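(* Let $\mathcal I=(I_j)_{j\in[n]}$ be a necklace for $\mathrm{Gr}(k,n)$ and let $B=\bigoplus_{j\in[n]}M_{I_j}\in\mathrm{CM}(C)$. Then, as subcategories of $\mathrm{CM}(C)$, $$\mathrm{CM}(B)=\bigcap_{j\in[n]}F(I_j,j-1),\qquad \mathrm{GP}(B)=\bigcap_{j\in[n]}S(I_j,j-1).$$
   Context: Fix integers $0<k<n$, $[n]=\{1,\dots,n\}$; $\binom{[n]}{k}$ is the set of $k$-subsets of $[n]$; vertex indices are taken mod $n$ (so vertex $0$ is vertex $n$). Let $Q$ be the quiver with vertex set $[n]$ and arrows $x_i:i\to i+1$, $y_i:i+1\to i$; $x=\sum_i x_i$, $y=\sum_i y_i$. $C=C_{k,n}$ is the quotient of the completed path algebra of $Q$ over $\mathbb C$ by $xy-yx=0$, $x^k-y^{n-k}=0$; $e_i$ is the idempotent at vertex $i$ and $t=xy$ (central). $\mathrm{CM}(C)$ is the full subcategory of finitely generated left $C$-modules (representations of $Q$) free over $\mathbb C[[t]]$. For $I\in\binom{[n]}{k}$, $M_I\in\mathrm{CM}(C)$ is the module with $e_iM_I=\mathbb C[[t]]$ for all $i$, where $x_{i-1}:e_{i-1}M_I\to e_iM_I$ is $1$ if $i\in I$ and $t$ if $i\notin I$, and $y_{i-1}:e_iM_I\to e_{i-1}M_I$ is $t$ if $i\in I$ and $1$ if $i\notin I$. $F(I,i)$ is the full subcategory of $M\in\mathrm{CM}(C)$ for which there are $r\in\mathbb N$ and an injection $M_I^r\hookrightarrow M$ inducing a surjection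 $e_iM_I^r\to e_iM$; $S(I,i)=\{M\in F(I,i):\mathrm{Ext}^1_C(M,M_I)=0\}$. The order $\le_i$ on $[n]$ is $i<_ii+1<_i\cdots<_in<_i1<_i\cdots<_ii-1$; on $\binom{[n]}{k}$, $I\le_iJ$ means: writing $I=\{i_1<_i\cdots<_ii_k\}$, $J=\{j_1<_i\cdots<_ij_k\}$, one has $i_s\le_ij_s$ for all $s$. Two $k$-subsets $I,J$ are weakly separated if there are no cyclically ordered $a,b,c,d\in[n]$ with $a,c\in I\setminus J$ and $b,d\in J\setminus I$. A necklace for $\mathrm{Gr}(k,n)$ is a family $(I_i)_{i\in[n]}$ in $\binom{[n]}{k}$ with $I_i\le_iI_j$ for all $i,j$ and $I_i,I_j$ weakly separated for all $i,j$. $\mathrm{CM}(B)=\{M\in\mathrm{CM}(C):\text{there is a surjection }B^s\to M\text{ for some }s\in\mathbb N\}$ and $\mathrm{GP}(B)=\{M\in\mathrm{CM}(B):\mathrm{Ext}^1_C(M,B)=0\}$. *)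

theory Defs
  imports
    "HOL-Algebra.Elementary_Groups"
    "HOL-Algebra.QuotRing"
    "HOL-Algebra.Module"
    "HOL-Computational_Algebra.Formal_Power_Series"
    "HOL.Complex"
begin

section \<open>Left modules over a possibly noncommutative ring\<close>

text \<open>The locale \<^locale>\<open>module\<close> of the library requires a commutative ring.  We keep its record
  type, whose fields \<^const>\<open>mult\<close> and \<^const>\<open>one\<close> play no role for modules, and drop
  commutativity of the scalars.\<close>

locale left_module = R?: ring R + M?: abelian_group M
  for R :: "('a, 'r) ring_scheme" (structure) and M :: "('a, 'm) module" (structure) +
  assumes smult_closed:
      "\<lbrakk>a \<in> carrier R; x \<in> carrier M\<rbrakk> \<Longrightarrow> a \<odot>\<^bsub>M\<^esub> x \<in> carrier M"
    and smult_l_distr: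
      "\<lbrakk>a \<in> carrier R; b \<in> carrier R; x \<in> carrier M\<rbrakk> \<Longrightarrow>
        (a \<oplus>\<^bsub>R\<^esub> b) \<odot>\<^bsub>M\<^esub> x = a \<odot>\<^bsub>M\<^esub> x \<oplus>\<^bsub>M\<^esub> b \<odot>\<^bsub>M\<^esub> x"
    and smult_r_distr:
      "\<lbrakk>a \<in> carrier R; x \<in> carrier M; y \<in> carrier M\<rbrakk> \<Longrightarrow>
        a \<odot>\<^bsub>M\<^esub> (x \<oplus>\<^bsub>M\<^esub> y) = a \<odot>\<^bsub>M\<^esub> x \<oplus>\<^bsub>M\<^esub> a \<odot>\<^bsub>M\<^esub> y"
    and smult_assoc:
      "\<lbrakk>a \<in> carrier R; b \<in> carrier R; x \<in> carrier M\<rbrakk> \<Longrightarrow>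
        (a \<otimes>\<^bsub>R\<^esub> b) \<odot>\<^bsub>M\<^esub> x = a \<odot>\<^bsub>M\<^esub> (b \<odot>\<^bsub>M\<^esub> x)"
    and smult_one:
      "x \<in> carrier M \<Longrightarrow> \<one>\<^bsub>R\<^esub> \<odot>\<^bsub>M\<^esub> x = x"

definition lmod_hom ::
    "('a, 'r) ring_scheme \<Rightarrow> ('a, 'm) module \<Rightarrow> ('a, 'n) module \<Rightarrow> ('m \<Rightarrow> 'n) set" where
  "lmod_hom R M N = {f \<in> carrier M \<rightarrow>\<^sub>E carrier N.
     (\<forall>x\<in>carrier M. \<forall>y\<in>carrier M. f (x \<oplus>\<^bsub>M\<^esub> y) = f x \<oplus>\<^bsub>N\<^esub> f y) \<and>
     (\<forall>a\<in>carrier R. \<forall>x\<in>carrier M. f (a \<odot>\<^bsub>M\<^esub> x) = a \<odot>\<^bsub>N\<^esub> f x)}"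

definition lmod_fin_gen :: "('a, 'r) ring_scheme \<Rightarrow> ('a, 'm) module \<Rightarrow> bool" where
  "lmod_fin_gen R M \<longleftrightarrow> (\<exists>S. finite S \<and> S \<subseteq> carrier M \<and>
     (\<forall>x\<in>carrier M. \<exists>a \<in> S \<rightarrow> carrier R. x = (\<Oplus>\<^bsub>M\<^esub>s\<in>S. a s \<odot>\<^bsub>M\<^esub> s)))"

text \<open>The direct sum of a family of modules; it is used for finite index sets \<open>J\<close> only.\<close>

definition lmod_sum :: "'i set \<Rightarrow> ('i \<Rightarrow> ('a, 'm) module) \<Rightarrow> ('a, 'i \<Rightarrow> 'm) module" where
  "lmod_sum J N =
    \<lparr>carrier = (\<Pi>\<^sub>E j\<in>J. carrier (N j)), monoid.mult = undefined, one = undefined,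
     ring.zero = (\<lambda>j\<in>J. \<zero>\<^bsub>N j\<^esub>), ring.add = (\<lambda>u v. \<lambda>j\<in>J. u j \<oplus>\<^bsub>N j\<^esub> v j),
     smult = (\<lambda>a u. \<lambda>j\<in>J. a \<odot>\<^bsub>N j\<^esub> u j)\<rparr>"

abbreviation lmod_pow :: "('a, 'm) module \<Rightarrow> nat \<Rightarrow> ('a, nat \<Rightarrow> 'm) module" where
  "lmod_pow M r \<equiv> lmod_sum {..<r} (\<lambda>_. M)"


section \<open>First extension groups\<close>

text \<open>\<open>free_lmod R S\<close> is the free module on the set \<open>S\<close>: finitely supported functions on \<open>S\<close>.\<close>

definition free_lmod :: "('a, 'r) ring_scheme \<Rightarrow> 's set \<Rightarrow> ('a, 's \<Rightarrow> 'a) module" where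
  "free_lmod R S =
    \<lparr>carrier = {u. (\<forall>s\<in>S. u s \<in> carrier R) \<and> (\<forall>s. s \<notin> S \<longrightarrow> u s = \<zero>\<^bsub>R\<^esub>) \<and>
                   finite {s. u s \<noteq> \<zero>\<^bsub>R\<^esub>}},
     monoid.mult = undefined, one = undefined, ring.zero = (\<lambda>_. \<zero>\<^bsub>R\<^esub>),
     ring.add = (\<lambda>u v s. u s \<oplus>\<^bsub>R\<^esub> v s), smult = (\<lambda>a u s. a \<otimes>\<^bsub>R\<^esub> u s)\<rparr>"

definition free_cover :: "('a, 'r) ring_scheme \<Rightarrow> ('a, 'm) module \<Rightarrow> ('a, 'm \<Rightarrow> 'a) module" where
  "free_cover R M = free_lmod R (carrier M)"

definition cover_map :: "('a, 'r) ring_scheme \<Rightarrow> ('a, 'm) module \<Rightarrow> ('m \<Rightarrow> 'a) \<Rightarrow> 'm" where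
  "cover_map R M u = (\<Oplus>\<^bsub>M\<^esub>m\<in>{m. u m \<noteq> \<zero>\<^bsub>R\<^esub>}. u m \<odot>\<^bsub>M\<^esub> m)"

definition syzygy :: "('a, 'r) ring_scheme \<Rightarrow> ('a, 'm) module \<Rightarrow> ('a, 'm \<Rightarrow> 'a) module" where
  "syzygy R M = (free_cover R M)
     \<lparr>carrier := {u \<in> carrier (free_cover R M). cover_map R M u = \<zero>\<^bsub>M\<^esub>}\<rparr>"

text \<open>Iterating free covers gives the canonical free resolution of \<open>M\<close>, with terms
  \<open>P\<^sub>0 = free_cover R M\<close>, \<open>P\<^sub>1 = free_cover R (syzygy R M)\<close>,
  \<open>P\<^sub>2 = free_cover R (syzygy R (syzygy R M))\<close>
  and differentials \<open>cover_map R (syzygy R M) : P\<^sub>1 \<rightarrow> P\<^sub>0\<close>,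
  \<open>cover_map R (syzygy R (syzygy R M)) : P\<^sub>2 \<rightarrow> P\<^sub>1\<close>.
  \<open>Ext1 R M N\<close> is the first cohomology group of \<open>Hom(P, N)\<close>, written multiplicatively.
  Only the underlying abelian group is recorded.\<close>

definition Ext1_cocycles ::
    "('a, 'r) ring_scheme \<Rightarrow> ('a, 'm) module \<Rightarrow> ('a, 'n) module \<Rightarrow> ((('m \<Rightarrow> 'a) \<Rightarrow> 'a) \<Rightarrow> 'n) monoid" where
  "Ext1_cocycles R M N =
    \<lparr>carrier = {f \<in> lmod_hom R (free_cover R (syzygy R M)) N.
        \<forall>w\<in>carrier (free_cover R (syzygy R (syzygy R M))).
          f (cover_map R (syzygy R (syzygy R M)) w) = \<zero>\<^bsub>N\<^esub>},
     monoid.mult = (\<lambda>f g. \<lambda>u\<in>carrier (free_cover R (syzygy R M)). f u \<oplus>\<^bsub>N\<^esub> g u),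
     one = (\<lambda>u\<in>carrier (free_cover R (syzygy R M)). \<zero>\<^bsub>N\<^esub>)\<rparr>"

definition Ext1_coboundaries ::
    "('a, 'r) ring_scheme \<Rightarrow> ('a, 'm) module \<Rightarrow> ('a, 'n) module \<Rightarrow> ((('m \<Rightarrow> 'a) \<Rightarrow> 'a) \<Rightarrow> 'n) set" where
  "Ext1_coboundaries R M N =
    (\<lambda>g. \<lambda>u\<in>carrier (free_cover R (syzygy R M)). g (cover_map R (syzygy R M) u)) `
      lmod_hom R (free_cover R M) N"

definition Ext1 ::
    "('a, 'r) ring_scheme \<Rightarrow> ('a, 'm) module \<Rightarrow> ('a, 'n) module \<Rightarrow> ((('m \<Rightarrow> 'a) \<Rightarrow> 'a) \<Rightarrow> 'n) set monoid" where
  "Ext1 R M N = Ext1_cocycles R M N Mod Ext1_coboundaries R M N"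


section \<open>The completed path algebra of the quiver\<close>

text \<open>Vertices are the elements of \<open>{1..n}\<close>; indices are read modulo \<open>n\<close>.\<close>

definition nextv :: "nat \<Rightarrow> nat \<Rightarrow> nat" where
  "nextv n i = (if i = n then 1 else i + 1)"

definition prevv :: "nat \<Rightarrow> nat \<Rightarrow> nat" where
  "prevv n i = (if i = 1 then n else i - 1)"

datatype arrow = X nat | Y nat

fun src :: "nat \<Rightarrow> arrow \<Rightarrow> nat" where
  "src n (X i) = i"
| "src n (Y i) = nextv n i"

fun tgt :: "nat \<Rightarrow> arrow \<Rightarrow> nat" where
  "tgt n (X i) = nextv n i"
| "tgt n (Y i) = i"

definition arrows :: "nat \<Rightarrow> arrow set" where
  "arrows n = X ` {1..n} \<union> Y ` {1..n}"

text \<open>Paths compose like maps, so that left modules are representations of the quiver: the pair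
  \<open>([a\<^sub>m, \<dots>, a\<^sub>1], i)\<close> is the path \<open>a\<^sub>m \<cdots> a\<^sub>1\<close> which starts at \<open>i\<close> with the arrow \<open>a\<^sub>1\<close>.\<close>

type_synonym path = "arrow list \<times> nat"

fun path_end :: "nat \<Rightarrow> path \<Rightarrow> nat" where
  "path_end n ([], i) = i"
| "path_end n (a # w, i) = tgt n a"

fun is_path :: "nat \<Rightarrow> path \<Rightarrow> bool" where
  "is_path n ([], i) \<longleftrightarrow> i \<in> {1..n}"
| "is_path n (a # w, i) \<longleftrightarrow> is_path n (w, i) \<and> a \<in> arrows n \<and> src n a = path_end n (w, i)"

text \<open>There are finitely many paths of each length, so the completion of the path algebra at the
  arrow ideal consists of all formal, possibly infinite, complex linear combinations of paths.\<close>

definition cpath_algebra :: "nat \<Rightarrow> (path \<Rightarrow> complex) ring" where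
  "cpath_algebra n =
    \<lparr>carrier = {f. \<forall>p. \<not> is_path n p \<longrightarrow> f p = 0},
     monoid.mult = (\<lambda>f g (w, i). \<Sum>m\<le>length w. f (take m w, path_end n (drop m w, i)) * g (drop m w, i)),
     one = (\<lambda>p. if is_path n p \<and> fst p = [] then 1 else 0),
     ring.zero = (\<lambda>_. 0),
     ring.add = (\<lambda>f g p. f p + g p)\<rparr>"

definition path_elem :: "path \<Rightarrow> path \<Rightarrow> complex" where
  "path_elem q = (\<lambda>p. if p = q then 1 else 0)"

definition x_elem :: "nat \<Rightarrow> path \<Rightarrow> complex" where
  "x_elem n = (\<lambda>p. \<Sum>i=1..n. path_elem ([X i], src n (X i)) p)"

definition y_elem :: "nat \<Rightarrow> path \<Rightarrow> complex" where
  "y_elem n = (\<lambda>p. \<Sum>i=1..n. path_elem ([Y i], src n (Y i)) p)"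

definition t_elem :: "nat \<Rightarrow> path \<Rightarrow> complex" where
  "t_elem n = x_elem n \<otimes>\<^bsub>cpath_algebra n\<^esub> y_elem n"

text \<open>The power series \<open>\<Sum>m. f\<^sub>m t\<^sup>m\<close>; as \<open>t\<^sup>m\<close> is supported on paths of length \<open>2 m\<close>, each
  coefficient is a finite sum.\<close>

definition t_series :: "nat \<Rightarrow> complex fps \<Rightarrow> path \<Rightarrow> complex" where
  "t_series n f = (\<lambda>p. \<Sum>m\<le>length (fst p). fps_nth f m * (t_elem n [^]\<^bsub>cpath_algebra n\<^esub> m) p)"

text \<open>Closure in the arrow-adic topology.\<close>

definition arrow_closure :: "nat \<Rightarrow> (path \<Rightarrow> complex) set \<Rightarrow> (path \<Rightarrow> complex) set" where
  "arrow_closure n J =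
    {f \<in> carrier (cpath_algebra n). \<forall>N. \<exists>g\<in>J. \<forall>p. length (fst p) < N \<longrightarrow> f p = g p}"


section \<open>The algebra C\<close>

text \<open>As usual for quotients of completed path algebras, the relations are imposed topologically:
  one divides by the closure of the ideal which they generate.\<close>

definition C_ideal :: "nat \<Rightarrow> nat \<Rightarrow> (path \<Rightarrow> complex) set" where
  "C_ideal k n = (let A = cpath_algebra n; x = x_elem n; y = y_elem n in
     arrow_closure n (Idl\<^bsub>A\<^esub>
       {(x \<otimes>\<^bsub>A\<^esub> y) \<ominus>\<^bsub>A\<^esub> (y \<otimes>\<^bsub>A\<^esub> x), (x [^]\<^bsub>A\<^esub> k) \<ominus>\<^bsub>A\<^esub> (y [^]\<^bsub>A\<^esub> (n - k))}))"

type_synonym C_elem = "(path \<Rightarrow> complex) set"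

definition C_alg :: "nat \<Rightarrow> nat \<Rightarrow> C_elem ring" where
  "C_alg k n = cpath_algebra n Quot C_ideal k n"

definition C_class :: "nat \<Rightarrow> nat \<Rightarrow> (path \<Rightarrow> complex) \<Rightarrow> C_elem" where
  "C_class k n f = C_ideal k n +>\<^bsub>cpath_algebra n\<^esub> f"

definition C_idem :: "nat \<Rightarrow> nat \<Rightarrow> nat \<Rightarrow> C_elem" where
  "C_idem k n i = C_class k n (path_elem ([], i))"

definition vertex_part :: "nat \<Rightarrow> nat \<Rightarrow> nat \<Rightarrow> (C_elem, 'm) module \<Rightarrow> 'm set" where
  "vertex_part k n i M = (\<lambda>m. C_idem k n i \<odot>\<^bsub>M\<^esub> m) ` carrier M"

text \<open>Freeness over the power series ring in \<open>t\<close>, which acts through \<^const>\<open>t_series\<close>: there is a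
  set \<open>S\<close> such that each element is a finite linear combination of \<open>S\<close> in exactly one way.\<close>

definition free_over_t :: "nat \<Rightarrow> nat \<Rightarrow> (C_elem, 'm) module \<Rightarrow> bool" where
  "free_over_t k n M \<longleftrightarrow> (\<exists>S \<subseteq> carrier M. \<forall>m\<in>carrier M. \<exists>!c :: 'm \<Rightarrow> complex fps.
     finite {s. c s \<noteq> 0} \<and> {s. c s \<noteq> 0} \<subseteq> S \<and>
     m = (\<Oplus>\<^bsub>M\<^esub>s\<in>{s. c s \<noteq> 0}. C_class k n (t_series n (c s)) \<odot>\<^bsub>M\<^esub> s))"

text \<open>Full subcategories of the category of modules are given by their sets of objects, where the
  type of the elements of the modules is arbitrary.\<close>

definition CM_C :: "nat \<Rightarrow> nat \<Rightarrow> (C_elem, 'm) module set" where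
  "CM_C k n = {M. left_module (C_alg k n) M \<and> lmod_fin_gen (C_alg k n) M \<and> free_over_t k n M}"


section \<open>The modules attached to k-subsets\<close>

text \<open>The arrow \<open>X i\<close> is the \<open>x\<close>-arrow into the vertex \<open>i + 1\<close>, and \<open>Y i\<close> is the \<open>y\<close>-arrow out
  of it, so the scalars of both depend on whether \<open>i + 1\<close> lies in \<open>I\<close>.\<close>

fun arrow_scalar :: "nat \<Rightarrow> nat set \<Rightarrow> arrow \<Rightarrow> complex fps" where
  "arrow_scalar n I (X i) = (if nextv n i \<in> I then 1 else fps_X)"
| "arrow_scalar n I (Y i) = (if nextv n i \<in> I then fps_X else 1)"

definition path_scalar :: "nat \<Rightarrow> nat set \<Rightarrow> path \<Rightarrow> complex fps" where
  "path_scalar n I p = (\<Prod>a\<leftarrow>fst p. arrow_scalar n I a)"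

text \<open>The component at the vertex \<open>j\<close> of \<open>f \<cdot> v\<close> is the sum of
  \<open>f(p) \<cdot> path_scalar n I p \<cdot> v\<^sub>i\<close> over all paths \<open>p : i \<rightarrow> j\<close>.  This sum converges in the power
  series ring: if \<open>I\<close> is neither empty nor everything, only finitely many paths contribute to the
  coefficient of a given degree \<open>d\<close>.\<close>

definition path_action ::
    "nat \<Rightarrow> nat set \<Rightarrow> (path \<Rightarrow> complex) \<Rightarrow> (nat \<Rightarrow> complex fps) \<Rightarrow> nat \<Rightarrow> complex fps" where
  "path_action n I f v j = Abs_fps (\<lambda>d.
     \<Sum>p | is_path n p \<and> path_end n p = j \<and> fps_nth (path_scalar n I p * v (snd p)) d \<noteq> 0.
       f p * fps_nth (path_scalar n I p * v (snd p)) d)"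

text \<open>A class in \<open>C\<close> acts through any of its representatives; the result does not depend on the
  choice if \<open>I\<close> is a \<open>k\<close>-subset of \<open>{1..n}\<close>.\<close>

definition M_mod :: "nat \<Rightarrow> nat set \<Rightarrow> (C_elem, nat \<Rightarrow> complex fps) module" where
  "M_mod n I =
    \<lparr>carrier = {v. \<forall>i. i \<notin> {1..n} \<longrightarrow> v i = 0}, monoid.mult = undefined, one = undefined,
     ring.zero = (\<lambda>_. 0), ring.add = (\<lambda>u v i. u i + v i),
     smult = (\<lambda>a v. path_action n I (SOME f. f \<in> a) v)\<rparr>"

definition F_cat :: "nat \<Rightarrow> nat \<Rightarrow> nat set \<Rightarrow> nat \<Rightarrow> (C_elem, 'm) module set" where
  "F_cat k n I i = {M \<in> CM_C k n. \<exists>r. \<exists>f \<in> lmod_hom (C_alg k n) (lmod_pow (M_mod n I) r) M.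
     inj_on f (carrier (lmod_pow (M_mod n I) r)) \<and>
     f ` vertex_part k n i (lmod_pow (M_mod n I) r) = vertex_part k n i M}"

definition S_cat :: "nat \<Rightarrow> nat \<Rightarrow> nat set \<Rightarrow> nat \<Rightarrow> (C_elem, 'm) module set" where
  "S_cat k n I i = {M \<in> F_cat k n I i. trivial_group (Ext1 (C_alg k n) M (M_mod n I))}"


section \<open>Necklaces\<close>

definition k_subsets :: "nat \<Rightarrow> nat \<Rightarrow> nat set set" where
  "k_subsets k n = {I. I \<subseteq> {1..n} \<and> card I = k}"

text \<open>The elements of \<open>{1..n}\<close> in the order \<open>i <\<^sub>i i+1 <\<^sub>i \<dots> <\<^sub>i n <\<^sub>i 1 <\<^sub>i \<dots> <\<^sub>i i-1\<close>, and
  the position of an element in it.\<close>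

definition cyc_list :: "nat \<Rightarrow> nat \<Rightarrow> nat list" where
  "cyc_list n i = [i..<Suc n] @ [1..<i]"

definition cyc_pos :: "nat \<Rightarrow> nat \<Rightarrow> nat \<Rightarrow> nat" where
  "cyc_pos n i a = (if i \<le> a then a - i else n - i + a)"

definition cyc_le :: "nat \<Rightarrow> nat \<Rightarrow> nat \<Rightarrow> nat \<Rightarrow> bool" where
  "cyc_le n i a b \<longleftrightarrow> cyc_pos n i a \<le> cyc_pos n i b"

definition subset_le :: "nat \<Rightarrow> nat \<Rightarrow> nat set \<Rightarrow> nat set \<Rightarrow> bool" where
  "subset_le n i I J \<longleftrightarrow>
     list_all2 (cyc_le n i) (filter (\<lambda>a. a \<in> I) (cyc_list n i)) (filter (\<lambda>a. a \<in> J) (cyc_list n i))"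

definition cyc_ordered :: "nat \<Rightarrow> nat \<Rightarrow> nat \<Rightarrow> nat \<Rightarrow> bool" where
  "cyc_ordered a b c d \<longleftrightarrow>
     (a < b \<and> b < c \<and> c < d) \<or> (b < c \<and> c < d \<and> d < a) \<or>
     (c < d \<and> d < a \<and> a < b) \<or> (d < a \<and> a < b \<and> b < c)"

definition weakly_separated :: "nat \<Rightarrow> nat set \<Rightarrow> nat set \<Rightarrow> bool" where
  "weakly_separated n I J \<longleftrightarrow>
     \<not> (\<exists>a\<in>{1..n}. \<exists>b\<in>{1..n}. \<exists>c\<in>{1..n}. \<exists>d\<in>{1..n}. cyc_ordered a b c d \<and>
          a \<in> I - J \<and> c \<in> I - J \<and> b \<in> J - I \<and> d \<in> J - I)"

definition necklace :: "nat \<Rightarrow> nat \<Rightarrow> (nat \<Rightarrow> nat set) \<Rightarrow> bool" where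
  "necklace k n \<I> \<longleftrightarrow>
     (\<forall>i\<in>{1..n}. \<I> i \<in> k_subsets k n) \<and>
     (\<forall>i\<in>{1..n}. \<forall>j\<in>{1..n}. subset_le n i (\<I> i) (\<I> j)) \<and>
     (\<forall>i\<in>{1..n}. \<forall>j\<in>{1..n}. weakly_separated n (\<I> i) (\<I> j))"

definition B_mod :: "nat \<Rightarrow> (nat \<Rightarrow> nat set) \<Rightarrow> (C_elem, nat \<Rightarrow> nat \<Rightarrow> complex fps) module" where
  "B_mod n \<I> = lmod_sum {1..n} (\<lambda>j. M_mod n (\<I> j))"

definition CM_B :: "nat \<Rightarrow> nat \<Rightarrow> (C_elem, 'b) module \<Rightarrow> (C_elem, 'm) module set" where
  "CM_B k n B = {M \<in> CM_C k n. \<exists>s. \<exists>f \<in> lmod_hom (C_alg k n) (lmod_pow B s) M.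
     f ` carrier (lmod_pow B s) = carrier M}"

definition GP_B :: "nat \<Rightarrow> nat \<Rightarrow> (C_elem, 'b) module \<Rightarrow> (C_elem, 'm) module set" where
  "GP_B k n B = {M \<in> CM_B k n B. trivial_group (Ext1 (C_alg k n) M B)}"

end

theory Submission
  imports Defs
begin

text \<open>
  Every module \<open>M\<close> in \<open>CM(C)\<close> is torsion-free over \<open>\<complex>[[t]]\<close>, and inverting \<open>t\<close> makes all arrows
  invertible.  A morphism out of \<open>M\<^sub>I\<close> is therefore determined by its value on the generator at one
  vertex \<open>i\<close>, and \<open>M \<in> F(I,i)\<close> says exactly that \<^emph>\<open>every\<close> element of \<open>e\<^sub>i M\<close> is such a value.
  For the nontrivial half (\<open>F_catI\<close>), a minimal family of values generating \<open>e\<^sub>i M\<close> is a basis,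
  because \<open>\<complex>[[t]]\<close> is local, and the corresponding morphisms \<open>M\<^sub>I \<rightarrow> M\<close> assemble to an injection.

  In this form membership in \<open>F(I,i)\<close> visibly passes to quotients and sums.  So
  \<open>CM(B) \<subseteq> F(I\<^sub>j, j-1)\<close> reduces to finding, for each \<open>l\<close>, a morphism \<open>M_(I\<^sub>j) \<rightarrow> M_(I\<^sub>l)\<close> which is the
  identity at the vertex \<open>j - 1\<close>.  Following the arrows \<open>x\<close> around the cycle from \<open>j - 1\<close>, it has to
  multiply by \<open>t\<close> to the power \<open>|I\<^sub>j \<inter> [j,m]| - |I\<^sub>l \<inter> [j,m]|\<close> at \<open>m\<close>, and these exponents are
  nonnegative precisely because \<open>I\<^sub>j \<le>\<^sub>j I\<^sub>l\<close> (\<open>subset_le_hom\<close>).  Conversely, if \<open>M\<close> lies in all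
  \<open>F(I\<^sub>j, j-1)\<close>, then powers of the \<open>M_(I\<^sub>j)\<close> jointly cover \<open>M\<close> at all vertices \<open>j - 1\<close>, and these are
  all the vertices (\<open>F_cat_Inter_subset_CM_B\<close>).  The statement about \<open>GP(B)\<close> follows, as \<open>Ext\<^sup>1\<close> is
  additive in its second argument (\<open>Ext1_lmod_sum_trivial_iff\<close>).

  To compute in \<open>C\<close> and to see that each \<open>M\<^sub>I\<close> is a \<open>C\<close>-module, give \<open>x\<close> the degree \<open>n - k\<close> and \<open>y\<close>
  the degree \<open>k\<close>.  Both relations are then homogeneous, and they identify paths that have the same
  ends and the same degree.  Counting paths by ends and degree sends an element of the path
  algebra to a matrix of power series in a variable \<open>q\<close>, its symbol; this is multiplicative and kills
  the relations, and \<open>t\<close> becomes \<open>q\<^sup>n\<close>.  The module \<open>M\<^sub>I\<close> embeds into columns of power series in \<open>q\<close>,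
  with \<open>q\<^sup>a \<complex>[[q\<^sup>n]]\<close> at a vertex of level \<open>a\<close>, in such a way that algebra elements act by matrix
  multiplication with their symbols.
\<close>

unbundle fps_syntax

section \<open>Left modules and their homomorphisms\<close>

lemma left_moduleI:
  assumes "ring R" "abelian_group M"
    and "\<And>a x. \<lbrakk>a \<in> carrier R; x \<in> carrier M\<rbrakk> \<Longrightarrow> a \<odot>\<^bsub>M\<^esub> x \<in> carrier M"
    and "\<And>a b x. \<lbrakk>a \<in> carrier R; b \<in> carrier R; x \<in> carrier M\<rbrakk> \<Longrightarrow>
        (a \<oplus>\<^bsub>R\<^esub> b) \<odot>\<^bsub>M\<^esub> x = a \<odot>\<^bsub>M\<^esub> x \<oplus>\<^bsub>M\<^esub> b \<odot>\<^bsub>M\<^esub> x"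
    and "\<And>a x y. \<lbrakk>a \<in> carrier R; x \<in> carrier M; y \<in> carrier M\<rbrakk> \<Longrightarrow>
        a \<odot>\<^bsub>M\<^esub> (x \<oplus>\<^bsub>M\<^esub> y) = a \<odot>\<^bsub>M\<^esub> x \<oplus>\<^bsub>M\<^esub> a \<odot>\<^bsub>M\<^esub> y"
    and "\<And>a b x. \<lbrakk>a \<in> carrier R; b \<in> carrier R; x \<in> carrier M\<rbrakk> \<Longrightarrow>
        (a \<otimes>\<^bsub>R\<^esub> b) \<odot>\<^bsub>M\<^esub> x = a \<odot>\<^bsub>M\<^esub> (b \<odot>\<^bsub>M\<^esub> x)"
    and "\<And>x. x \<in> carrier M \<Longrightarrow> \<one>\<^bsub>R\<^esub> \<odot>\<^bsub>M\<^esub> x = x"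
  shows "left_module R M"
  using assms by (auto intro!: left_module.intro left_module_axioms.intro)

context left_module
begin

lemma smult_l_null:
  assumes "x \<in> carrier M" shows "\<zero>\<^bsub>R\<^esub> \<odot>\<^bsub>M\<^esub> x = \<zero>\<^bsub>M\<^esub>"
proof -
  have c: "\<zero>\<^bsub>R\<^esub> \<odot>\<^bsub>M\<^esub> x \<in> carrier M" using assms by (simp add: smult_closed)
  have "\<zero>\<^bsub>R\<^esub> \<odot>\<^bsub>M\<^esub> x \<oplus>\<^bsub>M\<^esub> \<zero>\<^bsub>R\<^esub> \<odot>\<^bsub>M\<^esub> x = \<zero>\<^bsub>R\<^esub> \<odot>\<^bsub>M\<^esub> x"
    using smult_l_distr[of "\<zero>\<^bsub>R\<^esub>" "\<zero>\<^bsub>R\<^esub>" x] assms by simp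
  then show ?thesis using c M.add.r_cancel_one' by metis
qed

lemma smult_r_null:
  assumes "a \<in> carrier R" shows "a \<odot>\<^bsub>M\<^esub> \<zero>\<^bsub>M\<^esub> = \<zero>\<^bsub>M\<^esub>"
proof -
  have c: "a \<odot>\<^bsub>M\<^esub> \<zero>\<^bsub>M\<^esub> \<in> carrier M" using assms by (simp add: smult_closed)
  have "a \<odot>\<^bsub>M\<^esub> \<zero>\<^bsub>M\<^esub> \<oplus>\<^bsub>M\<^esub> a \<odot>\<^bsub>M\<^esub> \<zero>\<^bsub>M\<^esub> = a \<odot>\<^bsub>M\<^esub> \<zero>\<^bsub>M\<^esub>"
    using smult_r_distr[of a "\<zero>\<^bsub>M\<^esub>" "\<zero>\<^bsub>M\<^esub>"] assms by simp
  then show ?thesis using c M.add.r_cancel_one' by metis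
qed

text \<open>A subset closed under scalars contains the negatives of its elements, as these are multiples
  by \<open>- 1\<close>.\<close>
lemma smult_neg_one:
  assumes "x \<in> carrier M" shows "(\<ominus>\<^bsub>R\<^esub> \<one>\<^bsub>R\<^esub>) \<odot>\<^bsub>M\<^esub> x \<oplus>\<^bsub>M\<^esub> x = \<zero>\<^bsub>M\<^esub>"
  using smult_l_distr[of "\<ominus>\<^bsub>R\<^esub> \<one>\<^bsub>R\<^esub>" "\<one>\<^bsub>R\<^esub>" x] assms
  by (simp add: smult_one smult_l_null R.l_neg)

lemma smult_r_minus:
  assumes "a \<in> carrier R" "x \<in> carrier M"
  shows "a \<odot>\<^bsub>M\<^esub> (\<ominus>\<^bsub>M\<^esub> x) = \<ominus>\<^bsub>M\<^esub> (a \<odot>\<^bsub>M\<^esub> x)"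
proof -
  have "a \<odot>\<^bsub>M\<^esub> (\<ominus>\<^bsub>M\<^esub> x) \<oplus>\<^bsub>M\<^esub> a \<odot>\<^bsub>M\<^esub> x = \<zero>\<^bsub>M\<^esub>"
    using smult_r_distr[of a "\<ominus>\<^bsub>M\<^esub> x" x] assms by (simp add: M.l_neg smult_r_null)
  then show ?thesis
    using assms by (metis M.minus_equality M.a_inv_closed smult_closed)
qed

lemma smult_finsum:
  assumes "a \<in> carrier R" "f \<in> A \<rightarrow> carrier M"
  shows "a \<odot>\<^bsub>M\<^esub> (\<Oplus>\<^bsub>M\<^esub>i\<in>A. f i) = (\<Oplus>\<^bsub>M\<^esub>i\<in>A. a \<odot>\<^bsub>M\<^esub> f i)"
  using assms(2)
proof (induction A rule: infinite_finite_induct)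
  case (insert i A)
  then have "f \<in> A \<rightarrow> carrier M" "f i \<in> carrier M" by auto
  moreover from this have "(\<lambda>i. a \<odot>\<^bsub>M\<^esub> f i) \<in> A \<rightarrow> carrier M"
    using assms(1) smult_closed by auto
  ultimately show ?case
    using insert assms(1)
    by (simp add: M.finsum_insert smult_r_distr smult_closed)
qed (simp_all add: smult_r_null assms(1))

lemma left_module_submodule:
  assumes "K \<subseteq> carrier M" "\<zero>\<^bsub>M\<^esub> \<in> K"
    and add: "\<And>x y. \<lbrakk>x \<in> K; y \<in> K\<rbrakk> \<Longrightarrow> x \<oplus>\<^bsub>M\<^esub> y \<in> K"
    and sm: "\<And>a x. \<lbrakk>a \<in> carrier R; x \<in> K\<rbrakk> \<Longrightarrow> a \<odot>\<^bsub>M\<^esub> x \<in> K"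
  shows "left_module R (M\<lparr>carrier := K\<rparr>)"
proof (rule left_moduleI)
  show "ring R" by (rule R.ring_axioms)
  show "abelian_group (M\<lparr>carrier := K\<rparr>)"
  proof (rule abelian_groupI)
    fix x assume "x \<in> carrier (M\<lparr>carrier := K\<rparr>)"
    then have "(\<ominus>\<^bsub>R\<^esub> \<one>\<^bsub>R\<^esub>) \<odot>\<^bsub>M\<^esub> x \<in> K" "(\<ominus>\<^bsub>R\<^esub> \<one>\<^bsub>R\<^esub>) \<odot>\<^bsub>M\<^esub> x \<oplus>\<^bsub>M\<^esub> x = \<zero>\<^bsub>M\<^esub>"
      using sm smult_neg_one assms(1) by auto
    then show "\<exists>y\<in>carrier (M\<lparr>carrier := K\<rparr>). y \<oplus>\<^bsub>M\<lparr>carrier := K\<rparr>\<^esub> x = \<zero>\<^bsub>M\<lparr>carrier := K\<rparr>\<^esub>"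
      by auto
  qed (use assms in \<open>auto simp: M.a_assoc subset_iff intro: M.a_comm\<close>)
qed (use assms in \<open>auto simp: subset_iff smult_l_distr smult_r_distr smult_assoc smult_one\<close>)

end

lemma lmod_homI:
  assumes "f \<in> carrier M \<rightarrow>\<^sub>E carrier N"
    and "\<And>x y. \<lbrakk>x \<in> carrier M; y \<in> carrier M\<rbrakk> \<Longrightarrow> f (x \<oplus>\<^bsub>M\<^esub> y) = f x \<oplus>\<^bsub>N\<^esub> f y"
    and "\<And>a x. \<lbrakk>a \<in> carrier R; x \<in> carrier M\<rbrakk> \<Longrightarrow> f (a \<odot>\<^bsub>M\<^esub> x) = a \<odot>\<^bsub>N\<^esub> f x"
  shows "f \<in> lmod_hom R M N"
  using assms by (simp add: lmod_hom_def)

lemma restrict_lmod_homI: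
  assumes "left_module R M" "\<And>x. x \<in> carrier M \<Longrightarrow> f x \<in> carrier N"
    and "\<And>x y. \<lbrakk>x \<in> carrier M; y \<in> carrier M\<rbrakk> \<Longrightarrow> f (x \<oplus>\<^bsub>M\<^esub> y) = f x \<oplus>\<^bsub>N\<^esub> f y"
    and "\<And>a x. \<lbrakk>a \<in> carrier R; x \<in> carrier M\<rbrakk> \<Longrightarrow> f (a \<odot>\<^bsub>M\<^esub> x) = a \<odot>\<^bsub>N\<^esub> f x"
  shows "restrict f (carrier M) \<in> lmod_hom R M N"
proof -
  interpret left_module R M by fact
  show ?thesis
    using assms(2-) by (intro lmod_homI) (auto simp: smult_closed)
qed

lemma lmod_hom_closed: "\<lbrakk>f \<in> lmod_hom R M N; x \<in> carrier M\<rbrakk> \<Longrightarrow> f x \<in> carrier N"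
  by (auto simp: lmod_hom_def)

lemma lmod_hom_add:
  "\<lbrakk>f \<in> lmod_hom R M N; x \<in> carrier M; y \<in> carrier M\<rbrakk> \<Longrightarrow> f (x \<oplus>\<^bsub>M\<^esub> y) = f x \<oplus>\<^bsub>N\<^esub> f y"
  by (auto simp: lmod_hom_def)

lemma lmod_hom_smult:
  "\<lbrakk>f \<in> lmod_hom R M N; a \<in> carrier R; x \<in> carrier M\<rbrakk> \<Longrightarrow> f (a \<odot>\<^bsub>M\<^esub> x) = a \<odot>\<^bsub>N\<^esub> f x"
  by (auto simp: lmod_hom_def)

lemma lmod_hom_zero:
  assumes "left_module R M" "left_module R N" "f \<in> lmod_hom R M N"
  shows "f \<zero>\<^bsub>M\<^esub> = \<zero>\<^bsub>N\<^esub>"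
proof -
  interpret M: left_module R M by fact
  interpret N: left_module R N by fact
  have "f \<zero>\<^bsub>M\<^esub> \<oplus>\<^bsub>N\<^esub> f \<zero>\<^bsub>M\<^esub> = f \<zero>\<^bsub>M\<^esub>"
    using lmod_hom_add[OF assms(3), of "\<zero>\<^bsub>M\<^esub>" "\<zero>\<^bsub>M\<^esub>"] by simp
  moreover have "f \<zero>\<^bsub>M\<^esub> \<in> carrier N" using lmod_hom_closed[OF assms(3)] by simp
  ultimately show ?thesis using N.M.add.r_cancel_one' by metis
qed

lemma lmod_hom_comp:
  assumes "left_module R M" "f \<in> lmod_hom R M N" "g \<in> lmod_hom R N P"
  shows "(\<lambda>x\<in>carrier M. g (f x)) \<in> lmod_hom R M P"
  using assms
  by (intro restrict_lmod_homI) (auto simp: lmod_hom_add lmod_hom_smult lmod_hom_closed)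

lemma left_module_lmod_sum:
  assumes "ring R" "\<And>j. j \<in> J \<Longrightarrow> left_module R (N j)"
  shows "left_module R (lmod_sum J N)"
proof -
  have mon: "abelian_group (N j)" if "j \<in> J" for j
    using assms(2)[OF that] by (simp add: left_module_def)
  note ag = abelian_group.axioms(1)[OF mon]
  have mem: "u j \<in> carrier (N j)" if "u \<in> carrier (lmod_sum J N)" "j \<in> J" for u j
    using that by (auto simp: lmod_sum_def)
  have ext: "u = restrict u J" if "u \<in> carrier (lmod_sum J N)" for u
    using that by (simp add: lmod_sum_def PiE_restrict)
  have memI: "restrict u J \<in> carrier (lmod_sum J N)" if "\<And>j. j \<in> J \<Longrightarrow> u j \<in> carrier (N j)" for u
    using that by (simp add: lmod_sum_def)
  have ops: "u \<oplus>\<^bsub>lmod_sum J N\<^esub> v = (\<lambda>j\<in>J. u j \<oplus>\<^bsub>N j\<^esub> v j)" "\<zero>\<^bsub>lmod_sum J N\<^esub> = (\<lambda>j\<in>J. \<zero>\<^bsub>N j\<^esub>)"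
    "a \<odot>\<^bsub>lmod_sum J N\<^esub> u = (\<lambda>j\<in>J. a \<odot>\<^bsub>N j\<^esub> u j)" for a u v
    by (simp_all add: lmod_sum_def)
  show ?thesis
  proof (rule left_moduleI[OF assms(1)])
    show "abelian_group (lmod_sum J N)"
    proof (rule abelian_groupI)
      fix x assume x: "x \<in> carrier (lmod_sum J N)"
      have "(\<lambda>j\<in>J. \<ominus>\<^bsub>N j\<^esub> x j) \<in> carrier (lmod_sum J N)"
        using mem[OF x] abelian_group.a_inv_closed[OF mon] by (intro memI) auto
      moreover have "(\<lambda>j\<in>J. \<ominus>\<^bsub>N j\<^esub> x j) \<oplus>\<^bsub>lmod_sum J N\<^esub> x = \<zero>\<^bsub>lmod_sum J N\<^esub>"
        using mem[OF x] abelian_group.l_neg[OF mon] by (auto simp: ops intro!: restrict_ext)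
      ultimately show "\<exists>y\<in>carrier (lmod_sum J N). y \<oplus>\<^bsub>lmod_sum J N\<^esub> x = \<zero>\<^bsub>lmod_sum J N\<^esub>"
        by blast
      show "\<zero>\<^bsub>lmod_sum J N\<^esub> \<oplus>\<^bsub>lmod_sum J N\<^esub> x = x"
        using mem[OF x] by (subst (2) ext[OF x]) (auto simp: ops abelian_monoid.l_zero[OF ag] intro!: restrict_ext)
    next
      show "\<zero>\<^bsub>lmod_sum J N\<^esub> \<in> carrier (lmod_sum J N)"
        unfolding ops by (intro memI) (auto intro: abelian_monoid.zero_closed[OF ag])
    next
      fix x y assume xy: "x \<in> carrier (lmod_sum J N)" "y \<in> carrier (lmod_sum J N)"
      show "x \<oplus>\<^bsub>lmod_sum J N\<^esub> y \<in> carrier (lmod_sum J N)"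
        unfolding ops by (intro memI) (auto intro: abelian_monoid.a_closed[OF ag] mem[OF xy(1)] mem[OF xy(2)])
      show "x \<oplus>\<^bsub>lmod_sum J N\<^esub> y = y \<oplus>\<^bsub>lmod_sum J N\<^esub> x"
        unfolding ops by (rule restrict_ext) (rule abelian_monoid.a_comm[OF ag mem[OF xy(1)] mem[OF xy(2)]])
      fix z assume z: "z \<in> carrier (lmod_sum J N)"
      show "x \<oplus>\<^bsub>lmod_sum J N\<^esub> y \<oplus>\<^bsub>lmod_sum J N\<^esub> z = x \<oplus>\<^bsub>lmod_sum J N\<^esub> (y \<oplus>\<^bsub>lmod_sum J N\<^esub> z)"
        unfolding ops
        by (rule restrict_ext) (simp add: abelian_monoid.a_assoc[OF ag mem[OF xy(1)] mem[OF xy(2)] mem[OF z]])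
    qed
  next
    fix a x assume a: "a \<in> carrier R" and x: "x \<in> carrier (lmod_sum J N)"
    show "a \<odot>\<^bsub>lmod_sum J N\<^esub> x \<in> carrier (lmod_sum J N)"
      unfolding ops by (intro memI left_module.smult_closed[OF assms(2)] a mem[OF x])
    fix y assume y: "y \<in> carrier (lmod_sum J N)"
    show "a \<odot>\<^bsub>lmod_sum J N\<^esub> (x \<oplus>\<^bsub>lmod_sum J N\<^esub> y) =
        a \<odot>\<^bsub>lmod_sum J N\<^esub> x \<oplus>\<^bsub>lmod_sum J N\<^esub> a \<odot>\<^bsub>lmod_sum J N\<^esub> y"
      unfolding ops
      by (rule restrict_ext) (simp add: left_module.smult_r_distr[OF assms(2) a mem[OF x] mem[OF y]])
  next
    fix a b x assume a: "a \<in> carrier R" and b: "b \<in> carrier R" and x: "x \<in> carrier (lmod_sum J N)"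
    show "(a \<oplus>\<^bsub>R\<^esub> b) \<odot>\<^bsub>lmod_sum J N\<^esub> x = a \<odot>\<^bsub>lmod_sum J N\<^esub> x \<oplus>\<^bsub>lmod_sum J N\<^esub> b \<odot>\<^bsub>lmod_sum J N\<^esub> x"
      unfolding ops
      by (rule restrict_ext) (simp add: left_module.smult_l_distr[OF assms(2) a b mem[OF x]])
    show "(a \<otimes>\<^bsub>R\<^esub> b) \<odot>\<^bsub>lmod_sum J N\<^esub> x = a \<odot>\<^bsub>lmod_sum J N\<^esub> (b \<odot>\<^bsub>lmod_sum J N\<^esub> x)"
      unfolding ops
      by (rule restrict_ext) (simp add: left_module.smult_assoc[OF assms(2) a b mem[OF x]])
  next
    fix x assume x: "x \<in> carrier (lmod_sum J N)"
    show "\<one>\<^bsub>R\<^esub> \<odot>\<^bsub>lmod_sum J N\<^esub> x = x"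
      by (subst (2) ext[OF x], unfold ops, rule restrict_ext)
        (rule left_module.smult_one[OF assms(2) mem[OF x]])
  qed
qed

lemma lmod_sum_proj:
  assumes "j \<in> J" "f \<in> lmod_hom R P (lmod_sum J N)" "left_module R P"
  shows "(\<lambda>u\<in>carrier P. f u j) \<in> lmod_hom R P (N j)"
proof (rule restrict_lmod_homI[OF assms(3)])
  show "f u j \<in> carrier (N j)" if "u \<in> carrier P" for u
    using lmod_hom_closed[OF assms(2) that] assms(1) by (auto simp: lmod_sum_def)
qed (use assms(1) in \<open>simp_all add: lmod_hom_add[OF assms(2)] lmod_hom_smult[OF assms(2)] lmod_sum_def\<close>)

definition lmod_inj where
  "lmod_inj J N j v = (\<lambda>i\<in>J. if i = j then v else \<zero>\<^bsub>N i\<^esub>)"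

lemma lmod_inj_hom:
  assumes "\<And>i. i \<in> J \<Longrightarrow> left_module R (N i)" "j \<in> J"
  shows "(\<lambda>v\<in>carrier (N j). lmod_inj J N j v) \<in> lmod_hom R (N j) (lmod_sum J N)"
proof -
  have am: "abelian_monoid (N i)" if "i \<in> J" for i
    using assms(1)[OF that] by (simp add: left_module_def abelian_group_def)
  show ?thesis
    using assms
    by (intro restrict_lmod_homI)
      (auto simp: lmod_inj_def lmod_sum_def fun_eq_iff abelian_monoid.zero_closed[OF am]
        abelian_monoid.l_zero[OF am] left_module.smult_r_null[OF assms(1)])
qed

lemma lmod_inj_closed:
  assumes "\<And>i. i \<in> J \<Longrightarrow> left_module R (N i)" "j \<in> J" "v \<in> carrier (N j)"
  shows "lmod_inj J N j v \<in> carrier (lmod_sum J N)"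
  using lmod_hom_closed[OF lmod_inj_hom[of J R N j, OF assms(1,2)] assms(3)] assms(3) by simp

lemma lmod_hom_to_sum:
  assumes "left_module R P" "\<And>j. j \<in> J \<Longrightarrow> g j \<in> lmod_hom R P (N j)"
  shows "(\<lambda>u\<in>carrier P. \<lambda>j\<in>J. g j u) \<in> lmod_hom R P (lmod_sum J N)"
  using assms
  by (intro restrict_lmod_homI)
    (auto simp: lmod_sum_def fun_eq_iff lmod_hom_add[OF assms(2)] lmod_hom_smult[OF assms(2)]
      dest: lmod_hom_closed[OF assms(2)])

lemma lmod_hom_pointwise_sum:
  assumes "left_module R P" "left_module R M" "\<And>j. j \<in> J \<Longrightarrow> g j \<in> lmod_hom R P M"
  shows "(\<lambda>u\<in>carrier P. \<Oplus>\<^bsub>M\<^esub>j\<in>J. g j u) \<in> lmod_hom R P M"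
proof -
  interpret M: left_module R M by fact
  have c: "(\<lambda>j. g j u) \<in> J \<rightarrow> carrier M" if "u \<in> carrier P" for u
    using that lmod_hom_closed[OF assms(3)] by auto
  show ?thesis
  proof (rule restrict_lmod_homI[OF assms(1)])
    fix u assume u: "u \<in> carrier P"
    show "(\<Oplus>\<^bsub>M\<^esub>j\<in>J. g j u) \<in> carrier M"
      using c[OF u] by (rule M.M.finsum_closed)
    show "(\<Oplus>\<^bsub>M\<^esub>j\<in>J. g j (a \<odot>\<^bsub>P\<^esub> u)) = a \<odot>\<^bsub>M\<^esub> (\<Oplus>\<^bsub>M\<^esub>j\<in>J. g j u)"
      if a: "a \<in> carrier R" for a
      unfolding M.smult_finsum[OF a c[OF u]]
      by (rule M.M.finsum_cong'[OF refl])
        (use c[OF u] a M.smult_closed lmod_hom_smult[OF assms(3) a u] in auto)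
    fix v assume v: "v \<in> carrier P"
    show "(\<Oplus>\<^bsub>M\<^esub>j\<in>J. g j (u \<oplus>\<^bsub>P\<^esub> v)) = (\<Oplus>\<^bsub>M\<^esub>j\<in>J. g j u) \<oplus>\<^bsub>M\<^esub> (\<Oplus>\<^bsub>M\<^esub>j\<in>J. g j v)"
      unfolding M.M.finsum_addf[OF c[OF u] c[OF v], symmetric]
      by (rule M.M.finsum_cong'[OF refl])
        (use c[OF u] c[OF v] lmod_hom_add[OF assms(3) u v] in auto)
  qed
qed

lemma lmod_proj_hom:
  assumes "left_module R (lmod_sum J N)" "j \<in> J"
  shows "(\<lambda>u\<in>carrier (lmod_sum J N). u j) \<in> lmod_hom R (lmod_sum J N) (N j)"
  using assms by (intro restrict_lmod_homI) (auto simp: lmod_sum_def)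

text \<open>An additive property of elements of a finite direct sum only has to be checked on elements
  concentrated in a single summand.\<close>

lemma lmod_sum_induct [consumes 2, case_names zero add inj modules]:
  assumes "finite J" "u \<in> carrier (lmod_sum J N)"
    and zero: "P \<zero>\<^bsub>lmod_sum J N\<^esub>"
    and add: "\<And>u v. \<lbrakk>u \<in> carrier (lmod_sum J N); v \<in> carrier (lmod_sum J N); P u; P v\<rbrakk> \<Longrightarrow>
      P (u \<oplus>\<^bsub>lmod_sum J N\<^esub> v)"
    and inj: "\<And>j v. \<lbrakk>j \<in> J; v \<in> carrier (N j)\<rbrakk> \<Longrightarrow> P (lmod_inj J N j v)"
    and N: "\<And>j. j \<in> J \<Longrightarrow> left_module R (N j)"
  shows "P u"
proof -
  have am: "abelian_monoid (N i)" if "i \<in> J" for i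
    using N[OF that] by (simp add: left_module_def abelian_group_def)
  have u: "u \<in> (\<Pi>\<^sub>E j\<in>J. carrier (N j))" using assms(2) by (simp add: lmod_sum_def)
  have uj: "u j \<in> carrier (N j)" if "j \<in> J" for j using u that by auto
  let ?r = "\<lambda>F. \<lambda>j\<in>J. if j \<in> F then u j else \<zero>\<^bsub>N j\<^esub>"
  have cl: "?r F \<in> carrier (lmod_sum J N)" for F
    using uj abelian_monoid.zero_closed[OF am] by (auto simp: lmod_sum_def)
  have "P (?r F)" if "finite F" "F \<subseteq> J" for F
    using that
  proof (induction F)
    case empty
    have "?r {} = \<zero>\<^bsub>lmod_sum J N\<^esub>" by (simp add: lmod_sum_def restrict_def)
    then show ?case using zero by argo
  next
    case (insert i F)
    have i: "i \<in> J" using insert.prems by auto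
    have "?r (insert i F) = lmod_inj J N i (u i) \<oplus>\<^bsub>lmod_sum J N\<^esub> ?r F"
      unfolding lmod_inj_def lmod_sum_def ring.simps
      by (rule restrict_ext)
        (use insert.hyps in \<open>auto simp: abelian_monoid.zero_closed[OF am] uj
          abelian_monoid.l_zero[OF am] abelian_monoid.r_zero[OF am]\<close>)
    moreover have ic: "lmod_inj J N i (u i) \<in> carrier (lmod_sum J N)"
      by (rule lmod_inj_closed[of J R N, OF N i uj[OF i]])
    moreover have "P (?r F)" using insert.IH insert.prems by blast
    then have "P (lmod_inj J N i (u i) \<oplus>\<^bsub>lmod_sum J N\<^esub> ?r F)"
      by (rule add[OF ic cl inj[OF i uj[OF i]]])
    ultimately show ?case by argo
  qed
  from this[OF assms(1)] have "P (restrict u J)"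
    by (simp cong: restrict_cong)
  then show ?thesis using PiE_restrict[OF u] by simp
qed

section \<open>First extension groups\<close>

lemma left_module_free:
  assumes "ring R" shows "left_module R (free_lmod R S)"
proof -
  interpret ring R by fact
  show ?thesis
  proof (rule left_moduleI[OF assms])
    have fin: "finite {s. u s \<oplus>\<^bsub>R\<^esub> v s \<noteq> \<zero>\<^bsub>R\<^esub>}"
      if "finite {s. u s \<noteq> \<zero>\<^bsub>R\<^esub>}" "finite {s. v s \<noteq> \<zero>\<^bsub>R\<^esub>}" for u v :: "'s \<Rightarrow> 'a"
      using finite_UnI[OF that] by (rule rev_finite_subset) auto
    show "abelian_group (free_lmod R S)"
    proof (rule abelian_groupI)
      fix x assume x: "x \<in> carrier (free_lmod R S)"
      then have all: "x s \<in> carrier R" for s by (cases "s \<in> S") (auto simp: free_lmod_def)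
      have "(\<lambda>s. \<ominus>\<^bsub>R\<^esub> x s) \<in> carrier (free_lmod R S)"
        using x all by (auto simp: free_lmod_def elim!: rev_finite_subset)
      moreover have "(\<lambda>s. \<ominus>\<^bsub>R\<^esub> x s) \<oplus>\<^bsub>free_lmod R S\<^esub> x = \<zero>\<^bsub>free_lmod R S\<^esub>"
        using all by (auto simp: free_lmod_def fun_eq_iff l_neg)
      ultimately show "\<exists>y\<in>carrier (free_lmod R S). y \<oplus>\<^bsub>free_lmod R S\<^esub> x = \<zero>\<^bsub>free_lmod R S\<^esub>" by blast
    next
      fix x y assume "x \<in> carrier (free_lmod R S)" "y \<in> carrier (free_lmod R S)"
      then have "x s \<in> carrier R" "y s \<in> carrier R" for s
        by (cases "s \<in> S"; auto simp: free_lmod_def)+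
      then show "x \<oplus>\<^bsub>free_lmod R S\<^esub> y = y \<oplus>\<^bsub>free_lmod R S\<^esub> x"
        by (auto simp: free_lmod_def fun_eq_iff intro: a_comm)
    next
      fix x y z assume "x \<in> carrier (free_lmod R S)" "y \<in> carrier (free_lmod R S)" "z \<in> carrier (free_lmod R S)"
      then have "x s \<in> carrier R" "y s \<in> carrier R" "z s \<in> carrier R" for s
        by (cases "s \<in> S"; auto simp: free_lmod_def)+
      then show "x \<oplus>\<^bsub>free_lmod R S\<^esub> y \<oplus>\<^bsub>free_lmod R S\<^esub> z = x \<oplus>\<^bsub>free_lmod R S\<^esub> (y \<oplus>\<^bsub>free_lmod R S\<^esub> z)"
        by (auto simp: free_lmod_def fun_eq_iff a_assoc)
    next
      fix x assume "x \<in> carrier (free_lmod R S)"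
      then have "x s \<in> carrier R" for s by (cases "s \<in> S") (auto simp: free_lmod_def)
      then show "\<zero>\<^bsub>free_lmod R S\<^esub> \<oplus>\<^bsub>free_lmod R S\<^esub> x = x" by (auto simp: free_lmod_def)
    qed (auto simp: free_lmod_def fin)
    fix a u assume a: "a \<in> carrier R" and u: "u \<in> carrier (free_lmod R S)"
    have us: "u s \<in> carrier R" for s using u by (cases "s \<in> S") (auto simp: free_lmod_def)
    have "finite {s. a \<otimes>\<^bsub>R\<^esub> u s \<noteq> \<zero>\<^bsub>R\<^esub>}"
      using u a by (auto simp: free_lmod_def elim!: rev_finite_subset)
    then show "a \<odot>\<^bsub>free_lmod R S\<^esub> u \<in> carrier (free_lmod R S)"
      using u a by (auto simp: free_lmod_def)
    fix b assume b: "b \<in> carrier R"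
    show "(a \<oplus>\<^bsub>R\<^esub> b) \<odot>\<^bsub>free_lmod R S\<^esub> u =
        a \<odot>\<^bsub>free_lmod R S\<^esub> u \<oplus>\<^bsub>free_lmod R S\<^esub> b \<odot>\<^bsub>free_lmod R S\<^esub> u"
      using us a b by (simp add: free_lmod_def l_distr)
    show "(a \<otimes>\<^bsub>R\<^esub> b) \<odot>\<^bsub>free_lmod R S\<^esub> u = a \<odot>\<^bsub>free_lmod R S\<^esub> (b \<odot>\<^bsub>free_lmod R S\<^esub> u)"
      using us a b by (simp add: free_lmod_def m_assoc)
  next
    fix u assume "u \<in> carrier (free_lmod R S)"
    then have "u s \<in> carrier R" for s by (cases "s \<in> S") (auto simp: free_lmod_def)
    then show "\<one>\<^bsub>R\<^esub> \<odot>\<^bsub>free_lmod R S\<^esub> u = u" by (simp add: free_lmod_def)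
  next
    fix a u v assume "a \<in> carrier R" "u \<in> carrier (free_lmod R S)" "v \<in> carrier (free_lmod R S)"
    moreover from this have "u s \<in> carrier R" "v s \<in> carrier R" for s
      by (cases "s \<in> S"; auto simp: free_lmod_def)+
    ultimately show "a \<odot>\<^bsub>free_lmod R S\<^esub> (u \<oplus>\<^bsub>free_lmod R S\<^esub> v) =
        a \<odot>\<^bsub>free_lmod R S\<^esub> u \<oplus>\<^bsub>free_lmod R S\<^esub> a \<odot>\<^bsub>free_lmod R S\<^esub> v"
      by (simp add: free_lmod_def r_distr)
  qed
qed

context left_module
begin

lemma left_module_free_cover: "left_module R (free_cover R M)"
  unfolding free_cover_def by (rule left_module_free) (rule R.ring_axioms)

lemma free_cover_memD:
  assumes "u \<in> carrier (free_cover R M)"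
  shows "u s \<in> carrier R" "finite {m. u m \<noteq> \<zero>\<^bsub>R\<^esub>}" "{m. u m \<noteq> \<zero>\<^bsub>R\<^esub>} \<subseteq> carrier M"
  using assms by (cases "s \<in> carrier M"; auto simp: free_cover_def free_lmod_def)+

text \<open>The support of a sum or of a multiple may shrink, so linearity of the covering map is seen on
  a common finite set containing all supports involved.\<close>

lemma cover_map_superset:
  assumes u: "u \<in> carrier (free_cover R M)"
    and T: "finite T" "T \<subseteq> carrier M" "{m. u m \<noteq> \<zero>\<^bsub>R\<^esub>} \<subseteq> T"
  shows "cover_map R M u = (\<Oplus>\<^bsub>M\<^esub>m\<in>T. u m \<odot>\<^bsub>M\<^esub> m)"
  unfolding cover_map_def
  by (rule M.add.finprod_mono_neutral_cong_left)
    (use T free_cover_memD[OF u] in \<open>auto simp: smult_l_null smult_closed subset_iff\<close>)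

lemma cover_map_closed:
  assumes "u \<in> carrier (free_cover R M)" shows "cover_map R M u \<in> carrier M"
  unfolding cover_map_def
  by (rule M.finsum_closed) (use free_cover_memD[OF assms] smult_closed in auto)

lemma cover_map_add:
  assumes u: "u \<in> carrier (free_cover R M)" and v: "v \<in> carrier (free_cover R M)"
  shows "cover_map R M (u \<oplus>\<^bsub>free_cover R M\<^esub> v) = cover_map R M u \<oplus>\<^bsub>M\<^esub> cover_map R M v"
proof -
  interpret P: left_module R "free_cover R M" by (rule left_module_free_cover)
  let ?T = "{m. u m \<noteq> \<zero>\<^bsub>R\<^esub>} \<union> {m. v m \<noteq> \<zero>\<^bsub>R\<^esub>}"
  note uD = free_cover_memD[OF u] and vD = free_cover_memD[OF v]
  have T: "finite ?T" "?T \<subseteq> carrier M" using uD vD by auto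
  have s: "(u \<oplus>\<^bsub>free_cover R M\<^esub> v) m = u m \<oplus>\<^bsub>R\<^esub> v m" for m
    by (simp add: free_cover_def free_lmod_def)
  have uv: "u \<oplus>\<^bsub>free_cover R M\<^esub> v \<in> carrier (free_cover R M)" using u v by simp
  have "cover_map R M (u \<oplus>\<^bsub>free_cover R M\<^esub> v) = (\<Oplus>\<^bsub>M\<^esub>m\<in>?T. (u m \<oplus>\<^bsub>R\<^esub> v m) \<odot>\<^bsub>M\<^esub> m)"
    unfolding s[symmetric] by (rule cover_map_superset[OF uv T]) (auto simp: s)
  also have "\<dots> = (\<Oplus>\<^bsub>M\<^esub>m\<in>?T. u m \<odot>\<^bsub>M\<^esub> m \<oplus>\<^bsub>M\<^esub> v m \<odot>\<^bsub>M\<^esub> m)"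
    by (rule M.finsum_cong')
      (use uD(1) vD(1) T(2) in \<open>auto simp: subset_iff smult_closed intro!: smult_l_distr\<close>)
  also have "\<dots> = (\<Oplus>\<^bsub>M\<^esub>m\<in>?T. u m \<odot>\<^bsub>M\<^esub> m) \<oplus>\<^bsub>M\<^esub> (\<Oplus>\<^bsub>M\<^esub>m\<in>?T. v m \<odot>\<^bsub>M\<^esub> m)"
    by (rule M.finsum_addf) (use uD(1) vD(1) T(2) in \<open>auto simp: subset_iff smult_closed\<close>)
  also have "\<dots> = cover_map R M u \<oplus>\<^bsub>M\<^esub> cover_map R M v"
    using cover_map_superset[OF u T] cover_map_superset[OF v T] by simp
  finally show ?thesis .
qed

lemma cover_map_smult:
  assumes a: "a \<in> carrier R" and u: "u \<in> carrier (free_cover R M)"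
  shows "cover_map R M (a \<odot>\<^bsub>free_cover R M\<^esub> u) = a \<odot>\<^bsub>M\<^esub> cover_map R M u"
proof -
  interpret P: left_module R "free_cover R M" by (rule left_module_free_cover)
  let ?T = "{m. u m \<noteq> \<zero>\<^bsub>R\<^esub>}"
  note uD = free_cover_memD[OF u]
  have s: "(a \<odot>\<^bsub>free_cover R M\<^esub> u) m = a \<otimes>\<^bsub>R\<^esub> u m" for m
    by (simp add: free_cover_def free_lmod_def)
  have au: "a \<odot>\<^bsub>free_cover R M\<^esub> u \<in> carrier (free_cover R M)" using P.smult_closed u a by simp
  have "cover_map R M (a \<odot>\<^bsub>free_cover R M\<^esub> u) = (\<Oplus>\<^bsub>M\<^esub>m\<in>?T. (a \<otimes>\<^bsub>R\<^esub> u m) \<odot>\<^bsub>M\<^esub> m)"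
    unfolding s[symmetric] by (rule cover_map_superset[OF au uD(2,3)]) (use a in \<open>auto simp: s\<close>)
  also have "\<dots> = (\<Oplus>\<^bsub>M\<^esub>m\<in>?T. a \<odot>\<^bsub>M\<^esub> (u m \<odot>\<^bsub>M\<^esub> m))"
    by (rule M.finsum_cong')
      (use uD(1,3) a in \<open>auto simp: subset_iff smult_closed intro!: smult_assoc\<close>)
  also have "\<dots> = a \<odot>\<^bsub>M\<^esub> cover_map R M u"
    unfolding cover_map_def
    by (rule smult_finsum[symmetric, OF a]) (use uD(1,3) in \<open>auto simp: smult_closed\<close>)
  finally show ?thesis .
qed

lemma left_module_syzygy: "left_module R (syzygy R M)"
proof -
  interpret P: left_module R "free_cover R M" by (rule left_module_free_cover)
  have z: "cover_map R M \<zero>\<^bsub>free_cover R M\<^esub> = \<zero>\<^bsub>M\<^esub>"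
    by (simp add: cover_map_def free_cover_def free_lmod_def)
  show ?thesis
    unfolding syzygy_def
    by (rule P.left_module_submodule)
      (auto simp: z cover_map_add cover_map_smult P.smult_closed smult_r_null)
qed

end

text \<open>Cocycle groups have this form, with \<open>d\<close> the differential of the resolution; the empty set \<open>W\<close>
  gives the group of all homomorphisms, whose image is the group of coboundaries.\<close>
lemma hom_comm_group:
  assumes "left_module R P" "left_module R N" "d \<in> W \<rightarrow> carrier P"
  shows "comm_group \<lparr>carrier = {f \<in> lmod_hom R P N. \<forall>w\<in>W. f (d w) = \<zero>\<^bsub>N\<^esub>},
     monoid.mult = (\<lambda>f g. \<lambda>u\<in>carrier P. f u \<oplus>\<^bsub>N\<^esub> g u), one = (\<lambda>u\<in>carrier P. \<zero>\<^bsub>N\<^esub>)\<rparr>"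
    (is "comm_group ?G")
proof -
  interpret P: left_module R P by fact
  interpret N: left_module R N by fact
  have d: "d w \<in> carrier P" if "w \<in> W" for w using assms(3) that by auto
  show ?thesis
  proof (rule comm_groupI)
    fix f g assume "f \<in> carrier ?G" "g \<in> carrier ?G"
    then have fg: "f \<in> lmod_hom R P N" "g \<in> lmod_hom R P N" "\<And>w. w \<in> W \<Longrightarrow> f (d w) = \<zero>\<^bsub>N\<^esub>"
      "\<And>w. w \<in> W \<Longrightarrow> g (d w) = \<zero>\<^bsub>N\<^esub>" by auto
    have cl: "u \<in> carrier P \<Longrightarrow> f u \<in> carrier N" "u \<in> carrier P \<Longrightarrow> g u \<in> carrier N" for u
      using fg lmod_hom_closed by metis+
    have "(\<lambda>u\<in>carrier P. f u \<oplus>\<^bsub>N\<^esub> g u) \<in> lmod_hom R P N"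
      by (rule restrict_lmod_homI[OF assms(1)])
        (simp_all add: lmod_hom_add[OF fg(1)] lmod_hom_add[OF fg(2)] lmod_hom_smult[OF fg(1)]
          lmod_hom_smult[OF fg(2)] cl N.smult_r_distr N.M.add.m_ac)
    then show "f \<otimes>\<^bsub>?G\<^esub> g \<in> carrier ?G" using fg d by simp
    show "f \<otimes>\<^bsub>?G\<^esub> g = g \<otimes>\<^bsub>?G\<^esub> f" using cl by (auto simp: fun_eq_iff intro: N.M.a_comm)
  next
    show "\<one>\<^bsub>?G\<^esub> \<in> carrier ?G"
      using d by (auto intro!: restrict_lmod_homI[OF assms(1)] simp: N.smult_r_null)
  next
    fix f g h assume "f \<in> carrier ?G" "g \<in> carrier ?G" "h \<in> carrier ?G"
    then have "u \<in> carrier P \<Longrightarrow> f u \<in> carrier N" "u \<in> carrier P \<Longrightarrow> g u \<in> carrier N"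
      "u \<in> carrier P \<Longrightarrow> h u \<in> carrier N" for u
      using lmod_hom_closed by fastforce+
    then show "f \<otimes>\<^bsub>?G\<^esub> g \<otimes>\<^bsub>?G\<^esub> h = f \<otimes>\<^bsub>?G\<^esub> (g \<otimes>\<^bsub>?G\<^esub> h)"
      by (auto simp: fun_eq_iff N.M.a_assoc)
  next
    fix f assume "f \<in> carrier ?G"
    then have f: "f \<in> lmod_hom R P N" "\<And>w. w \<in> W \<Longrightarrow> f (d w) = \<zero>\<^bsub>N\<^esub>" by auto
    have cl: "u \<in> carrier P \<Longrightarrow> f u \<in> carrier N" for u
      using f lmod_hom_closed by metis
    have ext: "u \<notin> carrier P \<Longrightarrow> f u = undefined" for u
      using f by (auto simp: lmod_hom_def)
    show "\<one>\<^bsub>?G\<^esub> \<otimes>\<^bsub>?G\<^esub> f = f" using cl ext by (auto simp: fun_eq_iff)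
    have "(\<lambda>u\<in>carrier P. \<ominus>\<^bsub>N\<^esub> f u) \<in> carrier ?G"
      using f d by (auto intro!: restrict_lmod_homI[OF assms(1)] N.M.minus_add
        simp: lmod_hom_add[OF f(1)] lmod_hom_smult[OF f(1)] cl N.smult_r_minus)
    moreover have "(\<lambda>u\<in>carrier P. \<ominus>\<^bsub>N\<^esub> f u) \<otimes>\<^bsub>?G\<^esub> f = \<one>\<^bsub>?G\<^esub>"
      using cl by (auto simp: fun_eq_iff N.M.l_neg)
    ultimately show "\<exists>g\<in>carrier ?G. g \<otimes>\<^bsub>?G\<^esub> f = \<one>\<^bsub>?G\<^esub>" by blast
  qed
qed

lemma trivial_FactGroup_iff:
  assumes "comm_group G" "subgroup H G"
  shows "trivial_group (G Mod H) \<longleftrightarrow> carrier G \<subseteq> H"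
proof -
  interpret comm_group G by fact
  have n: "H \<lhd> G" using assms(2) by (simp add: normal_iff_subgroup)
  have "carrier (G Mod H) = {H} \<longleftrightarrow> carrier G \<subseteq> H"
  proof
    assume L: "carrier (G Mod H) = {H}"
    show "carrier G \<subseteq> H"
    proof
      fix f assume f: "f \<in> carrier G"
      then have "H #>\<^bsub>G\<^esub> f = H" using L by (auto simp: carrier_FactGroup)
      then show "f \<in> H" using rcos_self[OF f assms(2)] by simp
    qed
  next
    assume "carrier G \<subseteq> H"
    then have "\<And>f. f \<in> carrier G \<Longrightarrow> H #>\<^bsub>G\<^esub> f = H"
      using assms(2) coset_join2 by blast
    then show "carrier (G Mod H) = {H}" by (force simp: carrier_FactGroup)
  qed
  then show ?thesis
    using normal.factorgroup_is_group[OF n] by (simp add: trivial_group_def)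
qed

text \<open>The coboundaries are the image of a group homomorphism into the cocycles, since the composite of
  two consecutive differentials vanishes.  Hence they form a subgroup, and the quotient is trivial
  when they exhaust the cocycles.\<close>
lemma Ext1_trivial_iff:
  assumes M: "left_module R M" and N: "left_module R N"
  shows "trivial_group (Ext1 R M N) \<longleftrightarrow>
    (\<forall>f \<in> carrier (Ext1_cocycles R M N). \<exists>g \<in> lmod_hom R (free_cover R M) N.
      \<forall>u \<in> carrier (free_cover R (syzygy R M)). f u = g (cover_map R (syzygy R M) u))"
proof -
  interpret M: left_module R M by fact
  interpret N: left_module R N by fact
  let ?S = "syzygy R M"
  interpret S: left_module R ?S by (rule M.left_module_syzygy)
  interpret S2: left_module R "syzygy R ?S" by (rule S.left_module_syzygy)
  let ?P0 = "free_cover R M" and ?P1 = "free_cover R ?S" and ?P2 = "free_cover R (syzygy R ?S)"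
  have sub1: "carrier ?S \<subseteq> carrier ?P0" by (auto simp: syzygy_def)
  have d1: "cover_map R ?S u \<in> carrier ?P0" if "u \<in> carrier ?P1" for u
    using S.cover_map_closed[OF that] sub1 by auto
  have d2: "cover_map R (syzygy R ?S) w \<in> carrier ?P1"
    and dd: "cover_map R ?S (cover_map R (syzygy R ?S) w) = \<zero>\<^bsub>?P0\<^esub>" if "w \<in> carrier ?P2" for w
    using S2.cover_map_closed[OF that] by (auto simp: syzygy_def)
  have ops: "u \<oplus>\<^bsub>?S\<^esub> v = u \<oplus>\<^bsub>?P0\<^esub> v" "a \<odot>\<^bsub>?S\<^esub> u = a \<odot>\<^bsub>?P0\<^esub> u" for a u v
    by (simp_all add: syzygy_def)
  let ?G = "Ext1_cocycles R M N" and ?H = "Ext1_coboundaries R M N"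
  have G: "comm_group ?G"
    unfolding Ext1_cocycles_def
    by (rule hom_comm_group[OF S.left_module_free_cover N]) (use d2 in auto)
  define G0 where "G0 = \<lparr>carrier = {f \<in> lmod_hom R ?P0 N. \<forall>w\<in>{}. f (id w) = \<zero>\<^bsub>N\<^esub>},
     monoid.mult = (\<lambda>f g. \<lambda>u\<in>carrier ?P0. f u \<oplus>\<^bsub>N\<^esub> g u), one = (\<lambda>u\<in>carrier ?P0. \<zero>\<^bsub>N\<^esub>)\<rparr>"
  have G0: "comm_group G0"
    unfolding G0_def by (rule hom_comm_group[OF M.left_module_free_cover N]) auto
  let ?d = "\<lambda>g. \<lambda>u\<in>carrier ?P1. g (cover_map R ?S u)"
  have "?d \<in> hom G0 ?G"
  proof (rule homI)
    fix g assume "g \<in> carrier G0"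
    then have g: "g \<in> lmod_hom R ?P0 N" by (simp add: G0_def)
    have "?d g \<in> lmod_hom R ?P1 N"
      by (rule restrict_lmod_homI[OF S.left_module_free_cover])
        (simp_all add: lmod_hom_closed[OF g] d1 S.cover_map_add S.cover_map_smult ops
          lmod_hom_add[OF g] lmod_hom_smult[OF g])
    moreover have "?d g (cover_map R (syzygy R ?S) w) = \<zero>\<^bsub>N\<^esub>" if "w \<in> carrier ?P2" for w
      using d2[OF that] dd[OF that] lmod_hom_zero[OF M.left_module_free_cover N g] by simp
    ultimately show "?d g \<in> carrier ?G" by (simp add: Ext1_cocycles_def)
  next
    fix g h assume "g \<in> carrier G0" "h \<in> carrier G0"
    then show "?d (g \<otimes>\<^bsub>G0\<^esub> h) = ?d g \<otimes>\<^bsub>?G\<^esub> ?d h"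
      by (auto simp: G0_def Ext1_cocycles_def fun_eq_iff d1)
  qed
  then have "group_hom G0 ?G ?d"
    using G G0 by (simp add: group_hom_def group_hom_axioms_def comm_group_def)
  then have "subgroup (?d ` carrier G0) ?G" by (rule group_hom.img_is_subgroup)
  then have H: "subgroup ?H ?G" by (simp add: G0_def Ext1_coboundaries_def)
  have "f \<in> ?H \<longleftrightarrow> (\<exists>g \<in> lmod_hom R ?P0 N. \<forall>u \<in> carrier ?P1. f u = g (cover_map R ?S u))"
    if "f \<in> carrier ?G" for f
  proof -
    have "u \<notin> carrier ?P1 \<Longrightarrow> f u = undefined" for u
      using that by (auto simp: lmod_hom_def Ext1_cocycles_def)
    then show ?thesis unfolding Ext1_coboundaries_def image_iff fun_eq_iff by (auto simp: restrict_def)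
  qed
  then show ?thesis
    unfolding Ext1_def trivial_FactGroup_iff[OF G H] by blast
qed

text \<open>The canonical free resolution depends on \<open>M\<close> only, and homomorphisms into a product are families
  of homomorphisms.  So cocycles with values in the sum, and the cochains bounding them, can be
  treated one component at a time.\<close>
theorem Ext1_lmod_sum_trivial_iff:
  assumes "ring R" and M: "left_module R M" and N: "\<And>j. j \<in> J \<Longrightarrow> left_module R (N j)"
  shows "trivial_group (Ext1 R M (lmod_sum J N)) \<longleftrightarrow> (\<forall>j\<in>J. trivial_group (Ext1 R M (N j)))"
proof -
  interpret M: left_module R M by fact
  let ?S = "syzygy R M"
  interpret S: left_module R ?S by (rule M.left_module_syzygy)
  interpret S2: left_module R "syzygy R ?S" by (rule S.left_module_syzygy)
  let ?P0 = "free_cover R M" and ?P1 = "free_cover R ?S" and ?P2 = "free_cover R (syzygy R ?S)"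
  let ?d = "cover_map R ?S" and ?d2 = "cover_map R (syzygy R ?S)"
  have d2: "?d2 w \<in> carrier ?P1" if "w \<in> carrier ?P2" for w
    using S2.cover_map_closed[OF that] by (auto simp: syzygy_def)
  have d1: "?d u \<in> carrier ?P0" if "u \<in> carrier ?P1" for u
    using S.cover_map_closed[OF that] by (auto simp: syzygy_def)
  have sum: "left_module R (lmod_sum J N)" using assms by (intro left_module_lmod_sum) auto
  note P0 = M.left_module_free_cover and P1 = S.left_module_free_cover
  show ?thesis
  proof (intro iffI ballI)
    fix j assume triv: "trivial_group (Ext1 R M (lmod_sum J N))" and j: "j \<in> J"
    show "trivial_group (Ext1 R M (N j))"
      unfolding Ext1_trivial_iff[OF M N[OF j]]
    proof
      fix f assume "f \<in> carrier (Ext1_cocycles R M (N j))"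
      then have f: "f \<in> lmod_hom R ?P1 (N j)" "\<And>w. w \<in> carrier ?P2 \<Longrightarrow> f (?d2 w) = \<zero>\<^bsub>N j\<^esub>"
        by (auto simp: Ext1_cocycles_def)
      let ?F = "\<lambda>u\<in>carrier ?P1. (\<lambda>v\<in>carrier (N j). lmod_inj J N j v) (f u)"
      have F: "?F \<in> lmod_hom R ?P1 (lmod_sum J N)"
        by (rule lmod_hom_comp[OF P1 f(1) lmod_inj_hom[of J R N j, OF N j]])
      have Fu: "?F u = lmod_inj J N j (f u)" if "u \<in> carrier ?P1" for u
        using that lmod_hom_closed[OF f(1)] by simp
      have "?F (?d2 w) = \<zero>\<^bsub>lmod_sum J N\<^esub>" if "w \<in> carrier ?P2" for w
        unfolding Fu[OF d2[OF that]] f(2)[OF that] by (auto simp: lmod_sum_def lmod_inj_def)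
      then have "?F \<in> carrier (Ext1_cocycles R M (lmod_sum J N))"
        using F by (simp add: Ext1_cocycles_def)
      then obtain g where g: "g \<in> lmod_hom R ?P0 (lmod_sum J N)"
        "\<And>u. u \<in> carrier ?P1 \<Longrightarrow> ?F u = g (?d u)"
        using bspec[OF iffD1[OF Ext1_trivial_iff[OF M sum] triv]] by meson
      show "\<exists>g\<in>lmod_hom R ?P0 (N j). \<forall>u\<in>carrier ?P1. f u = g (?d u)"
      proof (intro bexI[OF _ lmod_sum_proj[OF j g(1) P0]] ballI)
        fix u assume u: "u \<in> carrier ?P1"
        have "g (?d u) = lmod_inj J N j (f u)" using g(2)[OF u] Fu[OF u] by metis
        then show "f u = (\<lambda>u\<in>carrier ?P0. g u j) (?d u)"
          using j d1[OF u] by (simp add: lmod_inj_def)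
      qed
    qed
  next
    assume triv: "\<forall>j\<in>J. trivial_group (Ext1 R M (N j))"
    show "trivial_group (Ext1 R M (lmod_sum J N))"
      unfolding Ext1_trivial_iff[OF M sum]
    proof
      fix f assume "f \<in> carrier (Ext1_cocycles R M (lmod_sum J N))"
      then have f: "f \<in> lmod_hom R ?P1 (lmod_sum J N)"
        "\<And>w. w \<in> carrier ?P2 \<Longrightarrow> f (?d2 w) = \<zero>\<^bsub>lmod_sum J N\<^esub>"
        by (auto simp: Ext1_cocycles_def)
      have "\<exists>g\<in>lmod_hom R ?P0 (N j). \<forall>u\<in>carrier ?P1. f u j = g (?d u)" if j: "j \<in> J" for j
      proof -
        have "(\<lambda>u\<in>carrier ?P1. f u j) \<in> carrier (Ext1_cocycles R M (N j))"
          using lmod_sum_proj[OF j f(1) P1] f(2) j d2 by (simp add: Ext1_cocycles_def lmod_sum_def)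
        then have "\<exists>g\<in>lmod_hom R ?P0 (N j). \<forall>u\<in>carrier ?P1. (\<lambda>u\<in>carrier ?P1. f u j) u = g (?d u)"
          by (rule bspec[OF iffD1[OF Ext1_trivial_iff[OF M N[OF j]] bspec[OF triv j]]])
        then show ?thesis by simp
      qed
      then obtain g where g: "\<And>j. j \<in> J \<Longrightarrow> g j \<in> lmod_hom R ?P0 (N j)"
        "\<And>j u. j \<in> J \<Longrightarrow> u \<in> carrier ?P1 \<Longrightarrow> f u j = g j (?d u)" by metis
      show "\<exists>g\<in>lmod_hom R ?P0 (lmod_sum J N). \<forall>u\<in>carrier ?P1. f u = g (?d u)"
      proof (intro bexI[OF _ lmod_hom_to_sum[OF P0 g(1)]] ballI)
        fix u assume u: "u \<in> carrier ?P1"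
        have "f u \<in> carrier (lmod_sum J N)" using lmod_hom_closed[OF f(1) u] .
        then have "f u \<in> extensional J" by (simp add: lmod_sum_def PiE_def)
        then show "f u = (\<lambda>u\<in>carrier ?P0. \<lambda>j\<in>J. g j u) (?d u)"
          using g(2)[OF _ u] d1[OF u] by (auto simp: fun_eq_iff extensional_def)
      qed
    qed
  qed
qed


section \<open>The completed path algebra and its symbol map\<close>

locale cyclic_quiver =
  fixes k n :: nat
  assumes k_pos: "0 < k" and k_less: "k < n"
begin

abbreviation "A \<equiv> cpath_algebra n"

lemma nextv_range: "i \<in> {1..n} \<Longrightarrow> nextv n i \<in> {1..n}"
  using k_less by (auto simp: nextv_def)

lemma prevv_range: "i \<in> {1..n} \<Longrightarrow> prevv n i \<in> {1..n}"
  using k_less by (auto simp: prevv_def)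

lemma prevv_nextv: "i \<in> {1..n} \<Longrightarrow> prevv n (nextv n i) = i"
  by (auto simp: prevv_def nextv_def)

lemma nextv_prevv: "i \<in> {1..n} \<Longrightarrow> nextv n (prevv n i) = i"
  by (auto simp: prevv_def nextv_def)

lemma tgt_range: "a \<in> arrows n \<Longrightarrow> tgt n a \<in> {1..n}"
  using nextv_range by (auto simp: arrows_def)

lemma path_end_append: "path_end n (u @ w, i) = path_end n (u, path_end n (w, i))"
  by (cases u) auto

lemma is_path_range:
  assumes "is_path n p" shows "snd p \<in> {1..n}" "path_end n p \<in> {1..n}"
proof -
  have "is_path n (w, i) \<Longrightarrow> i \<in> {1..n} \<and> path_end n (w, i) \<in> {1..n}" for w i
    by (induction w) (use tgt_range in auto)
  then show "snd p \<in> {1..n}" "path_end n p \<in> {1..n}" using assms by (metis prod.collapse)+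
qed

lemma is_path_append:
  "is_path n (u @ w, i) \<longleftrightarrow> is_path n (w, i) \<and> is_path n (u, path_end n (w, i))"
  by (induction u) (use is_path_range in \<open>fastforce simp: path_end_append\<close>)+

lemma is_path_arrows: "is_path n (w, i) \<Longrightarrow> set w \<subseteq> arrows n"
  by (induction w) auto

lemma is_path_split:
  "is_path n (w, i) \<longleftrightarrow> is_path n (drop m w, i) \<and> is_path n (take m w, path_end n (drop m w, i))"
  using is_path_append[of "take m w" "drop m w" i] by simp

lemma carrier_A: "f \<in> carrier A \<longleftrightarrow> (\<forall>p. \<not> is_path n p \<longrightarrow> f p = 0)"
  by (simp add: cpath_algebra_def)

lemma mult_A:
  "(f \<otimes>\<^bsub>A\<^esub> g) (w, i) =
    (\<Sum>m\<le>length w. f (take m w, path_end n (drop m w, i)) * g (drop m w, i))"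
  by (simp add: cpath_algebra_def)

lemma add_A: "(f \<oplus>\<^bsub>A\<^esub> g) = (\<lambda>p. f p + g p)"
  by (simp add: cpath_algebra_def)

lemma zero_A: "\<zero>\<^bsub>A\<^esub> = (\<lambda>_. 0)"
  by (simp add: cpath_algebra_def)

lemma one_A: "\<one>\<^bsub>A\<^esub> = (\<lambda>p. if is_path n p \<and> fst p = [] then 1 else 0)"
  by (simp add: cpath_algebra_def)

lemma mult_A_closed:
  assumes "f \<in> carrier A" "g \<in> carrier A" shows "f \<otimes>\<^bsub>A\<^esub> g \<in> carrier A"
proof -
  have "(f \<otimes>\<^bsub>A\<^esub> g) (w, i) = 0" if "\<not> is_path n (w, i)" for w i
    unfolding mult_A
  proof (intro sum.neutral ballI)
    fix m
    have "f (take m w, path_end n (drop m w, i)) = 0 \<or> g (drop m w, i) = 0"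
      using that assms is_path_split[of w i m] unfolding carrier_A by blast
    then show "f (take m w, path_end n (drop m w, i)) * g (drop m w, i) = 0" by auto
  qed
  then show ?thesis by (auto simp: carrier_A)
qed

text \<open>Both sides are sums over all ways of cutting the path into three pieces; \<open>l \<le> m\<close> are the
  lengths up to the two cuts.\<close>
lemma mult_A_assoc: "(f \<otimes>\<^bsub>A\<^esub> g) \<otimes>\<^bsub>A\<^esub> h = f \<otimes>\<^bsub>A\<^esub> (g \<otimes>\<^bsub>A\<^esub> h)"
proof (rule ext, clarify)
  fix w i
  let ?L = "length w" and ?e = "\<lambda>m. path_end n (drop m w, i)"
  define F where "F l m = f (take l w, ?e l) * g (drop l (take m w), ?e m) * h (drop m w, i)" for l m
  have "((f \<otimes>\<^bsub>A\<^esub> g) \<otimes>\<^bsub>A\<^esub> h) (w, i) = (\<Sum>m\<le>?L. \<Sum>l\<le>m. F l m)"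
    unfolding mult_A
  proof (rule sum.cong[OF refl])
    fix m assume m: "m \<in> {..?L}"
    have d: "path_end n (drop l (take m w), ?e m) = ?e l" if "l \<le> m" for l
    proof -
      have "drop l (take m w) @ drop m w = drop l w"
        using m that by (metis append_take_drop_id atMost_iff drop_append length_take min.absorb2
            diff_is_0_eq drop0)
      then show ?thesis by (metis path_end_append)
    qed
    show "(\<Sum>l\<le>length (take m w). f (take l (take m w), path_end n (drop l (take m w), ?e m)) *
          g (drop l (take m w), ?e m)) * h (drop m w, i) = (\<Sum>l\<le>m. F l m)"
      unfolding sum_distrib_right
      by (rule sum.cong) (use m d in \<open>auto simp: F_def min_def\<close>)
  qed
  also have "\<dots> = (\<Sum>l\<le>?L. \<Sum>m\<in>{l..?L}. F l m)"
    unfolding sum.Sigma[OF finite_atMost ballI[OF finite_atMost]]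
      sum.Sigma[OF finite_atMost ballI[OF finite_atLeastAtMost]]
    by (rule sum.reindex_bij_witness[where i = prod.swap and j = prod.swap]) auto
  also have "\<dots> = (\<Sum>l\<le>?L. f (take l w, ?e l) * (g \<otimes>\<^bsub>A\<^esub> h) (drop l w, i))"
  proof (rule sum.cong[OF refl])
    fix l assume l: "l \<in> {..?L}"
    have "(\<Sum>m\<in>{l..?L}. F l m) = (\<Sum>m\<le>?L - l. F l (m + l))"
      by (rule sum.reindex_bij_witness[where i = "\<lambda>m. m + l" and j = "\<lambda>m. m - l"]) (use l in auto)
    also have "\<dots> = f (take l w, ?e l) * (g \<otimes>\<^bsub>A\<^esub> h) (drop l w, i)"
      unfolding mult_A sum_distrib_left
      by (rule sum.cong) (auto simp: F_def drop_take add.commute mult.assoc)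
    finally show "(\<Sum>m\<in>{l..?L}. F l m) = f (take l w, ?e l) * (g \<otimes>\<^bsub>A\<^esub> h) (drop l w, i)" .
  qed
  also have "\<dots> = (f \<otimes>\<^bsub>A\<^esub> (g \<otimes>\<^bsub>A\<^esub> h)) (w, i)"
    by (simp add: mult_A)
  finally show "((f \<otimes>\<^bsub>A\<^esub> g) \<otimes>\<^bsub>A\<^esub> h) (w, i) = (f \<otimes>\<^bsub>A\<^esub> (g \<otimes>\<^bsub>A\<^esub> h)) (w, i)" .
qed

lemma one_mult_A:
  assumes "f \<in> carrier A" shows "\<one>\<^bsub>A\<^esub> \<otimes>\<^bsub>A\<^esub> f = f"
proof (rule ext, clarify)
  fix w i
  have "(\<one>\<^bsub>A\<^esub> \<otimes>\<^bsub>A\<^esub> f) (w, i) = (\<Sum>m\<le>length w. if m = 0 then f (w, i) else 0)"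
    unfolding mult_A
    by (rule sum.cong[OF refl])
      (use assms is_path_range(2)[of "(w, i)"] in \<open>auto simp: one_A carrier_A\<close>)
  then show "(\<one>\<^bsub>A\<^esub> \<otimes>\<^bsub>A\<^esub> f) (w, i) = f (w, i)" by simp
qed

lemma mult_A_one:
  assumes "f \<in> carrier A" shows "f \<otimes>\<^bsub>A\<^esub> \<one>\<^bsub>A\<^esub> = f"
proof (rule ext, clarify)
  fix w i
  have "(f \<otimes>\<^bsub>A\<^esub> \<one>\<^bsub>A\<^esub>) (w, i) = (\<Sum>m\<le>length w. if m = length w then f (w, i) else 0)"
    unfolding mult_A
    by (rule sum.cong[OF refl])
      (use assms is_path_range(1)[of "(w, i)"] in \<open>auto simp: one_A carrier_A\<close>)
  then show "(f \<otimes>\<^bsub>A\<^esub> \<one>\<^bsub>A\<^esub>) (w, i) = f (w, i)" by simp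
qed

lemma ring_A: "ring A"
proof (rule ringI)
  show "abelian_group A"
  proof (rule abelian_groupI)
    fix f assume "f \<in> carrier A"
    then show "\<exists>g\<in>carrier A. g \<oplus>\<^bsub>A\<^esub> f = \<zero>\<^bsub>A\<^esub>"
      by (intro bexI[of _ "\<lambda>p. - f p"]) (auto simp: carrier_A add_A zero_A)
  qed (auto simp: carrier_A add_A zero_A)
  show "monoid A"
    by (rule monoidI) (simp_all add: mult_A_closed mult_A_assoc one_mult_A mult_A_one,
        simp add: carrier_A one_A)
  show "(f \<oplus>\<^bsub>A\<^esub> g) \<otimes>\<^bsub>A\<^esub> h = f \<otimes>\<^bsub>A\<^esub> h \<oplus>\<^bsub>A\<^esub> g \<otimes>\<^bsub>A\<^esub> h" for f g h
    by (auto simp: fun_eq_iff mult_A add_A distrib_right sum.distrib)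
  show "h \<otimes>\<^bsub>A\<^esub> (f \<oplus>\<^bsub>A\<^esub> g) = h \<otimes>\<^bsub>A\<^esub> f \<oplus>\<^bsub>A\<^esub> h \<otimes>\<^bsub>A\<^esub> g" for f g h
    by (auto simp: fun_eq_iff mult_A add_A distrib_left sum.distrib)
qed

sublocale A: ring A by (rule ring_A)

lemma minus_A: "f \<in> carrier A \<Longrightarrow> \<ominus>\<^bsub>A\<^esub> f = (\<lambda>p. - f p)"
  by (rule A.minus_equality) (auto simp: carrier_A add_A zero_A)

lemma diff_A: "\<lbrakk>f \<in> carrier A; g \<in> carrier A\<rbrakk> \<Longrightarrow> f \<ominus>\<^bsub>A\<^esub> g = (\<lambda>p. f p - g p)"
  by (simp add: a_minus_def minus_A add_A)

lemma path_elem_closed: "is_path n p \<Longrightarrow> path_elem p \<in> carrier A"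
  by (auto simp: carrier_A path_elem_def)

subsection \<open>The grading and the symbol map\<close>

text \<open>With these degrees \<open>x\<^sup>k\<close> and \<open>y\<^sup>n\<^sup>-\<^sup>k\<close> both have degree \<open>k (n - k)\<close>, so the relations are
  homogeneous, and \<open>t = x y\<close> has degree \<open>n\<close>.  All degrees are positive, so there are only finitely
  many paths of a given degree.\<close>
fun arrow_deg :: "arrow \<Rightarrow> nat" where
  "arrow_deg (X i) = n - k"
| "arrow_deg (Y i) = k"

definition path_deg :: "arrow list \<Rightarrow> nat" where
  "path_deg w = (\<Sum>a\<leftarrow>w. arrow_deg a)"

lemma path_deg_append: "path_deg (u @ w) = path_deg u + path_deg w"
  by (simp add: path_deg_def)

lemma length_le_path_deg: "length w \<le> path_deg w"
proof (induction w)
  case (Cons a w)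
  moreover have "1 \<le> arrow_deg a" using k_pos k_less by (cases a) auto
  ultimately show ?case by (simp add: path_deg_def)
qed simp

definition paths :: "nat \<Rightarrow> nat \<Rightarrow> nat \<Rightarrow> path set" where
  "paths i j D = {p. is_path n p \<and> snd p = i \<and> path_end n p = j \<and> path_deg (fst p) = D}"

lemma finite_short_paths: "finite {p. is_path n p \<and> length (fst p) \<le> N}"
proof (rule finite_subset)
  show "{p. is_path n p \<and> length (fst p) \<le> N} \<subseteq>
      {w. set w \<subseteq> arrows n \<and> length w \<le> N} \<times> {1..n}"
    using is_path_arrows is_path_range(1) by fastforce
  show "finite ({w. set w \<subseteq> arrows n \<and> length w \<le> N} \<times> {1..n})"
    by (intro finite_cartesian_product finite_lists_length_le) (simp_all add: arrows_def)
qed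

lemma paths_length: "p \<in> paths i j D \<Longrightarrow> length (fst p) \<le> D"
  using length_le_path_deg[of "fst p"] by (auto simp: paths_def)

lemma finite_paths: "finite (paths i j D)"
  by (rule finite_subset[OF _ finite_short_paths[of D]]) (use paths_length in \<open>auto simp: paths_def\<close>)

text \<open>The entry at \<open>(i, j)\<close> is the generating function, by degree, of the coefficients at the paths
  from \<open>i\<close> to \<open>j\<close>.\<close>
definition symb :: "(path \<Rightarrow> complex) \<Rightarrow> nat \<Rightarrow> nat \<Rightarrow> complex fps" where
  "symb f i j = Abs_fps (\<lambda>D. \<Sum>p\<in>paths i j D. f p)"

text \<open>A path together with a cutting point is the same as a pair of composable paths, and the degree
  is additive.  So the symbol turns the product of the path algebra into the product of matrices.\<close>
lemma symb_mult: "symb (f \<otimes>\<^bsub>A\<^esub> g) i j = (\<Sum>l\<in>{1..n}. symb f l j * symb g i l)"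
proof (rule fps_ext)
  fix D
  let ?T = "SIGMA l:{1..n}. SIGMA d:{0..D}. paths l j d \<times> paths i l (D - d)"
  have "symb (f \<otimes>\<^bsub>A\<^esub> g) i j $ D = (\<Sum>p\<in>paths i j D. \<Sum>m\<le>length (fst p).
      f (take m (fst p), path_end n (drop m (fst p), i)) * g (drop m (fst p), i))"
    unfolding symb_def fps_nth_Abs_fps by (rule sum.cong) (auto simp: paths_def mult_A)
  also have "\<dots> = (\<Sum>(p, m)\<in>(SIGMA p:paths i j D. {..length (fst p)}).
      f (take m (fst p), path_end n (drop m (fst p), i)) * g (drop m (fst p), i))"
    by (rule sum.Sigma) (auto simp: finite_paths)
  also have "\<dots> = (\<Sum>(l, d, p, q)\<in>?T. f p * g q)"
  proof (rule sum.reindex_bij_witness[where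
        i = "\<lambda>(l, d, p, q). ((fst p @ fst q, i), length (fst p))" and
        j = "\<lambda>(p, m). (path_end n (drop m (fst p), i), path_deg (take m (fst p)),
          (take m (fst p), path_end n (drop m (fst p), i)), (drop m (fst p), i))"])
    fix a assume a: "a \<in> (SIGMA p:paths i j D. {..length (fst p)})"
    obtain w m where am: "a = ((w, i), m)" and m: "m \<le> length w"
      and w: "is_path n (w, i)" "path_end n (w, i) = j" "path_deg w = D"
      using a by (cases a) (auto simp: paths_def)
    have d: "path_deg (take m w) + path_deg (drop m w) = D"
      using w(3) path_deg_append[of "take m w" "drop m w"] by simp
    have e: "path_end n (take m w, path_end n (drop m w, i)) = j"
      using w(2) path_end_append[of "take m w" "drop m w" i] by simp
    have p: "is_path n (drop m w, i)" "is_path n (take m w, path_end n (drop m w, i))"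
      using w(1) is_path_split by auto
    show "(case a of (p, m) \<Rightarrow> (path_end n (drop m (fst p), i), path_deg (take m (fst p)),
          (take m (fst p), path_end n (drop m (fst p), i)), (drop m (fst p), i))) \<in> ?T"
      using d e p is_path_range(2)[OF p(1)] by (auto simp: am paths_def)
    show "(case (case a of (p, m) \<Rightarrow> (path_end n (drop m (fst p), i), path_deg (take m (fst p)),
          (take m (fst p), path_end n (drop m (fst p), i)), (drop m (fst p), i))) of
          (l, d, p, q) \<Rightarrow> ((fst p @ fst q, i), length (fst p))) = a"
      using m by (simp add: am)
  qed (auto simp: paths_def is_path_append path_end_append path_deg_append)
  also have "\<dots> = (\<Sum>l\<in>{1..n}. \<Sum>d=0..D. \<Sum>p\<in>paths l j d. \<Sum>q\<in>paths i l (D - d). f p * g q)"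
    by (simp add: sum.Sigma finite_paths sum.cartesian_product split_def)
  also have "\<dots> = (\<Sum>l\<in>{1..n}. symb f l j * symb g i l) $ D"
    by (simp add: fps_sum_nth fps_mult_nth symb_def sum_product)
  finally show "symb (f \<otimes>\<^bsub>A\<^esub> g) i j $ D = (\<Sum>l\<in>{1..n}. symb f l j * symb g i l) $ D" .
qed

lemma symb_add: "symb (\<lambda>p. f p + g p) i j = symb f i j + symb g i j"
  by (rule fps_ext) (simp add: symb_def sum.distrib)

lemma symb_diff: "symb (\<lambda>p. f p - g p) i j = symb f i j - symb g i j"
  by (rule fps_ext) (simp add: symb_def sum_subtractf)

lemma symb_sum: "symb (\<lambda>p. \<Sum>a\<in>S. f a p) i j = (\<Sum>a\<in>S. symb (f a) i j)"
  by (rule fps_ext) (simp add: symb_def fps_sum_nth sum.swap[of _ S])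

lemma symb_zero: "symb (\<lambda>_. 0) i j = 0"
  by (rule fps_ext) (simp add: symb_def)

lemma symb_path_elem:
  assumes "is_path n p"
  shows "symb (path_elem p) i j =
    (if snd p = i \<and> path_end n p = j then fps_X ^ path_deg (fst p) else 0)"
proof (rule fps_ext)
  fix D
  have "symb (path_elem p) i j $ D = (if p \<in> paths i j D then 1 else 0)"
    using finite_paths by (simp add: symb_def path_elem_def sum.delta')
  then show "symb (path_elem p) i j $ D =
    (if snd p = i \<and> path_end n p = j then fps_X ^ path_deg (fst p) else 0) $ D"
    using assms by (auto simp: paths_def)
qed

lemma symb_one:
  assumes "i \<in> {1..n}" shows "symb \<one>\<^bsub>A\<^esub> i j = (if i = j then 1 else 0)"
proof (rule fps_ext)
  fix D
  have "symb \<one>\<^bsub>A\<^esub> i j $ D = (\<Sum>p\<in>paths i j D. if p = ([], i) then 1 else 0)"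
    unfolding symb_def fps_nth_Abs_fps
    by (rule sum.cong) (auto simp: one_A paths_def split: if_splits)
  also have "\<dots> = (if ([], i) \<in> paths i j D then 1 else 0)"
    using finite_paths by (simp add: sum.delta')
  also have "\<dots> = (if i = j then 1 else 0) $ D"
    using assms by (auto simp: paths_def path_deg_def)
  finally show "symb \<one>\<^bsub>A\<^esub> i j $ D = (if i = j then 1 else 0) $ D" .
qed

lemma nextv_pow_range: "i \<in> {1..n} \<Longrightarrow> (nextv n ^^ m) i \<in> {1..n}"
  by (induction m) (use nextv_range in auto)

lemma prevv_pow_nextv_pow: "i \<in> {1..n} \<Longrightarrow> (prevv n ^^ m) ((nextv n ^^ m) i) = i"
proof (induction m)
  case (Suc m)
  have "(prevv n ^^ Suc m) ((nextv n ^^ Suc m) i) =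
      (prevv n ^^ m) (prevv n (nextv n ((nextv n ^^ m) i)))"
    by (simp add: funpow_swap1)
  also have "\<dots> = i" using Suc nextv_pow_range[of i m] by (simp only: prevv_nextv)
  finally show ?case .
qed simp

lemma nextv_pow: "i \<in> {1..n} \<Longrightarrow> (nextv n ^^ m) i = (i - 1 + m) mod n + 1"
proof (induction m)
  case (Suc m)
  then have "(nextv n ^^ Suc m) i = nextv n ((i - 1 + m) mod n + 1)" by simp
  moreover have "i - 1 + Suc m = Suc (i - 1 + m)" by simp
  ultimately show ?case by (simp add: nextv_def[of n "Suc _"] mod_Suc)
qed auto

text \<open>The paths \<open>x\<^sup>k\<close> and \<open>y\<^sup>n\<^sup>-\<^sup>k\<close> from \<open>i\<close> end at the same vertex, since together they go once around
  the cycle.\<close>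
lemma prevv_pow_eq_nextv_pow:
  assumes "i \<in> {1..n}" shows "(prevv n ^^ (n - k)) i = (nextv n ^^ k) i"
proof -
  have "i = (nextv n ^^ (n - k)) ((nextv n ^^ k) i)"
  proof -
    have "(nextv n ^^ n) i = i" using nextv_pow[OF assms, of n] assms by auto
    then show ?thesis using k_less funpow_add[of "n - k" k "nextv n"] by simp
  qed
  then show ?thesis using prevv_pow_nextv_pow[OF nextv_pow_range[OF assms]] by metis
qed

lemma x_closed: "x_elem n \<in> carrier A"
  unfolding carrier_A x_elem_def path_elem_def
  by (auto intro!: sum.neutral simp: arrows_def)

lemma y_closed: "y_elem n \<in> carrier A"
  using nextv_range unfolding carrier_A y_elem_def path_elem_def
  by (auto intro!: sum.neutral simp: arrows_def)

lemma symb_x: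
  assumes "i \<in> {1..n}" shows "symb (x_elem n) i j = (if j = nextv n i then fps_X ^ (n - k) else 0)"
proof -
  have "symb (x_elem n) i j = (\<Sum>a\<in>{1..n}. symb (path_elem ([X a], a)) i j)"
    unfolding x_elem_def src.simps by (rule symb_sum)
  also have "\<dots> = (\<Sum>a\<in>{1..n}. if a = i then if j = nextv n i then fps_X ^ (n - k) else 0 else 0)"
    by (rule sum.cong[OF refl], subst symb_path_elem) (auto simp: arrows_def path_deg_def)
  finally show ?thesis using assms by simp
qed

lemma symb_y:
  assumes "i \<in> {1..n}" shows "symb (y_elem n) i j = (if j = prevv n i then fps_X ^ k else 0)"
proof -
  have "symb (y_elem n) i j = (\<Sum>a\<in>{1..n}. symb (path_elem ([Y a], nextv n a)) i j)"
    unfolding y_elem_def src.simps by (rule symb_sum)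
  also have "\<dots> = (\<Sum>a\<in>{1..n}. if a = prevv n i then if j = prevv n i then fps_X ^ k else 0 else 0)"
  proof (rule sum.cong[OF refl])
    fix a assume a: "a \<in> {1..n}"
    then have "is_path n ([Y a], nextv n a)" using nextv_range by (auto simp: arrows_def)
    moreover have "nextv n a = i \<longleftrightarrow> a = prevv n i" using prevv_nextv nextv_prevv a assms by metis
    ultimately show "symb (path_elem ([Y a], nextv n a)) i j =
        (if a = prevv n i then if j = prevv n i then fps_X ^ k else 0 else 0)"
      by (subst symb_path_elem) (auto simp: path_deg_def)
  qed
  finally show ?thesis using prevv_range[OF assms] by simp
qed

lemma symb_x_pow:
  assumes "i \<in> {1..n}"
  shows "symb (x_elem n [^]\<^bsub>A\<^esub> m) i j = (if j = (nextv n ^^ m) i then fps_X ^ (m * (n - k)) else 0)"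
  using assms
proof (induction m arbitrary: i)
  case 0
  then show ?case using symb_one by auto
next
  case (Suc m)
  have "symb (x_elem n [^]\<^bsub>A\<^esub> Suc m) i j = (\<Sum>l\<in>{1..n}. if l = nextv n i then
      symb (x_elem n [^]\<^bsub>A\<^esub> m) l j * fps_X ^ (n - k) else 0)"
    unfolding A.nat_pow_Suc symb_mult by (rule sum.cong) (use Suc.prems symb_x in auto)
  also have "\<dots> = symb (x_elem n [^]\<^bsub>A\<^esub> m) (nextv n i) j * fps_X ^ (n - k)"
    using nextv_range[OF Suc.prems] by simp
  finally show ?case
    using Suc.IH[OF nextv_range[OF Suc.prems]] by (simp add: funpow_swap1 power_add mult.commute)
qed

lemma symb_y_pow:
  assumes "i \<in> {1..n}"
  shows "symb (y_elem n [^]\<^bsub>A\<^esub> m) i j = (if j = (prevv n ^^ m) i then fps_X ^ (m * k) else 0)"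
  using assms
proof (induction m arbitrary: i)
  case 0
  then show ?case using symb_one by auto
next
  case (Suc m)
  have "symb (y_elem n [^]\<^bsub>A\<^esub> Suc m) i j = (\<Sum>l\<in>{1..n}. if l = prevv n i then
      symb (y_elem n [^]\<^bsub>A\<^esub> m) l j * fps_X ^ k else 0)"
    unfolding A.nat_pow_Suc symb_mult by (rule sum.cong) (use Suc.prems symb_y in auto)
  also have "\<dots> = symb (y_elem n [^]\<^bsub>A\<^esub> m) (prevv n i) j * fps_X ^ k"
    using prevv_range[OF Suc.prems] by simp
  finally show ?case
    using Suc.IH[OF prevv_range[OF Suc.prems]] by (simp add: funpow_swap1 power_add mult.commute)
qed

lemma symb_xy:
  assumes "i \<in> {1..n}"
  shows "symb (x_elem n \<otimes>\<^bsub>A\<^esub> y_elem n) i j = (if i = j then fps_X ^ n else 0)"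
proof -
  have "symb (x_elem n \<otimes>\<^bsub>A\<^esub> y_elem n) i j = (\<Sum>l\<in>{1..n}. if l = prevv n i then
      symb (x_elem n) l j * fps_X ^ k else 0)"
    unfolding symb_mult by (rule sum.cong) (use assms symb_y in auto)
  also have "\<dots> = symb (x_elem n) (prevv n i) j * fps_X ^ k" using prevv_range[OF assms] by simp
  finally show ?thesis
    using symb_x[OF prevv_range[OF assms]] nextv_prevv[OF assms] k_less by (simp flip: power_add)
qed

lemma symb_yx:
  assumes "i \<in> {1..n}"
  shows "symb (y_elem n \<otimes>\<^bsub>A\<^esub> x_elem n) i j = (if i = j then fps_X ^ n else 0)"
proof -
  have "symb (y_elem n \<otimes>\<^bsub>A\<^esub> x_elem n) i j = (\<Sum>l\<in>{1..n}. if l = nextv n i then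
      symb (y_elem n) l j * fps_X ^ (n - k) else 0)"
    unfolding symb_mult by (rule sum.cong) (use assms symb_x in auto)
  also have "\<dots> = symb (y_elem n) (nextv n i) j * fps_X ^ (n - k)" using nextv_range[OF assms] by simp
  finally show ?thesis
    using symb_y[OF nextv_range[OF assms]] prevv_nextv[OF assms] k_less by (simp flip: power_add)
qed

subsection \<open>The relations\<close>
definition symb_ker :: "(path \<Rightarrow> complex) set" where
  "symb_ker = {f \<in> carrier A. \<forall>i\<in>{1..n}. \<forall>j. symb f i j = 0}"

lemma ideal_symb_ker: "ideal symb_ker A"
proof (rule idealI[OF ring_A])
  have "symb (\<lambda>p. - f p) i j = - symb f i j" for f i j
    using symb_diff[of "\<lambda>_. 0" f i j] by (simp add: symb_zero)
  then show "subgroup symb_ker (add_monoid A)"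
    by (intro A.add.subgroupI)
      (auto simp: symb_ker_def minus_A[unfolded a_inv_def] add_A symb_add A.a_closed[unfolded add_A]
        symb_zero simp flip: a_inv_def intro!: exI[of _ "\<lambda>_. 0"] simp: carrier_A minus_A)
qed (auto simp: symb_ker_def symb_mult intro!: sum.neutral)

text \<open>A coefficient of the symbol in degree \<open>D\<close> only depends on paths of length at most \<open>D\<close>, so the
  kernel of the symbol map is closed.\<close>
lemma arrow_closure_symb_ker:
  assumes "J \<subseteq> symb_ker" shows "arrow_closure n J \<subseteq> symb_ker"
proof
  fix f assume f: "f \<in> arrow_closure n J"
  have "symb f i j $ D = 0" if i: "i \<in> {1..n}" for i j D
  proof -
    obtain g where g: "g \<in> J" "\<And>p. length (fst p) < Suc D \<Longrightarrow> f p = g p"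
      using f unfolding arrow_closure_def by blast
    have "symb f i j $ D = symb g i j $ D"
      unfolding symb_def fps_nth_Abs_fps
      by (rule sum.cong) (use g(2) paths_length in \<open>auto simp: less_Suc_eq_le\<close>)
    then show ?thesis using g(1) assms i by (auto simp: symb_ker_def)
  qed
  then show "f \<in> symb_ker"
    using f by (auto simp: symb_ker_def arrow_closure_def fps_eq_iff)
qed

lemma ideal_arrow_closure:
  assumes "ideal J A" shows "ideal (arrow_closure n J) A"
proof (rule idealI[OF ring_A])
  interpret J: ideal J A by fact
  show "subgroup (arrow_closure n J) (add_monoid A)"
  proof (rule A.add.subgroupI)
    show "arrow_closure n J \<subseteq> carrier A" by (auto simp: arrow_closure_def)
    have "\<zero>\<^bsub>A\<^esub> \<in> arrow_closure n J"
      unfolding arrow_closure_def using J.zero_closed by blast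
    then show "arrow_closure n J \<noteq> {}" by blast
  next
    fix f assume f: "f \<in> arrow_closure n J"
    show "\<ominus>\<^bsub>A\<^esub> f \<in> arrow_closure n J"
      unfolding arrow_closure_def mem_Collect_eq
    proof (intro conjI allI)
      show "\<ominus>\<^bsub>A\<^esub> f \<in> carrier A" using f by (simp add: arrow_closure_def)
      fix N
      obtain g where g: "g \<in> J" "\<And>p. length (fst p) < N \<Longrightarrow> f p = g p"
        using f unfolding arrow_closure_def by blast
      show "\<exists>g\<in>J. \<forall>p. length (fst p) < N \<longrightarrow> (\<ominus>\<^bsub>A\<^esub> f) p = g p"
        using f g J.a_inv_closed[OF g(1)] J.a_Hcarr[OF g(1)]
        by (intro bexI[of _ "\<ominus>\<^bsub>A\<^esub> g"]) (auto simp: minus_A arrow_closure_def)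
    qed
  next
    fix f f' assume f: "f \<in> arrow_closure n J" "f' \<in> arrow_closure n J"
    show "f \<oplus>\<^bsub>A\<^esub> f' \<in> arrow_closure n J"
      unfolding arrow_closure_def mem_Collect_eq
    proof (intro conjI allI)
      show "f \<oplus>\<^bsub>A\<^esub> f' \<in> carrier A" using f by (simp add: arrow_closure_def)
      fix N
      obtain g g' where g: "g \<in> J" "\<And>p. length (fst p) < N \<Longrightarrow> f p = g p"
        "g' \<in> J" "\<And>p. length (fst p) < N \<Longrightarrow> f' p = g' p"
        using f unfolding arrow_closure_def by blast
      then show "\<exists>g\<in>J. \<forall>p. length (fst p) < N \<longrightarrow> (f \<oplus>\<^bsub>A\<^esub> f') p = g p"
        by (intro bexI[of _ "g \<oplus>\<^bsub>A\<^esub> g'"]) (auto simp: add_A intro: J.a_closed[unfolded add_A])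
    qed
  qed
next
  interpret J: ideal J A by fact
  fix f h assume f: "f \<in> arrow_closure n J" and h: "h \<in> carrier A"
  have fc: "f \<in> carrier A" using f by (simp add: arrow_closure_def)
  have ex: "\<exists>g\<in>J. \<forall>p. length (fst p) < N \<longrightarrow> f p = g p" for N
    using f unfolding arrow_closure_def by blast
  show "h \<otimes>\<^bsub>A\<^esub> f \<in> arrow_closure n J"
    unfolding arrow_closure_def mem_Collect_eq
  proof (intro conjI allI)
    fix N
    obtain g where g: "g \<in> J" "\<And>p. length (fst p) < N \<Longrightarrow> f p = g p" using ex by blast
    have "(h \<otimes>\<^bsub>A\<^esub> f) p = (h \<otimes>\<^bsub>A\<^esub> g) p" if "length (fst p) < N" for p
      using that by (cases p) (auto simp: mult_A g(2) intro!: sum.cong)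
    then show "\<exists>g\<in>J. \<forall>p. length (fst p) < N \<longrightarrow> (h \<otimes>\<^bsub>A\<^esub> f) p = g p"
      using J.I_l_closed[OF g(1) h] by blast
  qed (use fc h in simp)
  show "f \<otimes>\<^bsub>A\<^esub> h \<in> arrow_closure n J"
    unfolding arrow_closure_def mem_Collect_eq
  proof (intro conjI allI)
    fix N
    obtain g where g: "g \<in> J" "\<And>p. length (fst p) < N \<Longrightarrow> f p = g p" using ex by blast
    have "(f \<otimes>\<^bsub>A\<^esub> h) p = (g \<otimes>\<^bsub>A\<^esub> h) p" if "length (fst p) < N" for p
      using that by (cases p) (auto simp: mult_A g(2) intro!: sum.cong)
    then show "\<exists>g\<in>J. \<forall>p. length (fst p) < N \<longrightarrow> (f \<otimes>\<^bsub>A\<^esub> h) p = g p"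
      using J.I_r_closed[OF g(1) h] by blast
  qed (use fc h in simp)
qed

lemma C_ideal_alt: "C_ideal k n = arrow_closure n (Idl\<^bsub>A\<^esub>
    {(x_elem n \<otimes>\<^bsub>A\<^esub> y_elem n) \<ominus>\<^bsub>A\<^esub> (y_elem n \<otimes>\<^bsub>A\<^esub> x_elem n),
     (x_elem n [^]\<^bsub>A\<^esub> k) \<ominus>\<^bsub>A\<^esub> (y_elem n [^]\<^bsub>A\<^esub> (n - k))})"
  by (simp add: C_ideal_def Let_def)

lemma ideal_C_ideal: "ideal (C_ideal k n) A"
  unfolding C_ideal_alt
  by (intro ideal_arrow_closure A.genideal_ideal) (simp add: x_closed y_closed)

sublocale I: ideal "C_ideal k n" A by (rule ideal_C_ideal)

lemma diff_in_symb_ker: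
  assumes "f \<in> carrier A" "g \<in> carrier A"
    and "\<And>i j. i \<in> {1..n} \<Longrightarrow> symb f i j = symb g i j"
  shows "f \<ominus>\<^bsub>A\<^esub> g \<in> symb_ker"
proof -
  have "f \<ominus>\<^bsub>A\<^esub> g \<in> carrier A" using assms by simp
  then show ?thesis using assms by (simp add: symb_ker_def diff_A symb_diff)
qed

lemma C_ideal_symb_ker: "C_ideal k n \<subseteq> symb_ker"
proof -
  have "x_elem n \<otimes>\<^bsub>A\<^esub> y_elem n \<ominus>\<^bsub>A\<^esub> y_elem n \<otimes>\<^bsub>A\<^esub> x_elem n \<in> symb_ker"
    by (rule diff_in_symb_ker) (simp_all add: x_closed y_closed symb_xy symb_yx)
  moreover have "x_elem n [^]\<^bsub>A\<^esub> k \<ominus>\<^bsub>A\<^esub> y_elem n [^]\<^bsub>A\<^esub> (n - k) \<in> symb_ker"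
    by (rule diff_in_symb_ker)
      (simp_all add: x_closed y_closed symb_x_pow symb_y_pow prevv_pow_eq_nextv_pow mult.commute)
  ultimately show ?thesis
    unfolding C_ideal_alt by (intro arrow_closure_symb_ker A.genideal_minimal[OF ideal_symb_ker]) simp
qed

lemma ring_C: "ring (C_alg k n)"
  unfolding C_alg_def by (rule I.quotient_is_ring)

lemma C_class_hom: "C_class k n \<in> ring_hom A (C_alg k n)"
  using I.rcos_ring_hom by (simp add: C_class_def[abs_def] C_alg_def)

lemmas C_class_closed = ring_hom_closed[OF C_class_hom]
lemmas C_class_add = ring_hom_add[OF C_class_hom]
lemmas C_class_mult = ring_hom_mult[OF C_class_hom]
lemmas C_class_one = ring_hom_one[OF C_class_hom]

lemma C_alg_cases:
  assumes "a \<in> carrier (C_alg k n)"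
  obtains f where "f \<in> carrier A" "a = C_class k n f"
  using assms unfolding C_alg_def C_class_def FactRing_def A_RCOSETS_def' by auto

text \<open>An element of \<open>C\<close> acts on \<open>M\<^sub>I\<close> through an arbitrarily chosen representative.  The symbol does not
  see the choice.\<close>
lemma C_class_some:
  assumes f: "f \<in> carrier A" and i: "i \<in> {1..n}"
  shows "symb (SOME g. g \<in> C_class k n f) i j = symb f i j"
proof -
  have "f \<in> C_class k n f" unfolding C_class_def by (rule I.a_rcos_self[OF f])
  then have "(SOME g. g \<in> C_class k n f) \<in> C_class k n f" by (rule someI[of "\<lambda>g. g \<in> C_class k n f"])
  then obtain h where h: "h \<in> C_ideal k n" "(SOME g. g \<in> C_class k n f) = h \<oplus>\<^bsub>A\<^esub> f"
    unfolding C_class_def a_r_coset_def' by auto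
  have "symb h i j = 0" using h(1) C_ideal_symb_ker i by (auto simp: symb_ker_def)
  then show ?thesis by (simp add: h(2) add_A symb_add)
qed

subsection \<open>The central element\<close>

lemma t_closed: "t_elem n \<in> carrier A"
  by (simp add: t_elem_def x_closed y_closed)

lemma symb_t_pow:
  assumes "i \<in> {1..n}"
  shows "symb (t_elem n [^]\<^bsub>A\<^esub> m) i j = (if i = j then fps_X ^ (n * m) else 0)"
  using assms
proof (induction m arbitrary: i)
  case 0
  then show ?case using symb_one by auto
next
  case (Suc m)
  have "symb (t_elem n [^]\<^bsub>A\<^esub> Suc m) i j = (\<Sum>l\<in>{1..n}. if l = i then
      symb (t_elem n [^]\<^bsub>A\<^esub> m) l j * fps_X ^ n else 0)"
    unfolding A.nat_pow_Suc symb_mult by (rule sum.cong) (use Suc.prems in \<open>auto simp: t_elem_def symb_xy\<close>)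
  also have "\<dots> = symb (t_elem n [^]\<^bsub>A\<^esub> m) i j * fps_X ^ n" using Suc.prems by simp
  finally show ?case using Suc.IH[OF Suc.prems] by (simp add: power_add mult.commute)
qed

lemma homogeneous_mult:
  assumes "\<And>p. f p \<noteq> 0 \<Longrightarrow> length (fst p) = a" "\<And>p. g p \<noteq> 0 \<Longrightarrow> length (fst p) = b"
    and "(f \<otimes>\<^bsub>A\<^esub> g) p \<noteq> 0"
  shows "length (fst p) = a + b"
proof -
  obtain w i where p: "p = (w, i)" by (cases p)
  from assms(3) obtain m where "f (take m w, path_end n (drop m w, i)) * g (drop m w, i) \<noteq> 0" "m \<le> length w"
    unfolding p mult_A by (meson atMost_iff sum.neutral)
  then have "length (take m w) = a" "length (drop m w) = b" "m \<le> length w" using assms(1,2) by fastforce+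
  then show ?thesis by (simp add: p)
qed

lemma t_pow_length:
  "(t_elem n [^]\<^bsub>A\<^esub> m) p \<noteq> 0 \<Longrightarrow> length (fst p) = 2 * m"
proof (induction m arbitrary: p)
  case 0
  then show ?case by (simp add: one_A split: if_splits)
next
  case (Suc m)
  have "x_elem n p \<noteq> 0 \<Longrightarrow> length (fst p) = 1" for p
    unfolding x_elem_def path_elem_def by (auto elim!: sum.not_neutral_contains_not_neutral split: if_splits)
  moreover have "y_elem n p \<noteq> 0 \<Longrightarrow> length (fst p) = 1" for p
    unfolding y_elem_def path_elem_def by (auto elim!: sum.not_neutral_contains_not_neutral split: if_splits)
  ultimately have "t_elem n p \<noteq> 0 \<Longrightarrow> length (fst p) = 2" for p
    unfolding t_elem_def using homogeneous_mult[of "x_elem n" 1 "y_elem n" 1 p] by simp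
  then show ?case
    using homogeneous_mult[of "t_elem n [^]\<^bsub>A\<^esub> m" "2 * m" "t_elem n" 2 p] Suc by simp
qed

text \<open>As \<open>t\<^sup>m\<close> is supported on paths of length \<open>2 m\<close>, the sum may be extended to any upper bound, which
  need not depend on the path.\<close>
lemma t_series_bound:
  assumes "length (fst p) \<le> N"
  shows "t_series n c p = (\<Sum>m\<le>N. fps_nth c m * (t_elem n [^]\<^bsub>A\<^esub> m) p)"
  unfolding t_series_def
  by (rule sum.mono_neutral_left) (use assms t_pow_length[of _ p] in fastforce)+

lemma t_series_closed: "t_series n c \<in> carrier A"
proof -
  have "(t_elem n [^]\<^bsub>A\<^esub> m) p = 0" if "\<not> is_path n p" for m :: nat and p
    using A.nat_pow_closed[OF t_closed, of m] that unfolding carrier_A by blast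
  then show ?thesis by (simp add: carrier_A t_series_def)
qed

lemma fps_compose_X_pow_nth:
  "(c oo fps_X ^ n) $ D = (\<Sum>m\<le>D. c $ m * (if D = n * m then 1 else 0))" for c :: "complex fps"
  by (simp add: fps_compose_nth atLeast0AtMost flip: power_mult)

lemma symb_t_series:
  assumes "i \<in> {1..n}"
  shows "symb (t_series n c) i j = (if i = j then c oo fps_X ^ n else 0)"
proof (rule fps_ext)
  fix D
  have "symb (t_series n c) i j $ D = (\<Sum>p\<in>paths i j D. \<Sum>m\<le>D. c $ m * (t_elem n [^]\<^bsub>A\<^esub> m) p)"
    unfolding symb_def fps_nth_Abs_fps
    by (rule sum.cong[OF refl]) (rule t_series_bound[OF paths_length])
  also have "\<dots> = (\<Sum>m\<le>D. c $ m * symb (t_elem n [^]\<^bsub>A\<^esub> m) i j $ D)"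
    unfolding symb_def fps_nth_Abs_fps sum_distrib_left by (rule sum.swap)
  also have "\<dots> = (if i = j then c oo fps_X ^ n else 0) $ D"
    by (simp add: symb_t_pow[OF assms] fps_compose_X_pow_nth)
  finally show "symb (t_series n c) i j $ D = (if i = j then c oo fps_X ^ n else 0) $ D" .
qed

lemma t_mult_t_series: "t_elem n \<otimes>\<^bsub>A\<^esub> t_series n c = t_series n (fps_X * c)"
proof (rule ext, clarify)
  fix w :: "arrow list" and i
  let ?L = "length w"
  have "(t_elem n \<otimes>\<^bsub>A\<^esub> t_series n c) (w, i) = (\<Sum>s\<le>?L. t_elem n (take s w, path_end n (drop s w, i)) *
      (\<Sum>m\<le>?L. c $ m * (t_elem n [^]\<^bsub>A\<^esub> m) (drop s w, i)))"
    unfolding mult_A by (rule sum.cong[OF refl], subst t_series_bound[of _ ?L]) auto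
  also have "\<dots> = (\<Sum>m\<le>?L. c $ m * (t_elem n \<otimes>\<^bsub>A\<^esub> t_elem n [^]\<^bsub>A\<^esub> m) (w, i))"
    unfolding mult_A sum_distrib_left by (subst sum.swap) (simp add: mult.left_commute)
  also have "\<dots> = (\<Sum>m\<le>?L. (fps_X * c) $ Suc m * (t_elem n [^]\<^bsub>A\<^esub> Suc m) (w, i))"
    by (simp add: A.nat_pow_Suc2[OF t_closed] del: A.nat_pow_Suc nat_pow_Suc)
  also have "\<dots> = (\<Sum>m\<le>Suc ?L. (fps_X * c) $ m * (t_elem n [^]\<^bsub>A\<^esub> m) (w, i))"
    by (subst sum.atMost_Suc_shift) simp
  also have "\<dots> = t_series n (fps_X * c) (w, i)"
    by (rule t_series_bound[symmetric]) simp
  finally show "(t_elem n \<otimes>\<^bsub>A\<^esub> t_series n c) (w, i) = t_series n (fps_X * c) (w, i)" .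
qed


section \<open>The modules attached to k-subsets\<close>

abbreviation C :: "C_elem ring" where "C \<equiv> C_alg k n"

sublocale C: ring C by (rule ring_C)

lemma k_subsetsD:
  assumes "I \<in> k_subsets k n" shows "I \<subseteq> {1..n}" "card I = k" "finite I"
  using assms finite_subset by (auto simp: k_subsets_def)

text \<open>The level is chosen such that \<open>M\<^sub>I\<close> becomes graded when its generator at \<open>m\<close> is placed in degree
  \<open>level I m\<close>: one step \<open>x\<close> changes it by \<open>-k\<close>, and by \<open>n - k\<close> if the step enters an element of \<open>I\<close>.
  Along the whole cycle these changes cancel, because \<open>I\<close> has \<open>k\<close> elements.  The summand \<open>k (n - m)\<close>
  is written like this to keep the level a natural number.\<close>
definition level :: "nat set \<Rightarrow> nat \<Rightarrow> nat" where
  "level I m = n * card (I \<inter> {1..m}) + k * (n - m)"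

text \<open>The embedding of \<open>M\<^sub>I\<close> into columns of power series in \<open>q\<close>, with \<open>t = q\<^sup>n\<close>.\<close>
definition lift :: "nat set \<Rightarrow> (nat \<Rightarrow> complex fps) \<Rightarrow> nat \<Rightarrow> complex fps" where
  "lift I v m = fps_X ^ level I m * (v m oo fps_X ^ n)"

text \<open>The arrows act on \<open>M\<^sub>I\<close> as powers of \<open>t\<close>; the weights are the exponents.\<close>
fun arrow_weight :: "nat set \<Rightarrow> arrow \<Rightarrow> nat" where
  "arrow_weight I (X i) = (if nextv n i \<in> I then 0 else 1)"
| "arrow_weight I (Y i) = (if nextv n i \<in> I then 1 else 0)"

definition path_weight :: "nat set \<Rightarrow> arrow list \<Rightarrow> nat" where
  "path_weight I w = (\<Sum>a\<leftarrow>w. arrow_weight I a)"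

lemma path_scalar_eq: "path_scalar n I p = fps_X ^ path_weight I (fst p)"
proof -
  have "arrow_scalar n I a = fps_X ^ arrow_weight I a" for a by (cases a) auto
  moreover have "(\<Prod>a\<leftarrow>w. fps_X ^ arrow_weight I a) = (fps_X :: complex fps) ^ path_weight I w" for w
    by (induction w) (simp_all add: path_weight_def power_add)
  ultimately show ?thesis by (simp add: path_scalar_def)
qed

lemma level_nextv:
  assumes "I \<in> k_subsets k n" "i \<in> {1..n}"
  shows "level I (nextv n i) + k = level I i + (if nextv n i \<in> I then n else 0)"
proof (cases "i = n")
  case True
  have "I \<inter> {1..n} = I" using k_subsetsD(1)[OF assms(1)] by auto
  then have "level I i = n * k" using True k_subsetsD(2)[OF assms(1)] by (simp add: level_def)
  moreover have "level I 1 = n * (if 1 \<in> I then 1 else 0) + k * (n - 1)" by (simp add: level_def)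
  moreover have "k * (n - 1) + k = n * k" using k_less by (cases n) auto
  ultimately show ?thesis using True by (auto simp: nextv_def)
next
  case False
  then have "k * (n - i) = k * (n - Suc i) + k" using assms(2)
    by (metis Suc_diff_Suc add.commute atLeastAtMost_iff le_neq_implies_less mult_Suc_right)
  moreover have "card (I \<inter> {1..Suc i}) = card (I \<inter> {1..i}) + (if Suc i \<in> I then 1 else 0)"
    by (simp add: atLeastAtMostSuc_conv)
  ultimately show ?thesis using False by (simp add: level_def nextv_def distrib_left)
qed

lemma arrow_level:
  assumes "I \<in> k_subsets k n" "a \<in> arrows n"
  shows "n * arrow_weight I a + level I (tgt n a) = level I (src n a) + arrow_deg a"
proof -
  obtain i where "i \<in> {1..n}" "a = X i \<or> a = Y i" using assms(2) by (auto simp: arrows_def)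
  with level_nextv[OF assms(1) this(1)] k_less show ?thesis
    by (cases "nextv n i \<in> I") auto
qed

text \<open>The weight of a path, hence its action on \<open>M\<^sub>I\<close>, is determined by its ends and its degree.\<close>
lemma path_level:
  assumes "I \<in> k_subsets k n" "is_path n (w, i)"
  shows "n * path_weight I w + level I (path_end n (w, i)) = level I i + path_deg w"
  using assms(2)
proof (induction w)
  case (Cons a w)
  then have "n * arrow_weight I a + level I (tgt n a) = level I (path_end n (w, i)) + arrow_deg a"
    using arrow_level[OF assms(1), of a] by simp
  then show ?case using Cons by (simp add: path_weight_def path_deg_def distrib_left)
qed (simp add: path_weight_def path_deg_def)

lemma compose_nth_mult [simp]: "(c oo fps_X ^ n) $ (n * e) = c $ e" for c :: "complex fps"
proof -
  have "(c oo fps_X ^ n) $ (n * e) = (\<Sum>m\<le>n * e. if m = e then c $ e else 0)"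
    unfolding fps_compose_X_pow_nth by (rule sum.cong) (use k_less in auto)
  also have "\<dots> = c $ e" using k_less by simp
  finally show ?thesis .
qed

lemma compose_nth_not_dvd: "\<not> n dvd D \<Longrightarrow> (c oo fps_X ^ n) $ D = 0" for c :: "complex fps"
  unfolding fps_compose_X_pow_nth by (rule sum.neutral) auto

lemma lift_nth_level: "lift I v m $ (level I m + n * e) = v m $ e"
  by (simp add: lift_def fps_X_power_mult_nth)

lemma lift_nth_0:
  assumes "\<And>e. F \<noteq> level I m + n * e" shows "lift I v m $ F = 0"
proof (cases "F < level I m")
  case False
  then have "\<not> n dvd F - level I m" using assms unfolding dvd_def by (metis add_diff_inverse_nat)
  then show ?thesis using False by (simp add: lift_def fps_X_power_mult_nth compose_nth_not_dvd)
qed (simp add: lift_def fps_X_power_mult_nth)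

lemma lift_inj:
  assumes "lift I u m = lift I v m" shows "u m = v m"
  by (rule fps_ext) (metis assms lift_nth_level)

lemma lift_add: "lift I (\<lambda>i. u i + v i) m = lift I u m + lift I v m"
  by (simp add: lift_def fps_compose_add_distrib distrib_left)

lemma lift_mult: "lift I (\<lambda>i. c i * v i) m = (c m oo fps_X ^ n) * lift I v m"
  using k_less by (simp add: lift_def fps_compose_mult_distrib)

text \<open>Under the embedding the action becomes multiplication by the matrix of symbols.  The comparison
  is made in each degree \<open>E\<close>; both sides are sums over the paths into \<open>j\<close> of degree at most \<open>E\<close>, and
  they agree term by term by \<open>path_level\<close>.  Degrees not congruent to \<open>level I j\<close> modulo \<open>n\<close> do not
  occur on either side.\<close>
lemma lift_path_action:
  assumes I: "I \<in> k_subsets k n"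
  shows "lift I (path_action n I f v) j = (\<Sum>i\<in>{1..n}. symb f i j * lift I v i)"
proof (rule fps_ext)
  fix E
  define S where "S = {p. is_path n p \<and> path_end n p = j \<and> path_deg (fst p) \<le> E}"
  have finS: "finite S"
    by (rule finite_subset[OF _ finite_short_paths[of E]])
      (auto simp: S_def intro: order_trans[OF length_le_path_deg])
  have lev: "n * path_weight I (fst p) + level I j = level I (snd p) + path_deg (fst p)" if "p \<in> S" for p
    using path_level[OF I, of "fst p" "snd p"] that by (simp add: S_def)
  have "(\<Sum>i\<in>{1..n}. symb f i j * lift I v i) $ E =
      (\<Sum>i\<in>{1..n}. \<Sum>D\<in>{0..E}. \<Sum>p\<in>paths i j D. f p * lift I v i $ (E - D))"
    by (simp add: fps_sum_nth fps_mult_nth symb_def sum_distrib_right)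
  also have "\<dots> = (\<Sum>(i, D, p)\<in>(SIGMA i:{1..n}. SIGMA D:{0..E}. paths i j D). f p * lift I v i $ (E - D))"
    by (simp add: sum.Sigma finite_paths split_def)
  also have "\<dots> = (\<Sum>p\<in>S. f p * lift I v (snd p) $ (E - path_deg (fst p)))"
    by (rule sum.reindex_bij_witness[where
          i = "\<lambda>p. (snd p, path_deg (fst p), p)" and j = "\<lambda>(i, D, p). p"])
      (use is_path_range(1) in \<open>auto simp: S_def paths_def\<close>)
  also have "\<dots> = lift I (path_action n I f v) j $ E"
  proof (cases "\<exists>d. E = level I j + n * d")
    case True
    then obtain d where E: "E = level I j + n * d" by blast
    let ?c = "\<lambda>p. fps_nth (path_scalar n I p * v (snd p)) d"
    have c: "lift I v (snd p) $ (E - path_deg (fst p)) = ?c p" if p: "p \<in> S" for p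
    proof (cases "path_weight I (fst p) \<le> d")
      case True
      then obtain e where d: "d = path_weight I (fst p) + e" using le_Suc_ex by blast
      have "E = path_deg (fst p) + (level I (snd p) + n * e)"
        using lev[OF p] by (simp add: E d distrib_left)
      then show ?thesis by (simp add: lift_nth_level path_scalar_eq fps_X_power_mult_nth d)
    next
      case False
      then have "n * d < n * path_weight I (fst p)" using k_less by simp
      then have "E - path_deg (fst p) < level I (snd p) \<or> E < path_deg (fst p)"
        using lev[OF p] unfolding E by linarith
      then have "E - path_deg (fst p) < level I (snd p)" using p by (auto simp: S_def)
      then show ?thesis using False by (simp add: lift_def path_scalar_eq fps_X_power_mult_nth)
    qed
    have sub: "{p. is_path n p \<and> path_end n p = j \<and> ?c p \<noteq> 0} \<subseteq> S"
    proof
      fix p assume p: "p \<in> {p. is_path n p \<and> path_end n p = j \<and> ?c p \<noteq> 0}"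
      obtain w i where pw: "p = (w, i)" by (cases p)
      have w: "is_path n (w, i)" "j = path_end n (w, i)" "?c (w, i) \<noteq> 0" using p pw by auto
      then have "path_weight I w \<le> d"
        by (simp add: path_scalar_eq fps_X_power_mult_nth split: if_splits)
      then have "n * path_weight I w \<le> n * d" by simp
      then have "path_deg w \<le> E" using path_level[OF I w(1)] unfolding E w(2) by linarith
      then show "p \<in> S" using w(1,2) by (simp add: S_def pw)
    qed
    have "(\<Sum>p\<in>S. f p * lift I v (snd p) $ (E - path_deg (fst p))) = (\<Sum>p\<in>S. f p * ?c p)"
      by (rule sum.cong) (simp_all add: c)
    also have "\<dots> = (\<Sum>p | is_path n p \<and> path_end n p = j \<and> ?c p \<noteq> 0. f p * ?c p)"
      by (rule sum.mono_neutral_right[OF finS sub]) (auto simp: S_def)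
    also have "\<dots> = lift I (path_action n I f v) j $ E"
      by (simp add: E lift_nth_level path_action_def)
    finally show ?thesis .
  next
    case False
    have "lift I v (snd p) $ (E - path_deg (fst p)) = 0" if p: "p \<in> S" for p
    proof (rule lift_nth_0)
      fix e show "E - path_deg (fst p) \<noteq> level I (snd p) + n * e"
      proof
        assume "E - path_deg (fst p) = level I (snd p) + n * e"
        then have "E = level I (snd p) + path_deg (fst p) + n * e" using p by (auto simp: S_def)
        then have "E = level I j + n * (path_weight I (fst p) + e)"
          using lev[OF p] by (simp add: distrib_left)
        then show False using False by blast
      qed
    qed
    moreover have "lift I (path_action n I f v) j $ E = 0" using lift_nth_0 False by blast
    ultimately show ?thesis by simp
  qed
  finally show "lift I (path_action n I f v) j $ E = (\<Sum>i\<in>{1..n}. symb f i j * lift I v i) $ E" ..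
qed

abbreviation "MM \<equiv> M_mod n"

lemma carrier_MM: "v \<in> carrier (MM I) \<longleftrightarrow> (\<forall>i. i \<notin> {1..n} \<longrightarrow> v i = 0)"
  by (simp add: M_mod_def)

lemma add_MM: "u \<oplus>\<^bsub>MM I\<^esub> v = (\<lambda>i. u i + v i)"
  by (simp add: M_mod_def)

lemma zero_MM: "\<zero>\<^bsub>MM I\<^esub> = (\<lambda>_. 0)"
  by (simp add: M_mod_def)

lemma smult_MM_closed: "a \<odot>\<^bsub>MM I\<^esub> v \<in> carrier (MM I)"
proof -
  have "path_action n I f v j = 0" if "j \<notin> {1..n}" for f j
    using that is_path_range(2) by (intro fps_ext) (auto simp: path_action_def intro!: sum.neutral)
  then show ?thesis by (simp add: M_mod_def)
qed

lemma lift_smult: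
  assumes "I \<in> k_subsets k n" "f \<in> carrier A"
  shows "lift I (C_class k n f \<odot>\<^bsub>MM I\<^esub> v) j = (\<Sum>i\<in>{1..n}. symb f i j * lift I v i)"
proof -
  have "lift I (C_class k n f \<odot>\<^bsub>MM I\<^esub> v) j =
      (\<Sum>i\<in>{1..n}. symb (SOME g. g \<in> C_class k n f) i j * lift I v i)"
    by (simp add: M_mod_def lift_path_action[OF assms(1)])
  also have "\<dots> = (\<Sum>i\<in>{1..n}. symb f i j * lift I v i)"
    by (rule sum.cong) (simp_all add: C_class_some[OF assms(2)])
  finally show ?thesis .
qed

lemma MM_eqI:
  assumes "u \<in> carrier (MM I)" "v \<in> carrier (MM I)"
    and "\<And>j. j \<in> {1..n} \<Longrightarrow> lift I u j = lift I v j"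
  shows "u = v"
proof
  fix j show "u j = v j"
    by (cases "j \<in> {1..n}") (use assms(1,2) lift_inj[OF assms(3), of j] in \<open>auto simp: carrier_MM\<close>)
qed

text \<open>Once embedded, the module axioms are the corresponding identities for matrices.\<close>
lemma left_module_MM:
  assumes I: "I \<in> k_subsets k n" shows "left_module C (MM I)"
proof (rule left_moduleI[OF ring_C])
  show "abelian_group (MM I)"
  proof (rule abelian_groupI)
    fix v assume "v \<in> carrier (MM I)"
    then show "\<exists>u\<in>carrier (MM I). u \<oplus>\<^bsub>MM I\<^esub> v = \<zero>\<^bsub>MM I\<^esub>"
      by (intro bexI[of _ "\<lambda>i. - v i"]) (auto simp: carrier_MM add_MM zero_MM)
  qed (auto simp: carrier_MM add_MM zero_MM add.assoc add.commute)
next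
  fix a v assume v: "v \<in> carrier (MM I)" and a: "a \<in> carrier C"
  show "a \<odot>\<^bsub>MM I\<^esub> v \<in> carrier (MM I)" by (rule smult_MM_closed)
next
  fix a b v assume v: "v \<in> carrier (MM I)" and ab: "a \<in> carrier C" "b \<in> carrier C"
  obtain f where f: "f \<in> carrier A" "a = C_class k n f" using ab(1) by (rule C_alg_cases)
  obtain g where g: "g \<in> carrier A" "b = C_class k n g" using ab(2) by (rule C_alg_cases)
  have c: "u \<oplus>\<^bsub>MM I\<^esub> v \<in> carrier (MM I)" if "u \<in> carrier (MM I)" "v \<in> carrier (MM I)" for u v
    using that by (simp add: carrier_MM add_MM)
  show "(a \<oplus>\<^bsub>C\<^esub> b) \<odot>\<^bsub>MM I\<^esub> v = a \<odot>\<^bsub>MM I\<^esub> v \<oplus>\<^bsub>MM I\<^esub> b \<odot>\<^bsub>MM I\<^esub> v"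
    unfolding f(2) g(2) C_class_add[OF f(1) g(1), symmetric]
    by (rule MM_eqI[OF smult_MM_closed c[OF smult_MM_closed smult_MM_closed]])
      (simp add: lift_smult[OF I] f g add_MM lift_add, simp add: add_A symb_add distrib_right sum.distrib)
  show "(a \<otimes>\<^bsub>C\<^esub> b) \<odot>\<^bsub>MM I\<^esub> v = a \<odot>\<^bsub>MM I\<^esub> (b \<odot>\<^bsub>MM I\<^esub> v)"
    unfolding f(2) g(2) C_class_mult[OF f(1) g(1), symmetric]
  proof (rule MM_eqI[OF smult_MM_closed smult_MM_closed])
    fix j
    have "(\<Sum>i\<in>{1..n}. \<Sum>l\<in>{1..n}. symb f l j * symb g i l * lift I v i) =
        (\<Sum>l\<in>{1..n}. \<Sum>i\<in>{1..n}. symb f l j * symb g i l * lift I v i)" by (rule sum.swap)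
    then show "lift I (C_class k n (f \<otimes>\<^bsub>A\<^esub> g) \<odot>\<^bsub>MM I\<^esub> v) j =
        lift I (C_class k n f \<odot>\<^bsub>MM I\<^esub> (C_class k n g \<odot>\<^bsub>MM I\<^esub> v)) j"
      by (simp add: lift_smult[OF I] f g symb_mult sum_distrib_left sum_distrib_right mult.assoc)
  qed
next
  fix a u v assume v: "v \<in> carrier (MM I)" "u \<in> carrier (MM I)" and a: "a \<in> carrier C"
  obtain f where f: "f \<in> carrier A" "a = C_class k n f" using a by (rule C_alg_cases)
  have c: "u \<oplus>\<^bsub>MM I\<^esub> v \<in> carrier (MM I)" if "u \<in> carrier (MM I)" "v \<in> carrier (MM I)" for u v
    using that by (simp add: carrier_MM add_MM)
  show "a \<odot>\<^bsub>MM I\<^esub> (u \<oplus>\<^bsub>MM I\<^esub> v) = a \<odot>\<^bsub>MM I\<^esub> u \<oplus>\<^bsub>MM I\<^esub> a \<odot>\<^bsub>MM I\<^esub> v"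
    unfolding f(2)
    by (rule MM_eqI[OF smult_MM_closed c[OF smult_MM_closed smult_MM_closed]])
      (simp add: lift_smult[OF I] f add_MM lift_add distrib_left sum.distrib)
next
  fix v assume v: "v \<in> carrier (MM I)"
  have "lift I (C_class k n \<one>\<^bsub>A\<^esub> \<odot>\<^bsub>MM I\<^esub> v) j = lift I v j" if j: "j \<in> {1..n}" for j
  proof -
    have "lift I (C_class k n \<one>\<^bsub>A\<^esub> \<odot>\<^bsub>MM I\<^esub> v) j = (\<Sum>i\<in>{1..n}. if i = j then lift I v i else 0)"
      unfolding lift_smult[OF I A.one_closed] by (rule sum.cong) (auto simp: symb_one)
    then show ?thesis using j by simp
  qed
  then show "\<one>\<^bsub>C\<^esub> \<odot>\<^bsub>MM I\<^esub> v = v"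
    unfolding C_class_one[symmetric] by (intro MM_eqI[OF smult_MM_closed v])
qed

lemma t_series_smult_MM:
  assumes I: "I \<in> k_subsets k n" and v: "v \<in> carrier (MM I)"
  shows "C_class k n (t_series n c) \<odot>\<^bsub>MM I\<^esub> v = (\<lambda>i. c * v i)"
proof (rule MM_eqI[OF smult_MM_closed])
  show "(\<lambda>i. c * v i) \<in> carrier (MM I)" using v by (simp add: carrier_MM)
  fix j assume j: "j \<in> {1..n}"
  have "lift I (C_class k n (t_series n c) \<odot>\<^bsub>MM I\<^esub> v) j =
      (\<Sum>i\<in>{1..n}. if i = j then (c oo fps_X ^ n) * lift I v i else 0)"
    unfolding lift_smult[OF I t_series_closed] by (rule sum.cong) (auto simp: symb_t_series)
  then show "lift I (C_class k n (t_series n c) \<odot>\<^bsub>MM I\<^esub> v) j = lift I (\<lambda>i. c * v i) j"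
    using j by (simp add: lift_mult)
qed

lemma lift_path_smult:
  assumes I: "I \<in> k_subsets k n" and p: "is_path n p"
  shows "lift I (C_class k n (path_elem p) \<odot>\<^bsub>MM I\<^esub> v) j =
    (if j = path_end n p then fps_X ^ path_deg (fst p) * lift I v (snd p) else 0)"
proof -
  have "lift I (C_class k n (path_elem p) \<odot>\<^bsub>MM I\<^esub> v) j = (\<Sum>i\<in>{1..n}. if i = snd p then
      if j = path_end n p then fps_X ^ path_deg (fst p) * lift I v (snd p) else 0 else 0)"
    unfolding lift_smult[OF I path_elem_closed[OF p]]
    by (rule sum.cong) (auto simp: symb_path_elem[OF p])
  then show ?thesis using is_path_range(1)[OF p] by simp
qed

definition at_vertex :: "nat \<Rightarrow> complex fps \<Rightarrow> nat \<Rightarrow> complex fps" where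
  "at_vertex i c = (\<lambda>m. if m = i then c else 0)"

lemma at_vertex_closed: "i \<in> {1..n} \<Longrightarrow> at_vertex i c \<in> carrier (MM I)"
  by (auto simp: at_vertex_def carrier_MM)

lemma path_smult_MM:
  assumes I: "I \<in> k_subsets k n" and p: "is_path n p"
  shows "C_class k n (path_elem p) \<odot>\<^bsub>MM I\<^esub> v =
    at_vertex (path_end n p) ((C_class k n (path_elem p) \<odot>\<^bsub>MM I\<^esub> v) (path_end n p))" (is "?w = _")
proof (rule MM_eqI[OF smult_MM_closed at_vertex_closed[OF is_path_range(2)[OF p]]])
  fix j
  show "lift I ?w j = lift I (at_vertex (path_end n p) (?w (path_end n p))) j"
  proof (cases "j = path_end n p")
    case True
    then show ?thesis by (simp add: at_vertex_def lift_def)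
  next
    case False
    then have "lift I ?w j = 0" using lift_path_smult[OF I p] by simp
    then show ?thesis using False by (simp add: at_vertex_def lift_def)
  qed
qed

lemma idem_smult_MM:
  assumes I: "I \<in> k_subsets k n" and i: "i \<in> {1..n}"
  shows "C_idem k n i \<odot>\<^bsub>MM I\<^esub> v = at_vertex i (v i)"
  unfolding C_idem_def
  by (rule MM_eqI[OF smult_MM_closed at_vertex_closed[OF i]], subst lift_path_smult[OF I])
    (use i in \<open>auto simp: at_vertex_def lift_def path_deg_def\<close>)

section \<open>Morphisms between the rank one modules\<close>

text \<open>Under the embeddings this map is multiplication by the power of \<open>q\<close> with exponent \<open>d - c\<close>, the
  same at all vertices.  That commutes with the matrices of symbols.  The exponent may be negative,
  whence the two numbers \<open>c\<close> and \<open>d\<close>.\<close>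
lemma shift_hom:
  assumes I: "I \<in> k_subsets k n" and J: "J \<in> k_subsets k n"
    and a: "\<And>m. m \<in> {1..n} \<Longrightarrow> level J m + n * a m + c = level I m + d"
  shows "(\<lambda>v\<in>carrier (MM I). \<lambda>m. fps_X ^ a m * v m) \<in> lmod_hom C (MM I) (MM J)"
proof (rule restrict_lmod_homI[OF left_module_MM[OF I]])
  have cl: "(\<lambda>m. fps_X ^ a m * v m) \<in> carrier (MM J)" if "v \<in> carrier (MM I)" for v
    using that by (simp add: carrier_MM)
  have key: "fps_X ^ c * lift J (\<lambda>m. fps_X ^ a m * v m) m = fps_X ^ d * lift I v m"
    if m: "m \<in> {1..n}" for m v
  proof -
    have "fps_X ^ c * lift J (\<lambda>m. fps_X ^ a m * v m) m =
        fps_X ^ (level J m + n * a m + c) * (v m oo fps_X ^ n)"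
      using k_less by (simp add: lift_def fps_compose_mult_distrib fps_X_power_compose power_add
          power_mult mult_ac)
    also have "\<dots> = fps_X ^ d * lift I v m"
      unfolding a[OF m] by (simp add: lift_def power_add mult_ac)
    finally show ?thesis .
  qed
  fix v assume v: "v \<in> carrier (MM I)"
  show "(\<lambda>m. fps_X ^ a m * v m) \<in> carrier (MM J)" by (rule cl[OF v])
  show "(\<lambda>m. fps_X ^ a m * (u \<oplus>\<^bsub>MM I\<^esub> v) m) = (\<lambda>m. fps_X ^ a m * u m) \<oplus>\<^bsub>MM J\<^esub> (\<lambda>m. fps_X ^ a m * v m)"
    for u by (simp add: add_MM distrib_left)
  fix x assume "x \<in> carrier C"
  then obtain f where f: "f \<in> carrier A" "x = C_class k n f" by (rule C_alg_cases)
  show "(\<lambda>m. fps_X ^ a m * (x \<odot>\<^bsub>MM I\<^esub> v) m) = x \<odot>\<^bsub>MM J\<^esub> (\<lambda>m. fps_X ^ a m * v m)"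
  proof (rule MM_eqI[OF cl[OF smult_MM_closed] smult_MM_closed])
    fix j assume j: "j \<in> {1..n}"
    have "fps_X ^ c * lift J (x \<odot>\<^bsub>MM J\<^esub> (\<lambda>m. fps_X ^ a m * v m)) j =
        (\<Sum>i\<in>{1..n}. symb f i j * (fps_X ^ c * lift J (\<lambda>m. fps_X ^ a m * v m) i))"
      by (simp add: f lift_smult[OF J] sum_distrib_left mult.left_commute)
    also have "\<dots> = (\<Sum>i\<in>{1..n}. symb f i j * (fps_X ^ d * lift I v i))"
      by (rule sum.cong) (simp_all add: key)
    also have "\<dots> = fps_X ^ d * lift I (x \<odot>\<^bsub>MM I\<^esub> v) j"
      by (simp add: f lift_smult[OF I] sum_distrib_left mult.left_commute)
    also have "\<dots> = fps_X ^ c * lift J (\<lambda>m. fps_X ^ a m * (x \<odot>\<^bsub>MM I\<^esub> v) m) j"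
      by (rule key[OF j, symmetric])
    finally show "lift J (\<lambda>m. fps_X ^ a m * (x \<odot>\<^bsub>MM I\<^esub> v) m) j =
        lift J (x \<odot>\<^bsub>MM J\<^esub> (\<lambda>m. fps_X ^ a m * v m)) j" by simp
  qed
qed

text \<open>Comparing the elements of \<open>I\<close> and \<open>J\<close> one by one in the order \<open>\<le>\<^sub>j\<close> means that each initial
  segment of this order contains at least as many elements of \<open>I\<close> as of \<open>J\<close>.\<close>
lemma subset_le_card:
  assumes "subset_le n j I J" "j \<in> {1..n}" "I \<subseteq> {1..n}" "J \<subseteq> {1..n}"
  shows "card {a \<in> J. cyc_pos n j a \<le> P} \<le> card {a \<in> I. cyc_pos n j a \<le> P}"
proof -
  have len: "length (filter (\<lambda>a. cyc_pos n j a \<le> P) ys) \<le> length (filter (\<lambda>a. cyc_pos n j a \<le> P) xs)"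
    if "list_all2 (cyc_le n j) xs ys" for xs ys
    using that by (induction rule: list_all2_induct) (auto simp: cyc_le_def)
  have d: "distinct (cyc_list n j)" and s: "set (cyc_list n j) = {1..n}"
    using assms(2) by (auto simp: cyc_list_def)
  have c: "length (filter (\<lambda>a. cyc_pos n j a \<le> P) (filter (\<lambda>a. a \<in> K) (cyc_list n j))) =
      card {a \<in> K. cyc_pos n j a \<le> P}" if "K \<subseteq> {1..n}" for K
  proof -
    have "set (filter (\<lambda>a. cyc_pos n j a \<le> P) (filter (\<lambda>a. a \<in> K) (cyc_list n j))) =
        {a \<in> K. cyc_pos n j a \<le> P}"
      using that s by auto
    then show ?thesis using distinct_card d by (metis distinct_filter)
  qed
  show ?thesis
    using len assms(1) c[OF assms(3)] c[OF assms(4)] unfolding subset_le_def by metis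
qed

text \<open>An initial segment for \<open>\<le>\<^sub>j\<close> is an interval \<open>[j,m]\<close>, or it wraps around and is the complement of an
  interval \<open>[m+1,j-1]\<close>; in the second case one uses that \<open>I\<close> and \<open>J\<close> have equally many elements.
  Writing intervals as differences of intervals starting at \<open>1\<close> gives both cases the same form.\<close>
lemma subset_le_interval:
  assumes le: "subset_le n j I J" and j: "j \<in> {1..n}" and m: "m \<in> {1..n}"
    and I: "I \<in> k_subsets k n" and J: "J \<in> k_subsets k n"
  shows "card (J \<inter> {1..m}) + card (I \<inter> {1..prevv n j}) \<le> card (I \<inter> {1..m}) + card (J \<inter> {1..prevv n j})"
proof -
  note ID = k_subsetsD[OF I] and JD = k_subsetsD[OF J]
  let ?b = "j - 1"
  have pre: "card (I \<inter> {1..prevv n j}) + card (J \<inter> {1..?b}) = card (J \<inter> {1..prevv n j}) + card (I \<inter> {1..?b})"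
  proof (cases "j = 1")
    case True
    moreover have "I \<inter> {1..n} = I" "J \<inter> {1..n} = J" using ID JD by auto
    ultimately show ?thesis using ID JD by (simp add: prevv_def)
  qed (simp add: prevv_def)
  have split: "card (K \<inter> {1..m}) = card (K \<inter> {1..?b}) + card (K \<inter> {j..m})" if "j \<le> m" for K m
  proof -
    have "K \<inter> {1..m} = (K \<inter> {1..?b}) \<union> (K \<inter> {j..m})" using that j by auto
    moreover have "(K \<inter> {1..?b}) \<inter> (K \<inter> {j..m}) = {}" using j by auto
    ultimately show ?thesis by (simp add: card_Un_disjoint)
  qed
  have "card (J \<inter> {1..m}) + card (I \<inter> {1..?b}) \<le> card (I \<inter> {1..m}) + card (J \<inter> {1..?b})"
  proof (cases "j \<le> m")
    case True
    have "{a \<in> K. cyc_pos n j a \<le> m - j} = K \<inter> {j..m}" if "K \<subseteq> {1..n}" for K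
    proof -
      have "cyc_pos n j a \<le> m - j \<longleftrightarrow> j \<le> a \<and> a \<le> m" if a: "a \<in> K" for a
      proof -
        have "1 \<le> a" using a \<open>K \<subseteq> {1..n}\<close> by auto
        then show ?thesis using True m j by (cases "j \<le> a") (auto simp: cyc_pos_def)
      qed
      then show ?thesis by auto
    qed
    then show ?thesis
      using subset_le_card[OF le j ID(1) JD(1), of "m - j"] split[OF True] ID(1) JD(1) by simp
  next
    case False
    have s: "card {a \<in> K. cyc_pos n j a \<le> n - j + m} + card (K \<inter> {1..?b}) = card K + card (K \<inter> {1..m})"
      if K: "K \<subseteq> {1..n}" for K
    proof -
      have "{a \<in> K. cyc_pos n j a \<le> n - j + m} = (K \<inter> {j..n}) \<union> (K \<inter> {1..m})"
        using K False m j by (auto simp: cyc_pos_def)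
      then have "card {a \<in> K. cyc_pos n j a \<le> n - j + m} = card (K \<inter> {j..n}) + card (K \<inter> {1..m})"
        using False by (simp, subst card_Un_disjoint) auto
      moreover have "K \<inter> {1..n} = K" using K by auto
      ultimately show ?thesis using split[of n K] j by simp
    qed
    show ?thesis
      using subset_le_card[OF le j ID(1) JD(1), of "n - j + m"] s[OF ID(1)] s[OF JD(1)] ID(2) JD(2) by simp
  qed
  then show ?thesis using pre by linarith
qed

text \<open>The exponents \<open>a m\<close> of the shift morphism that is the identity at \<open>j - 1\<close> are the differences in
  \<open>subset_le_interval\<close>, hence they are natural numbers.\<close>
lemma subset_le_hom:
  assumes le: "subset_le n j I J" and j: "j \<in> {1..n}"
    and I: "I \<in> k_subsets k n" and J: "J \<in> k_subsets k n"
  obtains h where "h \<in> lmod_hom C (MM I) (MM J)" "\<And>c. h (at_vertex (prevv n j) c) = at_vertex (prevv n j) c"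
proof
  let ?i = "prevv n j"
  have i: "?i \<in> {1..n}" using prevv_range[OF j] .
  define a where "a m = card (I \<inter> {1..m}) + card (J \<inter> {1..?i}) - (card (J \<inter> {1..m}) + card (I \<inter> {1..?i}))" for m
  have "level J m + n * a m + level I ?i = level I m + level J ?i" if m: "m \<in> {1..n}" for m
  proof -
    have "card (J \<inter> {1..m}) + card (I \<inter> {1..?i}) + a m = card (I \<inter> {1..m}) + card (J \<inter> {1..?i})"
      using subset_le_interval[OF le j m I J] by (simp add: a_def)
    then have "n * card (J \<inter> {1..m}) + n * card (I \<inter> {1..?i}) + n * a m =
        n * card (I \<inter> {1..m}) + n * card (J \<inter> {1..?i})"
      by (metis distrib_left)
    then show ?thesis by (simp add: level_def)
  qed
  then show "(\<lambda>v\<in>carrier (MM I). \<lambda>m. fps_X ^ a m * v m) \<in> lmod_hom C (MM I) (MM J)"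
    by (rule shift_hom[OF I J])
  show "(\<lambda>v\<in>carrier (MM I). \<lambda>m. fps_X ^ a m * v m) (at_vertex ?i c) = at_vertex ?i c" for c
    using at_vertex_closed[OF i] by (auto simp: at_vertex_def a_def fun_eq_iff)
qed


section \<open>Torsion-freeness and vertex idempotents\<close>

lemma idem_closed: "i \<in> {1..n} \<Longrightarrow> C_idem k n i \<in> carrier C"
  unfolding C_idem_def by (intro C_class_closed path_elem_closed) simp

lemma t_series_1: "t_series n 1 = \<one>\<^bsub>A\<^esub>"
proof
  fix p
  have "t_series n 1 p = (\<Sum>m\<le>length (fst p). if m = 0 then \<one>\<^bsub>A\<^esub> p else 0)"
    unfolding t_series_def by (rule sum.cong) auto
  then show "t_series n 1 p = \<one>\<^bsub>A\<^esub> p" by simp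
qed

text \<open>If \<open>m\<close> has the coefficients \<open>c\<close> in a basis, then \<open>t m\<close> has the coefficients \<open>t c\<close>, and the
  coefficients of \<open>0\<close> are unique.\<close>
lemma t_torsion_free:
  assumes M: "M \<in> CM_C k n" and m: "m \<in> carrier M"
    and z: "C_class k n (t_elem n) \<odot>\<^bsub>M\<^esub> m = \<zero>\<^bsub>M\<^esub>"
  shows "m = \<zero>\<^bsub>M\<^esub>"
proof -
  interpret M: left_module C M using M by (simp add: CM_C_def)
  let ?sc = "\<lambda>c. C_class k n (t_series n c)"
  have sc: "?sc c \<in> carrier C" for c by (intro C_class_closed t_series_closed)
  define expansion where "expansion S m c \<longleftrightarrow> finite {s. c s \<noteq> 0} \<and> {s. c s \<noteq> 0} \<subseteq> S \<and>
      m = (\<Oplus>\<^bsub>M\<^esub>s\<in>{s. c s \<noteq> 0}. ?sc (c s) \<odot>\<^bsub>M\<^esub> s)" for S m c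
  have "free_over_t k n M" using M by (simp add: CM_C_def)
  then obtain S where S: "S \<subseteq> carrier M" "\<forall>m\<in>carrier M. \<exists>!c. expansion S m c"
    unfolding free_over_t_def expansion_def by (elim exE conjE)
  have unique: "c = d" if "m \<in> carrier M" "expansion S m c" "expansion S m d" for m c d
    by (rule ex1E[OF bspec[OF S(2) that(1)]]) (use that(2,3) in metis)
  obtain c where ex: "expansion S m c" using ex1_implies_ex[OF bspec[OF S(2) m]] by (elim exE)
  note c = conjunct2[OF ex[unfolded expansion_def], THEN conjunct1]
    conjunct2[OF ex[unfolded expansion_def], THEN conjunct2]
  let ?d = "\<lambda>s. fps_X * c s"
  have cl: "(\<lambda>s. ?sc (c s) \<odot>\<^bsub>M\<^esub> s) \<in> {s. c s \<noteq> 0} \<rightarrow> carrier M"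
    using c(1) S(1) sc M.smult_closed by (auto simp: subset_iff)
  have "C_class k n (t_elem n) \<odot>\<^bsub>M\<^esub> m =
      (\<Oplus>\<^bsub>M\<^esub>s\<in>{s. c s \<noteq> 0}. C_class k n (t_elem n) \<odot>\<^bsub>M\<^esub> (?sc (c s) \<odot>\<^bsub>M\<^esub> s))"
    unfolding c(2) by (rule M.smult_finsum[OF C_class_closed[OF t_closed] cl])
  also have "\<dots> = (\<Oplus>\<^bsub>M\<^esub>s\<in>{s. c s \<noteq> 0}. ?sc (?d s) \<odot>\<^bsub>M\<^esub> s)"
  proof (rule M.M.finsum_cong'[OF refl])
    show "(\<lambda>s. ?sc (?d s) \<odot>\<^bsub>M\<^esub> s) \<in> {s. c s \<noteq> 0} \<rightarrow> carrier M"
      using c(1) S(1) sc M.smult_closed by (auto simp: subset_iff)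
    fix s assume "s \<in> {s. c s \<noteq> 0}"
    then have s: "s \<in> carrier M" using c(1) S(1) by auto
    show "C_class k n (t_elem n) \<odot>\<^bsub>M\<^esub> (?sc (c s) \<odot>\<^bsub>M\<^esub> s) = ?sc (?d s) \<odot>\<^bsub>M\<^esub> s"
      unfolding t_mult_t_series[symmetric] C_class_mult[OF t_closed t_series_closed]
      by (rule M.smult_assoc[symmetric, OF C_class_closed[OF t_closed] sc s])
  qed
  finally have "expansion S \<zero>\<^bsub>M\<^esub> ?d" using ex z by (simp add: expansion_def)
  moreover have "expansion S \<zero>\<^bsub>M\<^esub> (\<lambda>_. 0)" by (simp add: expansion_def)
  ultimately have "?d = (\<lambda>_. 0)" by (rule unique[OF M.M.zero_closed])
  then have "c s = 0" for s by (simp add: fun_eq_iff)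
  then show ?thesis using c(2) by simp
qed

lemma t_power_torsion_free:
  assumes M: "M \<in> CM_C k n" and m: "m \<in> carrier M"
    and z: "C_class k n (t_series n (fps_X ^ d)) \<odot>\<^bsub>M\<^esub> m = \<zero>\<^bsub>M\<^esub>"
  shows "m = \<zero>\<^bsub>M\<^esub>"
proof -
  interpret M: left_module C M using M by (simp add: CM_C_def)
  have sc: "C_class k n (t_series n c) \<in> carrier C" for c by (intro C_class_closed t_series_closed)
  show ?thesis
    using z
  proof (induction d)
    case 0
    then show ?case using m by (simp add: t_series_1 C_class_one M.smult_one)
  next
    case (Suc d)
    have "C_class k n (t_elem n) \<odot>\<^bsub>M\<^esub> (C_class k n (t_series n (fps_X ^ d)) \<odot>\<^bsub>M\<^esub> m) =
        C_class k n (t_series n (fps_X ^ Suc d)) \<odot>\<^bsub>M\<^esub> m"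
      unfolding power_Suc t_mult_t_series[symmetric] C_class_mult[OF t_closed t_series_closed]
      by (rule M.smult_assoc[symmetric, OF C_class_closed[OF t_closed] sc m])
    then show ?case
      using Suc t_torsion_free[OF M M.smult_closed[OF sc m]] by simp
  qed
qed

text \<open>The idempotents \<open>e\<^sub>i\<close> add up to \<open>1\<close>, so an additive property of \<open>m\<close> only has to be checked on
  the components \<open>e\<^sub>i m\<close>.\<close>

lemma idem_induct:
  assumes M: "left_module C M" and m: "m \<in> carrier M"
    and zero: "P \<zero>\<^bsub>M\<^esub>"
    and add: "\<And>u v. \<lbrakk>u \<in> carrier M; v \<in> carrier M; P u; P v\<rbrakk> \<Longrightarrow> P (u \<oplus>\<^bsub>M\<^esub> v)"
    and idem: "\<And>i. i \<in> {1..n} \<Longrightarrow> P (C_idem k n i \<odot>\<^bsub>M\<^esub> m)"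
  shows "P m"
proof -
  interpret M: left_module C M by fact
  define e where "e V = (\<lambda>p. if is_path n p \<and> fst p = [] \<and> snd p \<in> V then 1 else 0 :: complex)" for V
  have ec: "e V \<in> carrier A" for V by (auto simp: carrier_A e_def)
  have "P (C_class k n (e V) \<odot>\<^bsub>M\<^esub> m)" if "finite V" "V \<subseteq> {1..n}" for V
    using that
  proof (induction V)
    case empty
    have "e {} = \<zero>\<^bsub>A\<^esub>" by (auto simp: e_def zero_A)
    then have "C_class k n (e {}) = \<zero>\<^bsub>C\<^esub>"
      using ring_hom_zero[OF C_class_hom ring_A ring_C] by simp
    then show ?case using zero m by (simp add: M.smult_l_null)
  next
    case (insert i V)
    have i: "is_path n ([], i)" using insert.prems by simp
    have "e (insert i V) = path_elem ([], i) \<oplus>\<^bsub>A\<^esub> e V"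
      using insert.hyps i by (auto simp: e_def add_A path_elem_def fun_eq_iff)
    then have "C_class k n (e (insert i V)) \<odot>\<^bsub>M\<^esub> m =
        C_idem k n i \<odot>\<^bsub>M\<^esub> m \<oplus>\<^bsub>M\<^esub> C_class k n (e V) \<odot>\<^bsub>M\<^esub> m"
      using C_class_add[OF path_elem_closed[OF i] ec] m
      by (simp add: C_idem_def M.smult_l_distr C_class_closed path_elem_closed[OF i] ec)
    moreover have "i \<in> {1..n}" using insert.prems by simp
    ultimately show ?case
      using add[OF _ _ idem insert.IH] insert.prems M.smult_closed m idem_closed C_class_closed[OF ec]
      by simp
  qed
  from this[of "{1..n}"] have "P (C_class k n (e {1..n}) \<odot>\<^bsub>M\<^esub> m)" by simp
  moreover have "e {1..n} = \<one>\<^bsub>A\<^esub>" using is_path_range(1) by (auto simp: e_def one_A fun_eq_iff)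
  ultimately show ?thesis using m by (simp add: C_class_one M.smult_one)
qed

lemma ex_path:
  assumes "m \<in> {1..n}" "i \<in> {1..n}"
  obtains p where "is_path n p" "snd p = m" "path_end n p = i"
proof -
  let ?R = "\<lambda>i. \<exists>p. is_path n p \<and> snd p = m \<and> path_end n p = i"
  have up: "?R (nextv n j)" if "?R j" "j \<in> {1..n}" for j
  proof -
    from that(1) obtain w where "is_path n (w, m)" "path_end n (w, m) = j" by auto
    then show ?thesis using that(2) by (intro exI[of _ "(X j # w, m)"]) (auto simp: arrows_def)
  qed
  have pow: "?R ((nextv n ^^ d) m)" for d
  proof (induction d)
    case 0
    then show ?case using assms(1) by (intro exI[of _ "([], m)"]) simp
  next
    case (Suc d)
    then show ?case using up nextv_pow_range[OF assms(1)] by simp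
  qed
  have "m - 1 + (i + (n - m)) = i - 1 + n" using assms by auto
  then have "(nextv n ^^ (i + (n - m))) m = (i - 1 + n) mod n + 1"
    unfolding nextv_pow[OF assms(1)] by simp
  also have "\<dots> = i" using assms(2) by (simp only: mod_add_self2) auto
  finally show thesis using pow that by metis
qed

section \<open>Generating a vertex component\<close>

text \<open>The \<open>\<complex>[[t]]\<close>-span of the values at the vertex \<open>i\<close> of the morphisms \<open>H a\<close> with \<open>a \<in> S\<close>, written as
  the values of the map \<open>M\<^sub>I\<^sup>S \<rightarrow> M\<close> on elements concentrated at \<open>i\<close>.\<close>

definition vspan where
  "vspan M i H S = {\<Oplus>\<^bsub>M\<^esub>a\<in>S. H a (at_vertex i (c a)) | c :: 'b \<Rightarrow> complex fps. True}"

lemma at_vertex_add: "at_vertex i (c + d) = at_vertex i c \<oplus>\<^bsub>MM I\<^esub> at_vertex i d"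
  by (auto simp: at_vertex_def add_MM)

lemma t_series_at_vertex:
  assumes "I \<in> k_subsets k n" "i \<in> {1..n}"
  shows "C_class k n (t_series n f) \<odot>\<^bsub>MM I\<^esub> at_vertex i c = at_vertex i (f * c)"
  using t_series_smult_MM[OF assms(1) at_vertex_closed[OF assms(2)]] by (auto simp: at_vertex_def)

context
  fixes M :: "(C_elem, 'm) module" and I :: "nat set" and i :: nat
    and H :: "'b \<Rightarrow> (nat \<Rightarrow> complex fps) \<Rightarrow> 'm" and S :: "'b set"
  assumes M: "left_module C M" and I: "I \<in> k_subsets k n" and i: "i \<in> {1..n}"
    and HS: "H \<in> S \<rightarrow> lmod_hom C (MM I) M"
begin

interpretation M: left_module C M by (rule M)

lemma H_hom: "a \<in> S \<Longrightarrow> H a \<in> lmod_hom C (MM I) M"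
  using HS by auto

lemma H_closed: "a \<in> S \<Longrightarrow> H a (at_vertex i c) \<in> carrier M"
  by (rule lmod_hom_closed[OF H_hom at_vertex_closed[OF i]])

lemma vspanI: "(\<Oplus>\<^bsub>M\<^esub>a\<in>S. H a (at_vertex i (c a))) \<in> vspan M i H S"
  unfolding vspan_def by (intro CollectI exI[of _ c]) simp

lemma vspan_sum_add:
  "(\<Oplus>\<^bsub>M\<^esub>a\<in>S. H a (at_vertex i (c a + d a))) =
    (\<Oplus>\<^bsub>M\<^esub>a\<in>S. H a (at_vertex i (c a))) \<oplus>\<^bsub>M\<^esub> (\<Oplus>\<^bsub>M\<^esub>a\<in>S. H a (at_vertex i (d a)))"
  (is "?l = ?r")
proof -
  have "?l = (\<Oplus>\<^bsub>M\<^esub>a\<in>S. H a (at_vertex i (c a)) \<oplus>\<^bsub>M\<^esub> H a (at_vertex i (d a)))"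
    by (rule M.M.finsum_cong'[OF refl])
      (auto simp: H_closed at_vertex_add[of i _ _ I] lmod_hom_add[OF H_hom] at_vertex_closed[OF i])
  also have "\<dots> = ?r" by (rule M.M.finsum_addf) (auto simp: H_closed)
  finally show ?thesis .
qed

lemma vspan_sum_smult:
  "C_class k n (t_series n f) \<odot>\<^bsub>M\<^esub> (\<Oplus>\<^bsub>M\<^esub>a\<in>S. H a (at_vertex i (c a))) =
    (\<Oplus>\<^bsub>M\<^esub>a\<in>S. H a (at_vertex i (f * c a)))"
proof -
  have f: "C_class k n (t_series n f) \<in> carrier C" by (intro C_class_closed t_series_closed)
  have "C_class k n (t_series n f) \<odot>\<^bsub>M\<^esub> (\<Oplus>\<^bsub>M\<^esub>a\<in>S. H a (at_vertex i (c a))) =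
      (\<Oplus>\<^bsub>M\<^esub>a\<in>S. C_class k n (t_series n f) \<odot>\<^bsub>M\<^esub> H a (at_vertex i (c a)))"
    by (rule M.smult_finsum[OF f]) (auto simp: H_closed)
  also have "\<dots> = (\<Oplus>\<^bsub>M\<^esub>a\<in>S. H a (at_vertex i (f * c a)))"
    by (rule M.M.finsum_cong'[OF refl])
      (auto simp: t_series_at_vertex[OF I i, symmetric] lmod_hom_smult[OF H_hom f at_vertex_closed[OF i]]
        intro!: M.smult_closed[OF f] H_closed)
  finally show ?thesis .
qed

lemma H_zero: "a \<in> S \<Longrightarrow> H a (at_vertex i 0) = \<zero>\<^bsub>M\<^esub>"
  using lmod_hom_zero[OF left_module_MM[OF I] M H_hom] by (simp add: zero_MM at_vertex_def)

lemma vspan_zero: "\<zero>\<^bsub>M\<^esub> \<in> vspan M i H S"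
proof -
  have "(\<Oplus>\<^bsub>M\<^esub>a\<in>S. H a (at_vertex i 0)) = \<zero>\<^bsub>M\<^esub>" by (rule M.M.add.finprod_one_eqI) (rule H_zero)
  then show ?thesis using vspanI[of "\<lambda>_. 0"] by simp
qed

lemma vspan_add: "\<lbrakk>u \<in> vspan M i H S; v \<in> vspan M i H S\<rbrakk> \<Longrightarrow> u \<oplus>\<^bsub>M\<^esub> v \<in> vspan M i H S"
  using vspanI by (auto simp: vspan_def vspan_sum_add[symmetric])

lemma vspan_base:
  assumes "finite S" "b \<in> S" shows "H b (at_vertex i c) \<in> vspan M i H S"
proof -
  have "(\<Oplus>\<^bsub>M\<^esub>a\<in>S. H a (at_vertex i (if b = a then c else 0))) =
      (\<Oplus>\<^bsub>M\<^esub>a\<in>S. if b = a then H a (at_vertex i c) else \<zero>\<^bsub>M\<^esub>)"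
    by (rule M.M.finsum_cong'[OF refl]) (auto simp: H_closed H_zero)
  also have "\<dots> = H b (at_vertex i c)"
    by (rule M.M.finsum_singleton) (use assms H_closed in auto)
  finally show ?thesis using vspanI[of "\<lambda>a. if b = a then c else 0"] by simp
qed

end

text \<open>The relation can be solved for the generator \<open>b\<close>, whose coefficient is invertible.\<close>

lemma vspan_remove:
  assumes M: "left_module C M" and I: "I \<in> k_subsets k n" and i: "i \<in> {1..n}"
    and H: "H \<in> S \<rightarrow> lmod_hom C (MM I) M"
    and S: "finite S" "b \<in> S" and u: "c b $ 0 \<noteq> 0"
    and rel: "(\<Oplus>\<^bsub>M\<^esub>a\<in>S. H a (at_vertex i (c a))) = \<zero>\<^bsub>M\<^esub>"
  shows "vspan M i H S \<subseteq> vspan M i H (S - {b})"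
proof
  interpret M: left_module C M by (rule M)
  have H': "H \<in> S - {b} \<rightarrow> lmod_hom C (MM I) M" using H by blast
  note Hc = H_closed[OF M I i H]
  fix m assume "m \<in> vspan M i H S"
  then obtain d where d: "m = (\<Oplus>\<^bsub>M\<^esub>a\<in>S. H a (at_vertex i (d a)))" by (auto simp: vspan_def)
  have mc: "m \<in> carrier M" unfolding d by (rule M.M.finsum_closed) (auto simp: Hc)
  \<comment> \<open>Adding \<open>f\<close> times the relation cancels the coefficient at \<open>b\<close>.\<close>
  define f where "f = - d b * inverse (c b)"
  have f: "d b + f * c b = 0" using u by (simp add: f_def inverse_mult_eq_1 mult.assoc)
  have "m = m \<oplus>\<^bsub>M\<^esub> C_class k n (t_series n f) \<odot>\<^bsub>M\<^esub> (\<Oplus>\<^bsub>M\<^esub>a\<in>S. H a (at_vertex i (c a)))"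
    using mc by (simp add: rel M.smult_r_null C_class_closed t_series_closed)
  also have "\<dots> = (\<Oplus>\<^bsub>M\<^esub>a\<in>S. H a (at_vertex i (d a + f * c a)))"
    by (simp only: d vspan_sum_smult[OF M I i H] vspan_sum_add[OF M I i H])
  also have "\<dots> = (\<Oplus>\<^bsub>M\<^esub>a\<in>insert b (S - {b}). H a (at_vertex i (d a + f * c a)))"
    using S(2) by (simp add: insert_absorb)
  also have "\<dots> = H b (at_vertex i (d b + f * c b)) \<oplus>\<^bsub>M\<^esub> (\<Oplus>\<^bsub>M\<^esub>a\<in>S - {b}. H a (at_vertex i (d a + f * c a)))"
    by (rule M.M.finsum_insert) (use S Hc in auto)
  also have "\<dots> = (\<Oplus>\<^bsub>M\<^esub>a\<in>S - {b}. H a (at_vertex i (d a + f * c a)))"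
    unfolding f H_zero[OF M I i H S(2)]
    by (rule M.M.l_zero, rule M.M.finsum_closed) (auto simp: Hc)
  finally show "m \<in> vspan M i H (S - {b})" using vspanI[OF M I i H'] by simp
qed

text \<open>Dividing a nontrivial relation by the largest possible power of \<open>t\<close>, which is allowed by
  torsion-freeness, makes one of its coefficients invertible.  This is where it matters that
  \<open>\<complex>[[t]]\<close> is a discrete valuation ring.\<close>
lemma minimal_independent:
  assumes M: "M \<in> CM_C k n" and I: "I \<in> k_subsets k n" and i: "i \<in> {1..n}"
    and H: "H \<in> S \<rightarrow> lmod_hom C (MM I) M"
    and S: "finite S" and min: "\<And>b. b \<in> S \<Longrightarrow> \<not> vspan M i H S \<subseteq> vspan M i H (S - {b})"
    and rel: "(\<Oplus>\<^bsub>M\<^esub>a\<in>S. H a (at_vertex i (c a))) = \<zero>\<^bsub>M\<^esub>"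
    and a: "a \<in> S"
  shows "c a = 0"
proof (rule ccontr)
  assume "c a \<noteq> 0"
  have lm: "left_module C M" using M by (simp add: CM_C_def)
  interpret M: left_module C M by (rule lm)
  define N where "N = {a \<in> S. c a \<noteq> 0}"
  have "finite N" "N \<noteq> {}" using S a \<open>c a \<noteq> 0\<close> by (auto simp: N_def)
  then obtain b where b: "b \<in> N" "\<And>a. a \<in> N \<Longrightarrow> subdegree (c b) \<le> subdegree (c a)"
    using ex_min_if_finite[of "(\<lambda>a. subdegree (c a)) ` N"] by (auto simp: not_less)
  define d where "d = subdegree (c b)"
  define c' where "c' a = fps_shift d (c a)" for a
  have c': "fps_X ^ d * c' a = c a" if "a \<in> S" for a
  proof (cases "c a = 0")
    case False
    then have "d \<le> subdegree (c a)" using b(2) that by (simp add: N_def d_def)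
    then show ?thesis unfolding c'_def mult.commute[of "fps_X ^ d"] by (rule fps_shift_times_fps_X_power)
  qed (simp add: c'_def)
  have "(\<Oplus>\<^bsub>M\<^esub>a\<in>S. H a (at_vertex i (c a))) = (\<Oplus>\<^bsub>M\<^esub>a\<in>S. H a (at_vertex i (fps_X ^ d * c' a)))"
    by (rule M.M.finsum_cong'[OF refl]) (auto simp: c' H_closed[OF lm I i H])
  then have "C_class k n (t_series n (fps_X ^ d)) \<odot>\<^bsub>M\<^esub> (\<Oplus>\<^bsub>M\<^esub>a\<in>S. H a (at_vertex i (c' a))) = \<zero>\<^bsub>M\<^esub>"
    using rel unfolding vspan_sum_smult[OF lm I i H] by simp
  then have "(\<Oplus>\<^bsub>M\<^esub>a\<in>S. H a (at_vertex i (c' a))) = \<zero>\<^bsub>M\<^esub>"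
    by (rule t_power_torsion_free[OF M, rotated])
      (rule M.M.finsum_closed, auto simp: H_closed[OF lm I i H])
  moreover have "c' b $ 0 \<noteq> 0" using b(1) by (simp add: c'_def d_def N_def)
  moreover have "b \<in> S" using b(1) by (simp add: N_def)
  ultimately show False
    using vspan_remove[OF lm I i H S, of b c'] min by blast
qed

text \<open>A family of morphisms \<open>M\<^sub>I \<rightarrow> M\<close> whose values at \<open>i\<close> generate \<open>e\<^sub>i M\<close> puts \<open>M\<close> into \<open>F(I,i)\<close>: a minimal
  subfamily \<open>S\<close> is independent by \<open>minimal_independent\<close>, and its sum is the required injection.
  Injectivity at other vertices follows by transport to \<open>i\<close> along a path, which acts injectively
  on \<open>M\<^sub>I\<close>.\<close>
lemma F_catI:
  assumes M: "M \<in> CM_C k n" and I: "I \<in> k_subsets k n" and i: "i \<in> {1..n}"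
    and H0: "H \<in> S0 \<rightarrow> lmod_hom C (MM I) M"
    and S0: "finite S0" and span: "vertex_part k n i M \<subseteq> vspan M i H S0"
  shows "M \<in> F_cat k n I i"
proof -
  have lm: "left_module C M" using M by (simp add: CM_C_def)
  interpret M: left_module C M by (rule lm)
  note lmI = left_module_MM[OF I]
  define Q where "Q T \<longleftrightarrow> T \<subseteq> S0 \<and> vertex_part k n i M \<subseteq> vspan M i H T" for T
  have "Q S0" using span by (simp add: Q_def)
  from ex_has_least_nat[of Q, OF this, of card]
  obtain S where QS: "Q S" and least: "\<And>T. Q T \<Longrightarrow> card S \<le> card T" by metis
  have S: "S \<subseteq> S0" "vertex_part k n i M \<subseteq> vspan M i H S" using QS by (simp_all add: Q_def)
  have fin: "finite S" using S(1) S0 finite_subset by blast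
  have H: "H \<in> S \<rightarrow> lmod_hom C (MM I) M" using H0 S(1) by blast
  have min: "\<not> vspan M i H S \<subseteq> vspan M i H (S - {b})" if b: "b \<in> S" for b
  proof
    assume "vspan M i H S \<subseteq> vspan M i H (S - {b})"
    then have "Q (S - {b})" using S by (auto simp: Q_def)
    then have "card S \<le> card (S - {b})" by (rule least)
    then show False using fin b by (metis card_Diff1_less not_less)
  qed
  note Hc = H_closed[OF lm I i H]
  obtain \<beta> where \<beta>: "bij_betw \<beta> {..<card S} S"
    using ex_bij_betw_nat_finite[OF fin] by (auto simp: atLeast0LessThan)
  let ?r = "card S" let ?P = "lmod_pow (MM I) (card S)"
  have \<beta>S: "\<beta> q \<in> S" if "q < ?r" for q using \<beta> that by (auto simp: bij_betw_def)
  have lmP: "left_module C ?P" by (rule left_module_lmod_sum[OF ring_C lmI])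
  interpret P: left_module C ?P by (rule lmP)
  define f where "f = (\<lambda>u\<in>carrier ?P. \<Oplus>\<^bsub>M\<^esub>q\<in>{..<?r}.
    (\<lambda>u\<in>carrier ?P. H (\<beta> q) ((\<lambda>u\<in>carrier ?P. u q) u)) u)"
  have f: "f \<in> lmod_hom C ?P M"
    unfolding f_def
    by (rule lmod_hom_pointwise_sum[OF lmP lm], rule lmod_hom_comp[OF lmP lmod_proj_hom[OF lmP]])
      (use H \<beta>S in auto)
  have uq: "u q \<in> carrier (MM I)" if "u \<in> carrier ?P" "q < ?r" for u q
    using that by (auto simp: lmod_sum_def)
  have f_at_vertex: "f u = (\<Oplus>\<^bsub>M\<^esub>a\<in>S. H a (at_vertex i (c a)))"
    if u: "u \<in> carrier ?P" "\<And>q. q < ?r \<Longrightarrow> u q = at_vertex i (c (\<beta> q))" for u c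
  proof -
    have "f u = (\<Oplus>\<^bsub>M\<^esub>q\<in>{..<?r}. H (\<beta> q) (at_vertex i (c (\<beta> q))))"
      unfolding f_def restrict_apply using u(1)
      by (simp, intro M.M.finsum_cong'[OF refl]) (auto simp: u(2) intro: Hc \<beta>S)
    also have "\<dots> = (\<Oplus>\<^bsub>M\<^esub>a\<in>\<beta> ` {..<?r}. H a (at_vertex i (c a)))"
      by (rule M.M.finsum_reindex[symmetric])
        (use \<beta> in \<open>auto simp: bij_betw_def intro: Hc\<close>)
    finally show ?thesis using \<beta> by (simp add: bij_betw_def)
  qed
  have smP: "(a \<odot>\<^bsub>?P\<^esub> u) q = a \<odot>\<^bsub>MM I\<^esub> u q" if "q < ?r" for a u q
    using that by (simp add: lmod_sum_def)
  have extP: "u = v" if "u \<in> carrier ?P" "v \<in> carrier ?P" "\<And>q. q < ?r \<Longrightarrow> u q = v q" for u v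
    using that by (intro PiE_ext[of u "{..<?r}" "\<lambda>_. carrier (MM I)" v]) (auto simp: lmod_sum_def)
  have inj: "inj_on f (carrier ?P)"
  proof
    fix u v assume u: "u \<in> carrier ?P" and v: "v \<in> carrier ?P" and fuv: "f u = f v"
    show "u = v"
    proof (rule extP[OF u v], rule MM_eqI[OF uq[OF u] uq[OF v]])
      fix q m assume q: "q < ?r" and m: "m \<in> {1..n}"
      obtain p where p: "is_path n p" "snd p = m" "path_end n p = i" using ex_path[OF m i] .
      \<comment> \<open>Acting with \<open>p\<close> moves the components at \<open>m\<close> to \<open>i\<close>, where independence applies.\<close>
      define e where "e = C_class k n (path_elem p)"
      have e: "e \<in> carrier C" unfolding e_def by (rule C_class_closed[OF path_elem_closed[OF p(1)]])
      define \<gamma> where "\<gamma> = inv_into {..<?r} \<beta>"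
      have \<gamma>: "\<gamma> (\<beta> q) = q" if "q < ?r" for q
        unfolding \<gamma>_def using \<beta> that by (auto simp: bij_betw_def)
      define c where "c w a = (e \<odot>\<^bsub>MM I\<^esub> w (\<gamma> a)) i" for w a
      have at_i: "e \<odot>\<^bsub>MM I\<^esub> w = at_vertex i ((e \<odot>\<^bsub>MM I\<^esub> w) i)" for w
        unfolding e_def using path_smult_MM[OF I p(1)] unfolding p(3) .
      have fe: "f (e \<odot>\<^bsub>?P\<^esub> w) = (\<Oplus>\<^bsub>M\<^esub>a\<in>S. H a (at_vertex i (c w a)))" if w: "w \<in> carrier ?P" for w
        by (rule f_at_vertex[OF P.smult_closed[OF e w]])
          (simp add: smP c_def \<gamma>, rule at_i)
      have "f (e \<odot>\<^bsub>?P\<^esub> u) = f (e \<odot>\<^bsub>?P\<^esub> v)"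
        using fuv by (simp add: lmod_hom_smult[OF f e] u v)
      then have eq: "(\<Oplus>\<^bsub>M\<^esub>a\<in>S. H a (at_vertex i (c u a))) = (\<Oplus>\<^bsub>M\<^esub>a\<in>S. H a (at_vertex i (c v a)))"
        using fe u v by simp
      have cl: "(\<Oplus>\<^bsub>M\<^esub>a\<in>S. H a (at_vertex i (d a))) \<in> carrier M" for d
        by (rule M.M.finsum_closed) (auto simp: Hc)
      have "(\<Oplus>\<^bsub>M\<^esub>a\<in>S. H a (at_vertex i (c u a))) =
          (\<Oplus>\<^bsub>M\<^esub>a\<in>S. H a (at_vertex i (c u a - c v a))) \<oplus>\<^bsub>M\<^esub> (\<Oplus>\<^bsub>M\<^esub>a\<in>S. H a (at_vertex i (c v a)))"
        using vspan_sum_add[OF lm I i H, of "\<lambda>a. c u a - c v a" "c v"] by simp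
      then have "(\<Oplus>\<^bsub>M\<^esub>a\<in>S. H a (at_vertex i (c u a - c v a))) = \<zero>\<^bsub>M\<^esub>"
        unfolding eq by (rule iffD1[OF M.M.add.r_cancel_one'[OF cl cl]])
      from minimal_independent[OF M I i H fin min this \<beta>S[OF q]]
      have "c u (\<beta> q) - c v (\<beta> q) = 0" by simp
      then have "(e \<odot>\<^bsub>MM I\<^esub> u q) i = (e \<odot>\<^bsub>MM I\<^esub> v q) i" by (simp add: c_def \<gamma>[OF q])
      then have "lift I (e \<odot>\<^bsub>MM I\<^esub> u q) i = lift I (e \<odot>\<^bsub>MM I\<^esub> v q) i" by (simp add: lift_def)
      then show "lift I (u q) m = lift I (v q) m"
        unfolding e_def by (simp add: lift_path_smult[OF I p(1)] p)
    qed
  qed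
  have "f ` vertex_part k n i ?P = vertex_part k n i M"
  proof (intro equalityI subsetI)
    fix m assume "m \<in> f ` vertex_part k n i ?P"
    then obtain u where "u \<in> carrier ?P" "m = f (C_idem k n i \<odot>\<^bsub>?P\<^esub> u)" by (auto simp: vertex_part_def)
    then show "m \<in> vertex_part k n i M"
      using lmod_hom_smult[OF f idem_closed[OF i]] lmod_hom_closed[OF f] by (auto simp: vertex_part_def)
  next
    fix m assume "m \<in> vertex_part k n i M"
    then obtain c where m: "m = (\<Oplus>\<^bsub>M\<^esub>a\<in>S. H a (at_vertex i (c a)))" using S(2) by (auto simp: vspan_def)
    let ?u = "\<lambda>q\<in>{..<?r}. at_vertex i (c (\<beta> q))"
    have u: "?u \<in> carrier ?P" using at_vertex_closed[OF i] by (auto simp: lmod_sum_def)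
    have "m = f ?u" unfolding m by (rule f_at_vertex[symmetric, OF u]) simp
    moreover have "?u = C_idem k n i \<odot>\<^bsub>?P\<^esub> ?u"
      by (rule extP[OF u P.smult_closed[OF idem_closed[OF i] u]])
        (simp add: smP idem_smult_MM[OF I i], simp add: at_vertex_def)
    ultimately show "m \<in> f ` vertex_part k n i ?P" using u unfolding vertex_part_def by blast
  qed
  then show ?thesis using f inj M unfolding F_cat_def by blast
qed

section \<open>Quotients of powers of B\<close>

lemma left_module_B:
  assumes "\<And>l. l \<in> {1..n} \<Longrightarrow> \<I> l \<in> k_subsets k n"
  shows "left_module C (B_mod n \<I>)"
  unfolding B_mod_def by (rule left_module_lmod_sum[OF ring_C left_module_MM[OF assms]])

text \<open>Let \<open>g\<close> map a power of \<open>B\<close> onto \<open>M\<close>.  The inclusions of the summands \<open>M_(I\<^sub>l)\<close> into this power,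
  preceded by the morphisms \<open>M_(I\<^sub>j) \<rightarrow> M_(I\<^sub>l)\<close> that are the identity at \<open>j - 1\<close> and followed by
  \<open>g\<close>, are morphisms \<open>M_(I\<^sub>j) \<rightarrow> M\<close> whose values generate \<open>M\<close> at \<open>j - 1\<close>.\<close>
lemma CM_B_subset_F_cat:
  assumes \<I>: "\<And>l. l \<in> {1..n} \<Longrightarrow> \<I> l \<in> k_subsets k n"
    and le: "\<And>l. l \<in> {1..n} \<Longrightarrow> subset_le n j (\<I> j) (\<I> l)" and j: "j \<in> {1..n}"
    and MB: "M \<in> CM_B k n (B_mod n \<I>)"
  shows "M \<in> F_cat k n (\<I> j) (prevv n j)"
proof -
  let ?B = "B_mod n \<I>" and ?i = "prevv n j" and ?N = "\<lambda>l. MM (\<I> l)"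
  have i: "?i \<in> {1..n}" by (rule prevv_range[OF j])
  have M: "M \<in> CM_C k n" using MB by (simp add: CM_B_def)
  have lm: "left_module C M" using M by (simp add: CM_C_def)
  interpret M: left_module C M by (rule lm)
  note lmB = left_module_B[of \<I>, OF \<I>]
  have lmN: "left_module C (?N l)" if "l \<in> {1..n}" for l using left_module_MM[OF \<I>[OF that]] .
  obtain s g where g: "g \<in> lmod_hom C (lmod_pow ?B s) M" "g ` carrier (lmod_pow ?B s) = carrier M"
    using MB by (auto simp: CM_B_def)
  have lmP: "left_module C (lmod_pow ?B s)" by (rule left_module_lmod_sum[OF ring_C lmB])
  interpret P: left_module C "lmod_pow ?B s" by (rule lmP)
  have "\<forall>l\<in>{1..n}. \<exists>h. h \<in> lmod_hom C (?N j) (?N l) \<and> (\<forall>c. h (at_vertex ?i c) = at_vertex ?i c)"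
  proof
    fix l assume l: "l \<in> {1..n}"
    obtain h where "h \<in> lmod_hom C (?N j) (?N l)" "\<And>c. h (at_vertex ?i c) = at_vertex ?i c"
      by (rule subset_le_hom[OF le[OF l] j \<I>[OF j] \<I>[OF l]]) (rule that)
    then show "\<exists>h. h \<in> lmod_hom C (?N j) (?N l) \<and> (\<forall>c. h (at_vertex ?i c) = at_vertex ?i c)" by blast
  qed
  from bchoice[OF this] obtain h where h: "\<And>l. l \<in> {1..n} \<Longrightarrow> h l \<in> lmod_hom C (?N j) (?N l)"
    "\<And>l c. l \<in> {1..n} \<Longrightarrow> h l (at_vertex ?i c) = at_vertex ?i c" by blast
  define S where "S = {1..n} \<times> {..<s}"
  define iota where "iota = (\<lambda>l p v. lmod_inj {..<s} (\<lambda>_. ?B) p (lmod_inj {1..n} ?N l v))"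
  have iota: "(\<lambda>v\<in>carrier (?N l). g (iota l p v)) \<in> lmod_hom C (?N l) M" if l: "l \<in> {1..n}" and p: "p < s" for l p
  proof -
    have 1: "(\<lambda>v\<in>carrier (?N l). lmod_inj {1..n} ?N l v) \<in> lmod_hom C (?N l) ?B"
      unfolding B_mod_def by (rule lmod_inj_hom[of "{1..n}" C ?N l, OF lmN l])
    have 2: "(\<lambda>v\<in>carrier ?B. lmod_inj {..<s} (\<lambda>_. ?B) p v) \<in> lmod_hom C ?B (lmod_pow ?B s)"
      using lmod_inj_hom[of "{..<s}" C "\<lambda>_. ?B" p, OF lmB] p by simp
    note 3 = lmod_hom_comp[OF lmN[OF l] lmod_hom_comp[OF lmN[OF l] 1 2] g(1)]
    have "(\<lambda>v\<in>carrier (?N l). g ((\<lambda>v\<in>carrier (?N l). (\<lambda>v\<in>carrier ?B. lmod_inj {..<s} (\<lambda>_. ?B) p v)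
        ((\<lambda>v\<in>carrier (?N l). lmod_inj {1..n} ?N l v) v)) v)) = (\<lambda>v\<in>carrier (?N l). g (iota l p v))"
      using lmod_hom_closed[OF 1] by (intro restrict_ext) (simp add: iota_def)
    then show ?thesis using 3 by argo
  qed
  define H where "H = (\<lambda>(l, p). \<lambda>v\<in>carrier (?N j). (\<lambda>v\<in>carrier (?N l). g (iota l p v)) (h l v))"
  have H: "H \<in> S \<rightarrow> lmod_hom C (?N j) M"
  proof
    fix a assume "a \<in> S"
    then obtain l p where a: "a = (l, p)" and l: "l \<in> {1..n}" and p: "p < s" by (auto simp: S_def)
    show "H a \<in> lmod_hom C (?N j) M"
      using lmod_hom_comp[OF lmN[OF j] h(1)[OF l] iota[OF l p]] by (simp only: a H_def prod.case)
  qed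
  have finS: "finite S" by (simp add: S_def)
  have H_at_vertex: "H (l, p) (at_vertex ?i c) = g (iota l p (at_vertex ?i c))" if "l \<in> {1..n}" for l p c
    using that at_vertex_closed[OF i] by (simp add: H_def h(2))
  let ?e = "C_idem k n ?i" and ?Sp = "vspan M ?i H S"
  have e: "?e \<in> carrier C" by (rule idem_closed[OF i])
  note sp = vspan_zero[OF lm \<I>[OF j] i H] vspan_add[OF lm \<I>[OF j] i H]
    vspan_base[OF lm \<I>[OF j] i H finS]
  have gz: "g \<zero>\<^bsub>lmod_pow ?B s\<^esub> = \<zero>\<^bsub>M\<^esub>" by (rule lmod_hom_zero[OF lmP lm g(1)])
  have "vertex_part k n ?i M \<subseteq> ?Sp"
  proof
    fix m assume "m \<in> vertex_part k n ?i M"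
    then obtain m' where "m' \<in> carrier M" "m = ?e \<odot>\<^bsub>M\<^esub> m'" by (auto simp: vertex_part_def)
    moreover from this(1) g(2) have "m' \<in> g ` carrier (lmod_pow ?B s)" by simp
    ultimately obtain b where b: "b \<in> carrier (lmod_pow ?B s)" "m = ?e \<odot>\<^bsub>M\<^esub> g b" by auto
    have "?e \<odot>\<^bsub>M\<^esub> g b \<in> ?Sp"
    proof (rule lmod_sum_induct[where P = "\<lambda>b. ?e \<odot>\<^bsub>M\<^esub> g b \<in> ?Sp" and R = C, OF finite_lessThan b(1)])
      show "?e \<odot>\<^bsub>M\<^esub> g \<zero>\<^bsub>lmod_pow ?B s\<^esub> \<in> ?Sp" unfolding gz M.smult_r_null[OF e] by (rule sp(1))
      show "?e \<odot>\<^bsub>M\<^esub> g (u \<oplus>\<^bsub>lmod_pow ?B s\<^esub> v) \<in> ?Sp"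
        if uv: "u \<in> carrier (lmod_pow ?B s)" "v \<in> carrier (lmod_pow ?B s)"
          and P: "?e \<odot>\<^bsub>M\<^esub> g u \<in> ?Sp" "?e \<odot>\<^bsub>M\<^esub> g v \<in> ?Sp" for u v
        unfolding lmod_hom_add[OF g(1) uv]
          M.smult_r_distr[OF e lmod_hom_closed[OF g(1) uv(1)] lmod_hom_closed[OF g(1) uv(2)]]
        by (rule sp(2)[OF P])
      show "left_module C ?B" by (rule lmB)
      fix p w assume "p \<in> {..<s}" and w: "w \<in> carrier ?B"
      then have p: "p < s" by simp
      have ih: "(\<lambda>v\<in>carrier ?B. lmod_inj {..<s} (\<lambda>_. ?B) p v) \<in> lmod_hom C ?B (lmod_pow ?B s)"
        using lmod_inj_hom[of "{..<s}" C "\<lambda>_. ?B" p, OF lmB] p by simp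
      define g' where "g' = (\<lambda>v\<in>carrier ?B. g ((\<lambda>v\<in>carrier ?B. lmod_inj {..<s} (\<lambda>_. ?B) p v) v))"
      have g': "g' \<in> lmod_hom C ?B M" unfolding g'_def by (rule lmod_hom_comp[OF lmB ih g(1)])
      have g'w: "g' w = g (lmod_inj {..<s} (\<lambda>_. ?B) p w)" if "w \<in> carrier ?B" for w
        using that by (simp add: g'_def)
      have gz': "g' \<zero>\<^bsub>?B\<^esub> = \<zero>\<^bsub>M\<^esub>" by (rule lmod_hom_zero[OF lmB lm g'])
      note Bd = B_mod_def[of n \<I>, symmetric]
      have "?e \<odot>\<^bsub>M\<^esub> g' w \<in> ?Sp"
      proof (rule lmod_sum_induct[where P = "\<lambda>w. ?e \<odot>\<^bsub>M\<^esub> g' w \<in> ?Sp" and R = C and N = ?N and J = "{1..n}",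
            OF finite_atLeastAtMost, unfolded Bd])
        show "w \<in> carrier ?B" by (rule w)
        show "?e \<odot>\<^bsub>M\<^esub> g' \<zero>\<^bsub>?B\<^esub> \<in> ?Sp"
          unfolding gz' M.smult_r_null[OF e] by (rule sp(1))
        show "?e \<odot>\<^bsub>M\<^esub> g' (u \<oplus>\<^bsub>?B\<^esub> v) \<in> ?Sp"
          if uv: "u \<in> carrier ?B" "v \<in> carrier ?B"
            and P: "?e \<odot>\<^bsub>M\<^esub> g' u \<in> ?Sp" "?e \<odot>\<^bsub>M\<^esub> g' v \<in> ?Sp" for u v
          unfolding lmod_hom_add[OF g' uv]
            M.smult_r_distr[OF e lmod_hom_closed[OF g' uv(1)] lmod_hom_closed[OF g' uv(2)]]
          by (rule sp(2)[OF P])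
        show "left_module C (?N l)" if "l \<in> {1..n}" for l by (rule lmN[OF that])
        fix l v assume l: "l \<in> {1..n}" and v: "v \<in> carrier (?N l)"
        have "lmod_inj {1..n} ?N l v \<in> carrier ?B"
          unfolding B_mod_def by (rule lmod_inj_closed[of "{1..n}" C ?N, OF lmN l v])
        then have gi: "g' (lmod_inj {1..n} ?N l v) = (\<lambda>v\<in>carrier (?N l). g (iota l p v)) v"
          using v by (simp add: g'w iota_def)
        have "?e \<odot>\<^bsub>M\<^esub> g' (lmod_inj {1..n} ?N l v) = (\<lambda>v\<in>carrier (?N l). g (iota l p v)) (?e \<odot>\<^bsub>?N l\<^esub> v)"
          unfolding gi by (rule lmod_hom_smult[symmetric, OF iota[OF l p] e v])
        also have "\<dots> = g (iota l p (at_vertex ?i (v ?i)))"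
          using at_vertex_closed[OF i] by (simp add: idem_smult_MM[OF \<I>[OF l] i])
        also have "\<dots> = H (l, p) (at_vertex ?i (v ?i))" using H_at_vertex[OF l] by simp
        finally have eq: "?e \<odot>\<^bsub>M\<^esub> g' (lmod_inj {1..n} ?N l v) = H (l, p) (at_vertex ?i (v ?i))" .
        have "(l, p) \<in> S" using l p by (simp add: S_def)
        then show "?e \<odot>\<^bsub>M\<^esub> g' (lmod_inj {1..n} ?N l v) \<in> ?Sp" unfolding eq by (rule sp(3))
      qed
      then show "?e \<odot>\<^bsub>M\<^esub> g (lmod_inj {..<s} (\<lambda>_. ?B) p w) \<in> ?Sp" unfolding g'w[OF w] .
    qed
    then show "m \<in> ?Sp" using b(2) by simp
  qed
  then show ?thesis
    by (rule F_catI[OF M \<I>[OF j] i H finS])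
qed

text \<open>The given maps from powers of the \<open>M_(I\<^sub>j)\<close> add up to a map from a power of \<open>B\<close>, after padding
  all exponents \<open>r j\<close> to a common \<open>s\<close>.  Its image contains \<open>e\<^sub>i m\<close> for all \<open>m\<close> and all \<open>i\<close>, as \<open>i\<close> is
  of the form \<open>j - 1\<close>.\<close>
lemma F_cat_Inter_subset_CM_B:
  assumes \<I>: "\<And>l. l \<in> {1..n} \<Longrightarrow> \<I> l \<in> k_subsets k n"
    and F: "\<And>j. j \<in> {1..n} \<Longrightarrow> M \<in> F_cat k n (\<I> j) (prevv n j)"
  shows "M \<in> CM_B k n (B_mod n \<I>)"
proof -
  let ?B = "B_mod n \<I>" and ?N = "\<lambda>l. MM (\<I> l)"
  have M: "M \<in> CM_C k n" using F[of 1] k_less by (simp add: F_cat_def)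
  have lm: "left_module C M" using M by (simp add: CM_C_def)
  interpret M: left_module C M by (rule lm)
  have lmB: "left_module C ?B" using \<I> by (rule left_module_B)
  have lmN: "left_module C (?N l)" if "l \<in> {1..n}" for l using left_module_MM[OF \<I>[OF that]] .
  have "\<exists>r f. f \<in> lmod_hom C (lmod_pow (?N j) r) M \<and>
      f ` vertex_part k n (prevv n j) (lmod_pow (?N j) r) = vertex_part k n (prevv n j) M"
    if "j \<in> {1..n}" for j using F[OF that] unfolding F_cat_def by blast
  then obtain r f where f: "\<And>j. j \<in> {1..n} \<Longrightarrow> f j \<in> lmod_hom C (lmod_pow (?N j) (r j)) M"
    "\<And>j. j \<in> {1..n} \<Longrightarrow> f j ` vertex_part k n (prevv n j) (lmod_pow (?N j) (r j)) = vertex_part k n (prevv n j) M"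
    by metis
  \<comment> \<open>Any common upper bound of the exponents would do.\<close>
  define s where "s = (\<Sum>j\<in>{1..n}. r j)"
  have rs: "r j \<le> s" if "j \<in> {1..n}" for j using that unfolding s_def by (intro member_le_sum) auto
  let ?P = "lmod_pow ?B s"
  have lmP: "left_module C ?P" by (rule left_module_lmod_sum[OF ring_C lmB])
  have lmR: "left_module C (lmod_pow (?N j) (r j))" if "j \<in> {1..n}" for j
    by (rule left_module_lmod_sum[OF ring_C lmN[OF that]])
  have upj: "u p j \<in> carrier (?N j)" if "u \<in> carrier ?P" "p < s" "j \<in> {1..n}" for u p j
  proof -
    have "u p \<in> carrier ?B" using that by (auto simp: lmod_sum_def)
    then show ?thesis using that(3) by (auto simp: B_mod_def lmod_sum_def)
  qed
  define \<pi> where "\<pi> j = (\<lambda>u\<in>carrier ?P. \<lambda>p\<in>{..<r j}. u p j)" for j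
  have \<pi>: "\<pi> j \<in> lmod_hom C ?P (lmod_pow (?N j) (r j))" if j: "j \<in> {1..n}" for j
    unfolding \<pi>_def
  proof (rule restrict_lmod_homI[OF lmP])
    fix u assume u: "u \<in> carrier ?P"
    show "(\<lambda>p\<in>{..<r j}. u p j) \<in> carrier (lmod_pow (?N j) (r j))"
      using upj[OF u _ j] rs[OF j] by (auto simp: lmod_sum_def)
  qed (use rs[OF j] j in \<open>auto simp: lmod_sum_def B_mod_def intro!: restrict_ext\<close>)
  define F where "F = (\<lambda>u\<in>carrier ?P. \<Oplus>\<^bsub>M\<^esub>j\<in>{1..n}. (\<lambda>u\<in>carrier ?P. f j (\<pi> j u)) u)"
  have F: "F \<in> lmod_hom C ?P M"
    unfolding F_def by (rule lmod_hom_pointwise_sum[OF lmP lm lmod_hom_comp[OF lmP \<pi> f(1)]])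
  let ?T = "F ` carrier ?P"
  interpret P: left_module C ?P by (rule lmP)
  have "m \<in> ?T" if "m \<in> carrier M" for m
    using lm that
  proof (rule idem_induct)
    show "\<zero>\<^bsub>M\<^esub> \<in> ?T" using lmod_hom_zero[OF lmP lm F] P.M.zero_closed by (metis image_eqI)
    show "u \<oplus>\<^bsub>M\<^esub> v \<in> ?T" if uv: "u \<in> ?T" "v \<in> ?T" for u v
    proof -
      obtain a b where "a \<in> carrier ?P" "b \<in> carrier ?P" "u = F a" "v = F b" using uv by blast
      then show ?thesis using lmod_hom_add[OF F, of a b] P.M.a_closed by (metis image_eqI)
    qed
    fix i assume i: "i \<in> {1..n}"
    define l where "l = nextv n i"
    have l: "l \<in> {1..n}" and li: "prevv n l = i" using nextv_range[OF i] prevv_nextv[OF i] by (auto simp: l_def)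
    interpret R: left_module C "lmod_pow (?N l) (r l)" by (rule lmR[OF l])
    have "C_idem k n i \<odot>\<^bsub>M\<^esub> m \<in> vertex_part k n i M" using that by (auto simp: vertex_part_def)
    then obtain v where v: "v \<in> carrier (lmod_pow (?N l) (r l))" "C_idem k n i \<odot>\<^bsub>M\<^esub> m = f l v"
      using f(2)[OF l] R.smult_closed[OF idem_closed[OF i]] unfolding li vertex_part_def by blast
    have vp: "v p \<in> carrier (?N l)" if "p < r l" for p using v(1) that by (auto simp: lmod_sum_def)
    define u where "u = (\<lambda>p\<in>{..<s}. lmod_inj {1..n} ?N l (if p < r l then v p else \<zero>\<^bsub>?N l\<^esub>))"
    have u: "u \<in> carrier ?P"
    proof -
      have "(if p < r l then v p else \<zero>\<^bsub>?N l\<^esub>) \<in> carrier (?N l)" for p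
        using vp by (auto simp: carrier_MM zero_MM)
      then show ?thesis
        unfolding u_def lmod_sum_def[of "{..<s}"] using lmod_inj_closed[of "{1..n}" C ?N, OF lmN l]
        by (auto simp: B_mod_def)
    qed
    have \<pi>u: "\<pi> j u = (if l = j then v else \<zero>\<^bsub>lmod_pow (?N j) (r j)\<^esub>)" if j: "j \<in> {1..n}" for j
    proof (cases "l = j")
      case True
      have "v \<in> extensional {..<r l}" using v(1) by (simp add: lmod_sum_def PiE_def)
      then show ?thesis using True u rs[OF j] j
        by (auto simp: \<pi>_def u_def lmod_inj_def fun_eq_iff extensional_def)
    next
      case False
      then show ?thesis using u rs[OF j] j
        by (auto simp: \<pi>_def u_def lmod_inj_def lmod_sum_def[of "{..<r j}"] intro!: restrict_ext)
    qed
    have flv: "f l v \<in> carrier M" by (rule lmod_hom_closed[OF f(1)[OF l] v(1)])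
    have "F u = (\<Oplus>\<^bsub>M\<^esub>j\<in>{1..n}. if l = j then f l v else \<zero>\<^bsub>M\<^esub>)"
      unfolding F_def using u
      by (simp, intro M.M.finsum_cong'[OF refl])
        (auto simp: \<pi>u flv lmod_hom_zero[OF lmR lm f(1)])
    also have "\<dots> = f l v"
      using M.M.finsum_singleton[of l "{1..n}" "\<lambda>_. f l v"] l flv by simp
    finally show "C_idem k n i \<odot>\<^bsub>M\<^esub> m \<in> ?T" using u v(2) by (metis image_eqI)
  qed
  then have "F ` carrier ?P = carrier M" using lmod_hom_closed[OF F] by blast
  then show ?thesis using F M unfolding CM_B_def by blast
qed

end

theorem proposition12p5:
  fixes k n :: nat and \<I> :: "nat \<Rightarrow> nat set"
  assumes "0 < k" and "k < n" and "necklace k n \<I>"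
  shows "(CM_B k n (B_mod n \<I>) :: (C_elem, 'm) module set)
             = (\<Inter>j\<in>{1..n}. F_cat k n (\<I> j) (prevv n j)) \<and>
         (GP_B k n (B_mod n \<I>) :: (C_elem, 'm) module set)
             = (\<Inter>j\<in>{1..n}. S_cat k n (\<I> j) (prevv n j))"
proof -
  interpret cyclic_quiver k n using assms by unfold_locales
  have \<I>: "\<I> j \<in> k_subsets k n" if "j \<in> {1..n}" for j
    using assms(3) that by (simp add: necklace_def)
  have le: "subset_le n j (\<I> j) (\<I> l)" if "j \<in> {1..n}" "l \<in> {1..n}" for j l
    using assms(3) that by (simp add: necklace_def)
  have CM: "(CM_B k n (B_mod n \<I>) :: (C_elem, 'm) module set)
      = (\<Inter>j\<in>{1..n}. F_cat k n (\<I> j) (prevv n j))"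
    using CM_B_subset_F_cat[of \<I>, OF \<I> le] F_cat_Inter_subset_CM_B[of \<I>, OF \<I>] by blast
  have "trivial_group (Ext1 C M (B_mod n \<I>)) \<longleftrightarrow> (\<forall>j\<in>{1..n}. trivial_group (Ext1 C M (MM (\<I> j))))"
    if "M \<in> CM_B k n (B_mod n \<I>)" for M :: "(C_elem, 'm) module"
  proof -
    have "left_module C M" using that by (simp add: CM_B_def CM_C_def)
    then show ?thesis
      unfolding B_mod_def by (rule Ext1_lmod_sum_trivial_iff[OF ring_C _ left_module_MM[OF \<I>]])
  qed
  then have "(GP_B k n (B_mod n \<I>) :: (C_elem, 'm) module set)
      = {M \<in> CM_B k n (B_mod n \<I>). \<forall>j\<in>{1..n}. trivial_group (Ext1 C M (MM (\<I> j)))}"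
    by (auto simp: GP_B_def)
  also have "\<dots> = (\<Inter>j\<in>{1..n}. S_cat k n (\<I> j) (prevv n j))"
    unfolding CM S_cat_def using k_less by auto
  finally show ?thesis using CM by blast
qed

end
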